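(* Let $n\ge 3$, and let $r,p,q$ be integers such that $1\le r\le n-1$ and $n=(r+2)p+q$, where $p\ge 0$ and $0\le q\le r+1$. Let $C_n$ be the cycle graph on $n$ vertices and $W_{n+1}$ the wheel graph on $n+1$ vertices. Then $$\mathrm{reg}(R_{W_{n+1}}/I_r(W_{n+1}))=\mathrm{reg}(R_{C_n}/I_r(C_n))=\begin{cases}rp+q-1 & \text{if } q\ne 0,\\ rp & \text{if } q=0.\end{cases}$$
   Context: $\mathbb K$ is a field. For a finite simple graph $G$ with vertex set $V(G)$, $R_G$ is the polynomial ring over $\mathbb K$ whose variables are the vertices of $G$ (standard grading). For a positive integer $r$, $I_r(G)\subseteq R_G$ is the square-free monomial ideal generated by the monomials $\prod_{x\in A}x$, where $A$ ranges over all subsets $A\subseteq V(G)$ with $|A|=r+1$ such that the induced subgraph $G[A]$ is connected. The wheel graph $W_{n+1}$ is obtained from $C_n$ by adding one new vertex adjacent to all $n$ vertices of $C_n$. $\beta_{i,j}(R/I)$ denotes the $(i,j)$-th graded Betti number of $R/I$, i.e. the multiplicity of $R(-j)$ in homological degree $i$ of its graded minimal free resolution, and the Castelnuovo-Mumford regularity is $\mathrm{reg}(R/I)=\max\{j-i\mid \beta_{i,j}(R/I)\ne 0\}$. *)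

theory Defs
  imports
    "HOL-Library.Poly_Mapping"
    "Jordan_Normal_Form.Matrix"
    "Graph_Theory.Digraph_Component"
begin

section \<open>Polynomial rings, homogeneous polynomials, ideals\<close>

text \<open>Polynomials with coefficients in \<open>'k\<close>: the exponent vectors are the finitely supported
  maps \<open>'v \<Rightarrow>\<^sub>0 nat\<close>. The polynomial ring with variable set \<open>V\<close> is the subring \<open>poly_ring V\<close>.\<close>

type_synonym ('v, 'k) mpoly = "('v \<Rightarrow>\<^sub>0 nat) \<Rightarrow>\<^sub>0 'k"

definition poly_ring :: "'v set \<Rightarrow> ('v, 'k::comm_ring_1) mpoly set" where
  "poly_ring V = {f. \<forall>m\<in>Poly_Mapping.keys f. Poly_Mapping.keys m \<subseteq> V}"

definition Var :: "'v \<Rightarrow> ('v, 'k::comm_ring_1) mpoly" where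
  "Var x = Poly_Mapping.single (Poly_Mapping.single x 1) 1"

definition mono_deg :: "('v \<Rightarrow>\<^sub>0 nat) \<Rightarrow> nat" where
  "mono_deg m = (\<Sum>x\<in>Poly_Mapping.keys m. Poly_Mapping.lookup m x)"

text \<open>As usual, \<open>0\<close> is homogeneous of every degree, and it is the only homogeneous polynomial of
  negative degree.\<close>

definition homogeneous :: "int \<Rightarrow> ('v, 'k::comm_ring_1) mpoly \<Rightarrow> bool" where
  "homogeneous d f \<longleftrightarrow> (\<forall>m\<in>Poly_Mapping.keys f. int (mono_deg m) = d)"

definition ideal_gen :: "'v set \<Rightarrow> ('v, 'k::comm_ring_1) mpoly set \<Rightarrow> ('v, 'k) mpoly set" where
  "ideal_gen V S = {\<Sum>s\<in>T. c s * s | T c. finite T \<and> T \<subseteq> S \<and> (\<forall>s\<in>T. c s \<in> poly_ring V)}"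


section \<open>Graded minimal free resolutions\<close>

definition free_module :: "'v set \<Rightarrow> nat \<Rightarrow> ('v, 'k::comm_ring_1) mpoly vec set" where
  "free_module V n = {v \<in> carrier_vec n. \<forall>k<n. v $ k \<in> poly_ring V}"

text \<open>
  A graded minimal free resolution
  \<open>\<dots> \<longrightarrow> F 2 \<longrightarrow> F 1 \<longrightarrow> F 0 \<longrightarrow> R/I \<longrightarrow> 0\<close>
  of \<open>R/I\<close> for \<open>R = poly_ring V\<close> and a homogeneous ideal \<open>I\<close> of \<open>R\<close>, in coordinates.

  \<^item> The list \<open>d i\<close> holds the degrees of the basis elements of \<open>F i\<close>, so that
    \<open>F i\<close> is the direct sum of the \<open>R(-j)\<close> for \<open>j\<close> in \<open>d i\<close> (with multiplicity).
  \<^item> The augmentation \<open>F 0 \<longrightarrow> R/I\<close> maps the \<open>k\<close>-th basis element to the class of \<open>e $ k\<close>; a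
    homogeneous element of \<open>R/I\<close> always has a homogeneous representative of the same degree.
  \<^item> The matrix \<open>D i\<close> is the differential \<open>F (i + 1) \<longrightarrow> F i\<close>. It is a map of degree \<open>0\<close>.
  \<^item> Minimality: every differential maps into \<open>\<mm> F i\<close>, with \<open>\<mm>\<close> the ideal of the variables.

  The length of the resolution is not restricted; \<open>F i = 0\<close> is expressed by \<open>d i = []\<close>.
\<close>

locale minimal_graded_free_resolution =
  fixes V :: "'v set"
    and I :: "('v, 'k::field) mpoly set"
    and d :: "nat \<Rightarrow> int list"
    and e :: "('v, 'k) mpoly vec"
    and D :: "nat \<Rightarrow> ('v, 'k) mpoly mat"
  assumes aug_carrier: "e \<in> free_module V (length (d 0))"
    and aug_homogeneous: "\<And>k. k < length (d 0) \<Longrightarrow> homogeneous (d 0 ! k) (e $ k)"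
    and aug_surjective:
      "\<And>f. f \<in> poly_ring V \<Longrightarrow> \<exists>v\<in>free_module V (length (d 0)). f - e \<bullet> v \<in> I"
    and diff_carrier: "\<And>i. D i \<in> carrier_mat (length (d i)) (length (d (Suc i)))"
    and diff_entries: "\<And>i k l. k < length (d i) \<Longrightarrow> l < length (d (Suc i)) \<Longrightarrow>
      D i $$ (k, l) \<in> poly_ring V"
    and diff_homogeneous: "\<And>i k l. k < length (d i) \<Longrightarrow> l < length (d (Suc i)) \<Longrightarrow>
      homogeneous (d (Suc i) ! l - d i ! k) (D i $$ (k, l))"
    and exact_aug: "{v \<in> free_module V (length (d 0)). e \<bullet> v \<in> I} =
      (\<lambda>w. D 0 *\<^sub>v w) ` free_module V (length (d 1))"
    and exact_diff: "\<And>i. {v \<in> free_module V (length (d (Suc i))). D i *\<^sub>v v = 0\<^sub>v (length (d i))} =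
      (\<lambda>w. D (Suc i) *\<^sub>v w) ` free_module V (length (d (Suc (Suc i))))"
    and minimal: "\<And>i k l. k < length (d i) \<Longrightarrow> l < length (d (Suc i)) \<Longrightarrow>
      D i $$ (k, l) \<in> ideal_gen V (Var ` V)"

text \<open>The graded minimal free resolution is unique up to isomorphism, so choosing one is
  harmless.\<close>

definition resolution_degrees :: "'v set \<Rightarrow> ('v, 'k::field) mpoly set \<Rightarrow> nat \<Rightarrow> int list" where
  "resolution_degrees V I = (SOME d. \<exists>e D. minimal_graded_free_resolution V I d e D)"

definition graded_betti :: "'v set \<Rightarrow> ('v, 'k::field) mpoly set \<Rightarrow> nat \<Rightarrow> int \<Rightarrow> nat" where
  "graded_betti V I i j = count_list (resolution_degrees V I i) j"

text \<open>The Castelnuovo--Mumford regularity of \<open>R/I\<close> for \<open>R = poly_ring V\<close>.\<close>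

definition regularity :: "'v set \<Rightarrow> ('v, 'k::field) mpoly set \<Rightarrow> int" where
  "regularity V I = Max {j - int i | i j. graded_betti V I i j \<noteq> 0}"


section \<open>Graphs and their \<open>r\<close>-connected ideals\<close>

text \<open>Finite simple graphs are digraphs satisfying \<^locale>\<open>pair_graph\<close>: finite, loop-free, and
  with a symmetric set of arcs.\<close>

definition connected_ideal :: "'v pair_pre_digraph \<Rightarrow> nat \<Rightarrow> ('v, 'k::field) mpoly set" where
  "connected_ideal G r = ideal_gen (pverts G)
     {\<Prod>x\<in>A. Var x | A. A \<subseteq> pverts G \<and> card A = r + 1 \<and>
        Digraph_Component.connected (with_proj G \<restriction> A)}"

definition cycle_graph :: "nat \<Rightarrow> nat pair_pre_digraph" where
  "cycle_graph n = \<lparr> pverts = {..<n},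
     parcs = {(i, j). i < n \<and> j < n \<and> (j = (i + 1) mod n \<or> i = (j + 1) mod n)} \<rparr>"

text \<open>The wheel on \<open>n + 1\<close> vertices; its hub is the vertex \<open>n\<close>.\<close>

definition wheel_graph :: "nat \<Rightarrow> nat pair_pre_digraph" where
  "wheel_graph n = \<lparr> pverts = insert n (pverts (cycle_graph n)),
     parcs = parcs (cycle_graph n) \<union> {n} \<times> pverts (cycle_graph n) \<union> pverts (cycle_graph n) \<times> {n} \<rparr>"

lemma pair_graph_cycle_graph:
  assumes "n \<ge> 3"
  shows "pair_graph (cycle_graph n)"
proof
  show "finite (parcs (cycle_graph n))"
    by (rule finite_subset[of _ "{..<n} \<times> {..<n}"]) (auto simp: cycle_graph_def)
  show "fst a \<noteq> snd a" if "a \<in> parcs (cycle_graph n)" for a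
    using that assms by (auto simp: cycle_graph_def mod_Suc split: if_splits)
qed (auto simp: cycle_graph_def symmetric_def sym_def)

lemma pair_graph_wheel_graph:
  assumes "n \<ge> 3"
  shows "pair_graph (wheel_graph n)"
proof -
  interpret C: pair_graph "cycle_graph n"
    by (rule pair_graph_cycle_graph[OF assms])
  have new: "n \<notin> pverts (cycle_graph n)"
    by (simp add: cycle_graph_def)
  show ?thesis
  proof
    show "fst a \<noteq> snd a" if "a \<in> parcs (wheel_graph n)" for a
      using that new C.pair_no_loops by (auto simp: wheel_graph_def)
    show "symmetric (with_proj (wheel_graph n))"
      using C.pair_sym_arcs by (auto simp: wheel_graph_def symmetric_def sym_def)
  qed (use C.arc_fst_in_verts C.arc_snd_in_verts C.pair_finite_verts C.pair_finite_arcs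
        in \<open>fastforce simp: wheel_graph_def\<close>)+
qed

end

(*
Everything is translated into simplicial cohomology. Computing the Tor groups of R/I from a minimal
free resolution and from the Koszul complex, and splitting the latter into multidegrees (Hochster's
formula), shows that reg(R/I) is the largest t such that some induced subcomplex of the
Stanley-Reisner complex has nonzero reduced cohomology in dimension t - 1.

For a path the link of the vertex r + 2 is a cone over the first vertex, so that deleting it splits
off the boundary of an r-simplex: the cohomology of a path is that of the path with r + 2 vertices
fewer, shifted by r. This settles the proper induced subcomplexes of the cycle. For the whole cycle
one passes successively to the links of {0}, {0, 1}, ..., {0, ..., r - 1}; all deletions met on the
way are paths with a shortened last generator, and the last link is a path. For the wheel, the
link of the hub has no simplices with r or more vertices, so it changes nothing above degree r.
*)

theory Submission
  imports Defs "HOL-Library.Function_Algebras"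
begin

section \<open>Simplicial cochains, links and deletions\<close>

text \<open>\<open>resolution_degrees\<close> is an arbitrary choice, so a minimal resolution must
  exist and its degrees must not depend on the choice. Koszul homology settles both: along a minimal
  presentation it passes from homological degree \<open>Suc p\<close> of a module to degree
  \<open>p\<close> of its syzygies, and in degree 0 it shows the degrees of the generators. Two
  resolutions are never compared, and vanishing in large internal degrees replaces the Hilbert basis
  theorem.

  Regularity only asks which Betti numbers are nonzero, so every long exact sequence is used only at
  a term between two vanishing ones.

  The case distinction arises as follows. For \<open>p \<ge> 1\<close> the deletion of
  \<open>a\<close> in the link of \<open>{..<a}\<close> is a path on \<open>n - (a + 1)\<close>
  vertices with last generator of size \<open>r + 1 - a\<close>; it has cohomology only if
  \<open>q = a + 1\<close> or \<open>q = 0\<close>. For \<open>q \<noteq> 0\<close> a single path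
  contributes, in degree \<open>r * p\<close>, and the \<open>q - 1\<close> links before it add one
  each. For \<open>q = 0\<close> deletions and shifted links contribute in one common degree; the
  cycle itself then supplies only vanishing elsewhere, and the path \<open>{1..<n}\<close> attains
  the maximum.\<close>

definition esgn :: "'v::linorder \<Rightarrow> 'v set \<Rightarrow> 'a::comm_ring_1" where
  "esgn v T = (-1) ^ card {z \<in> T. z < v}"

definition cobd :: "('v::linorder set \<Rightarrow> 'k::field) \<Rightarrow> 'v set \<Rightarrow> 'k" where
  "cobd g T = (\<Sum>y\<in>T. esgn y T * g (T - {y}))"

text \<open>Interior multiplication by \<open>v\<close>. The value 0 on sets containing
  \<open>v\<close> makes it square to zero.\<close>

definition contr :: "'v::linorder \<Rightarrow> ('v set \<Rightarrow> 'k::field) \<Rightarrow> 'v set \<Rightarrow> 'k" where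
  "contr v g T = (if v \<in> T then 0 else esgn v T * g (insert v T))"

definition del_ext :: "'v::linorder \<Rightarrow> ('v set \<Rightarrow> 'k::field) \<Rightarrow> 'v set \<Rightarrow> 'k" where
  "del_ext v g T = (if v \<in> T then 0 else g T)"

text \<open>Right inverse of \<open>contr v\<close> on sets avoiding \<open>v\<close>: a cochain of
  the link is moved to the simplices through \<open>v\<close>, one cardinality higher.\<close>

definition link_ext :: "'v::linorder \<Rightarrow> ('v set \<Rightarrow> 'k::field) \<Rightarrow> 'v set \<Rightarrow> 'k" where
  "link_ext v g T = (if v \<in> T then esgn v T * g (T - {v}) else 0)"

lemma esgn_square [simp]: "esgn v T * esgn v T = (1 :: 'a::comm_ring_1)"
  by (simp add: esgn_def flip: power_mult_distrib)

lemma esgn_square_left [simp]: "esgn v T * (esgn v T * x) = (x :: 'a::comm_ring_1)"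
  by (simp flip: mult.assoc)

lemma esgn_insert_self [simp]: "esgn v (insert v T) = esgn v T"
  unfolding esgn_def by (rule arg_cong[where f = "\<lambda>A. (-1) ^ card A"]) auto

lemma esgn_Diff_self [simp]: "esgn v (T - {v}) = esgn v T"
  unfolding esgn_def by (rule arg_cong[where f = "\<lambda>A. (-1) ^ card A"]) auto

lemma esgn_insert:
  assumes "finite T" "v \<notin> T"
  shows "esgn y (insert v T) = (if v < y then - esgn y T else (esgn y T :: 'a::comm_ring_1))"
proof -
  have "{z \<in> insert v T. z < y} = (if v < y then insert v {z \<in> T. z < y} else {z \<in> T. z < y})"
    by auto
  then show ?thesis using assms by (simp add: esgn_def)
qed

text \<open>Exactly one of the two signs changes, the one belonging to the larger of
  \<open>v\<close> and \<open>y\<close>; hence the overall minus.\<close>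

lemma esgn_insert_Diff:
  assumes "finite T" "v \<notin> T" "y \<in> T"
  shows "esgn v T * esgn y (insert v T) = - (esgn y T * esgn v (T - {y}) :: 'a::comm_ring_1)"
proof -
  have 1: "esgn v T = (if y < v then - esgn v (T - {y}) else (esgn v (T - {y}) :: 'a))"
    using esgn_insert[of "T - {y}" y v, where 'a = 'a] assms by (simp add: insert_absorb)
  have 2: "esgn y (insert v T) = (if v < y then - esgn y T else (esgn y T :: 'a))"
    using assms by (simp add: esgn_insert)
  have "v \<noteq> y" using assms by auto
  then show ?thesis unfolding 1 2 by (cases v y rule: linorder_cases) (auto simp: mult.commute)
qed

text \<open>The homotopy formula: the two composites of \<open>contr v\<close> and
  \<open>cobd\<close> add up to the identity on sets avoiding \<open>v\<close>. It expresses a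
  coboundary on a simplex through \<open>v\<close> by data on the opposite face, which is how cones,
  links and deletions are treated below.\<close>

lemma cobd_insert:
  assumes "finite T" "v \<notin> T"
  shows "esgn v T * cobd g (insert v T) = g T - cobd (contr v g) T"
proof -
  have "cobd g (insert v T) = esgn v T * g T
      + (\<Sum>y\<in>T. esgn y (insert v T) * g (insert v (T - {y})))"
    using assms by (simp add: cobd_def insert_Diff_if) (intro sum.cong, auto)
  then have "esgn v T * cobd g (insert v T)
     = g T + (\<Sum>y\<in>T. (esgn v T * esgn y (insert v T)) * g (insert v (T - {y})))"
    by (simp add: distrib_left sum_distrib_left mult.assoc)
  also have "(\<Sum>y\<in>T. (esgn v T * esgn y (insert v T)) * g (insert v (T - {y})))
     = - cobd (contr v g) T"
    using assms by (auto simp: cobd_def contr_def esgn_insert_Diff mult.assoc sum_negf[symmetric]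
      intro!: sum.cong)
  finally show ?thesis by simp
qed

lemma cobd_insert':
  assumes "finite T" "v \<notin> T"
  shows "cobd g (insert v T) = esgn v T * (g T - cobd (contr v g) T)"
  using arg_cong[OF cobd_insert[OF assms], of "\<lambda>x. esgn v T * x"] by simp

lemma cobd_cong: "(\<And>y. y \<in> T \<Longrightarrow> g (T - {y}) = h (T - {y})) \<Longrightarrow> cobd g T = cobd h T"
  by (simp add: cobd_def)

lemma cobd_zero: "(\<And>y. y \<in> T \<Longrightarrow> g (T - {y}) = 0) \<Longrightarrow> cobd g T = 0"
  by (simp add: cobd_def)

lemma cobd_diff: "cobd (\<lambda>T. g T - h T) T = cobd g T - cobd h T"
  by (simp add: cobd_def right_diff_distrib sum_subtractf)

text \<open>Splitting off a vertex by the homotopy formula leaves the same claim for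
  \<open>contr v g\<close> on the smaller set; for this the induction is general in
  \<open>g\<close>.\<close>

lemma cobd_cobd: "finite T \<Longrightarrow> cobd (cobd g) T = 0"
proof (induction T arbitrary: g rule: finite_induct)
  case empty
  then show ?case by (simp add: cobd_def)
next
  case (insert v T)
  have "cobd (contr v (cobd g)) T = cobd (\<lambda>T. g T - cobd (contr v g) T) T"
    using insert.hyps
    by (intro cobd_cong) (auto simp: contr_def cobd_insert)
  with insert show ?case by (simp add: cobd_insert' cobd_diff)
qed

lemma cobd_del_ext: "v \<notin> T \<Longrightarrow> cobd (del_ext v g) T = cobd g T"
  by (intro cobd_cong) (auto simp: del_ext_def)

lemma contr_link_ext [simp]: "v \<notin> T \<Longrightarrow> contr v (link_ext v g) T = g T"
  by (simp add: contr_def link_ext_def)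

lemma cobd_contr_link_ext: "v \<notin> T \<Longrightarrow> cobd (contr v (link_ext v g)) T = cobd g T"
  by (intro cobd_cong) auto

lemma cobd_link_ext: "v \<notin> T \<Longrightarrow> cobd (link_ext v g) T = 0"
  by (intro cobd_zero) (auto simp: link_ext_def)

text \<open>Cochains are indexed by the cardinality of the simplex, so that \<open>vanishing TYPE('k) t K\<close>
  says that the reduced cohomology of \<open>K\<close> in dimension \<open>t - 1\<close> is zero. A cochain is an arbitrary
  function on sets, whose values outside \<open>K\<close> are irrelevant. The empty family
  has vanishing cohomology in all degrees.\<close>

definition vanishing :: "'k::field itself \<Rightarrow> nat \<Rightarrow> 'v::linorder set set \<Rightarrow> bool" where
  "vanishing _ t K \<longleftrightarrow> (\<forall>g :: 'v set \<Rightarrow> 'k.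
     (\<forall>T\<in>K. card T = Suc t \<longrightarrow> cobd g T = 0) \<longrightarrow> (\<exists>h. \<forall>T\<in>K. card T = t \<longrightarrow> g T = cobd h T))"

text \<open>\<open>\<G>\<close> may contain non-minimal sets and sets not inside
  \<open>\<sigma>\<close>. Hence an induced subcomplex only changes \<open>\<sigma>\<close>, and a
  link only removes its vertex from \<open>\<sigma>\<close> and from the generators. If
  \<open>{} \<in> \<G>\<close>, no simplex is left, not even the empty one.\<close>

definition cpx :: "'v set \<Rightarrow> 'v set set \<Rightarrow> 'v set set" where
  "cpx \<sigma> \<G> = {T. T \<subseteq> \<sigma> \<and> (\<forall>A\<in>\<G>. \<not> A \<subseteq> T)}"

definition link_gens :: "'v \<Rightarrow> 'v set set \<Rightarrow> 'v set set" where
  "link_gens v \<G> = (\<lambda>A. A - {v}) ` \<G>"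

lemma cpx_subset: "T \<in> cpx \<sigma> \<G> \<Longrightarrow> S \<subseteq> T \<Longrightarrow> S \<in> cpx \<sigma> \<G>"
  unfolding cpx_def by blast

lemma cpx_del: "T \<in> cpx (\<sigma> - {v}) \<G> \<longleftrightarrow> v \<notin> T \<and> T \<in> cpx \<sigma> \<G>"
  by (auto simp: cpx_def)

lemma cpx_link:
  "v \<in> \<sigma> \<Longrightarrow> T \<in> cpx (\<sigma> - {v}) (link_gens v \<G>) \<longleftrightarrow> v \<notin> T \<and> insert v T \<in> cpx \<sigma> \<G>"
  by (auto simp: cpx_def link_gens_def)

lemma cpx_link_subset:
  "T \<in> cpx (\<sigma> - {v}) (link_gens v \<G>) \<Longrightarrow> T \<in> cpx (\<sigma> - {v}) \<G>"
  unfolding cpx_def link_gens_def by blast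

lemma vanishingE:
  fixes g :: "'v::linorder set \<Rightarrow> 'k::field"
  assumes "vanishing TYPE('k) t K"
    and "\<And>T. T \<in> K \<Longrightarrow> card T = Suc t \<Longrightarrow> cobd g T = 0"
  obtains h where "\<And>T. T \<in> K \<Longrightarrow> card T = t \<Longrightarrow> g T = cobd h T"
  using assms unfolding vanishing_def by blast

lemma vanishing_trivial: "finite \<sigma> \<Longrightarrow> card \<sigma> < t \<Longrightarrow> vanishing TYPE('k::field) t (cpx \<sigma> \<G>)"
  unfolding vanishing_def cpx_def using card_mono[of \<sigma>] by (metis (no_types, lifting) mem_Collect_eq not_le)

text \<open>By the last hypothesis adding \<open>v\<close> to a simplex never completes a generator,
  so \<open>v\<close> is a cone point, and \<open>contr v g\<close> is a primitive of every cocycle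
  \<open>g\<close>.\<close>

lemma vanishing_cone:
  assumes "finite \<sigma>" "v \<in> \<sigma>"
    and "\<And>A. A \<in> \<G> \<Longrightarrow> A \<subseteq> \<sigma> \<Longrightarrow> v \<in> A \<Longrightarrow> \<exists>B\<in>\<G>. B \<subseteq> A - {v}"
  shows "vanishing TYPE('k::field) t (cpx \<sigma> \<G>)"
  unfolding vanishing_def
proof (intro allI impI exI ballI)
  fix g :: "'a set \<Rightarrow> 'k" and T
  assume g: "\<forall>T\<in>cpx \<sigma> \<G>. card T = Suc t \<longrightarrow> cobd g T = 0"
    and T: "T \<in> cpx \<sigma> \<G>" "card T = t"
  have fin: "finite T" using T(1) assms(1) by (auto simp: cpx_def intro: finite_subset)
  show "g T = cobd (contr v g) T"
  proof (cases "v \<in> T")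
    case True
    then obtain S where S: "T = insert v S" "v \<notin> S" by (meson mk_disjoint_insert)
    \<comment> \<open>On simplices through \<open>v\<close> the identity holds for any cochain,
      since \<open>contr v\<close> squares to zero.\<close>
    have "cobd (contr v (contr v g)) S = 0"
      by (intro cobd_zero) (auto simp: contr_def)
    then show ?thesis using S fin by (simp add: cobd_insert') (simp add: contr_def)
  next
    case False
    have "insert v T \<in> cpx \<sigma> \<G>"
      using T(1) assms(2,3) unfolding cpx_def
      by (smt (verit, ccfv_threshold) insert_subset mem_Collect_eq subset_insert_iff subset_trans
          Diff_subset)
    then have "cobd g (insert v T) = 0" using g T(2) False fin by simp
    then show ?thesis using cobd_insert[OF fin False, of g] by simp
  qed
qed

section \<open>The long exact sequence of link and deletion\<close>

context
  fixes \<sigma> :: "'v::linorder set" and v :: 'v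
  assumes fin: "finite \<sigma>" and v: "v \<in> \<sigma>"
begin

lemma finite_del_simplex: "T \<in> cpx (\<sigma> - {v}) \<G> \<Longrightarrow> finite T \<and> v \<notin> T"
  using fin by (auto simp: cpx_def intro: finite_subset)

lemma cpx_cases:
  assumes "T \<in> cpx \<sigma> \<G>"
  obtains "T \<in> cpx (\<sigma> - {v}) \<G>" "v \<notin> T" "finite T"
  | S where "T = insert v S" "v \<notin> S" "finite S" "S \<in> cpx (\<sigma> - {v}) (link_gens v \<G>)"
      "S \<in> cpx (\<sigma> - {v}) \<G>"
proof (cases "v \<in> T")
  case True
  then have "T = insert v (T - {v})" by auto
  moreover have "T - {v} \<in> cpx (\<sigma> - {v}) (link_gens v \<G>)"
    using assms True by (simp add: cpx_link[OF v] insert_absorb)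
  moreover have "T - {v} \<in> cpx (\<sigma> - {v}) \<G>"
    using assms by (simp add: cpx_del cpx_subset)
  ultimately show ?thesis using that(2) finite_del_simplex by blast
next
  case False
  then have "T \<in> cpx (\<sigma> - {v}) \<G>" using assms by (simp add: cpx_del)
  then show ?thesis using that(1) finite_del_simplex[of T] False by blast
qed

text \<open>Lowest degree of \<open>vanishing_Suc_of_del_link\<close>, where the link would enter in
  degree -1: the only simplex of cardinality 0 is the empty set, which the deletion shares with the
  complex.\<close>

lemma vanishing_0_of_del:
  assumes "vanishing TYPE('k::field) 0 (cpx (\<sigma> - {v}) \<G>)"
  shows "vanishing TYPE('k) 0 (cpx \<sigma> \<G>)"
  unfolding vanishing_def
proof (intro allI impI exI ballI)
  fix g :: "'v set \<Rightarrow> 'k" and T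
  assume g: "\<forall>T\<in>cpx \<sigma> \<G>. card T = Suc 0 \<longrightarrow> cobd g T = 0"
    and T: "T \<in> cpx \<sigma> \<G>" "card T = 0"
  have "finite T" using T(1) fin unfolding cpx_def by (blast intro: finite_subset)
  then have T0: "T = {}" using T by simp
  obtain h where "\<And>T. T \<in> cpx (\<sigma> - {v}) \<G> \<Longrightarrow> card T = 0 \<Longrightarrow> g T = cobd h T"
    using vanishingE[OF assms, of g] g by (auto simp: cpx_del)
  then show "g T = cobd (\<lambda>_. 0) T"
    using T T0 by (simp add: cpx_del cobd_def)
qed

text \<open>Exactness at the complex, where relative cochains are cochains of the link shifted by
  one. After subtracting a primitive on the deletion, the cocycle is supported on simplices through
  \<open>v\<close> and so comes from the link.\<close>

lemma vanishing_Suc_of_del_link: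
  assumes del: "vanishing TYPE('k::field) (Suc t) (cpx (\<sigma> - {v}) \<G>)"
    and link: "vanishing TYPE('k) t (cpx (\<sigma> - {v}) (link_gens v \<G>))"
  shows "vanishing TYPE('k) (Suc t) (cpx \<sigma> \<G>)"
  unfolding vanishing_def
proof (intro allI impI)
  fix g :: "'v set \<Rightarrow> 'k"
  assume g: "\<forall>T\<in>cpx \<sigma> \<G>. card T = Suc (Suc t) \<longrightarrow> cobd g T = 0"
  then obtain h where h: "\<And>T. T \<in> cpx (\<sigma> - {v}) \<G> \<Longrightarrow> card T = Suc t \<Longrightarrow> g T = cobd h T"
    using vanishingE[OF del, of g] by (auto simp: cpx_del)
  define h1 where "h1 = del_ext v h"
  define g1 where "g1 = (\<lambda>T. g T - cobd h1 T)"
  have g1_del: "g1 T = 0" if "T \<in> cpx (\<sigma> - {v}) \<G>" "card T = Suc t" for T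
    using h[OF that] that by (simp add: g1_def h1_def cobd_del_ext cpx_del)
  have "cobd (contr v g1) T = 0"
    if T: "T \<in> cpx (\<sigma> - {v}) (link_gens v \<G>)" "card T = Suc t" for T
  proof -
    have vT: "finite T" "v \<notin> T" "insert v T \<in> cpx \<sigma> \<G>"
      using T cpx_link[OF v] finite_del_simplex by blast+
    have "cobd g (insert v T) = 0" using g vT T by simp
    then have "cobd g1 (insert v T) = 0"
      using vT by (simp add: g1_def cobd_diff cobd_cobd)
    moreover have "g1 T = 0"
      using g1_del[of T] vT(2) T(2) cpx_subset[OF vT(3), of T] by (auto simp: cpx_del)
    ultimately show ?thesis using cobd_insert[OF vT(1,2), of g1] by simp
  qed
  then obtain u where u: "\<And>T. T \<in> cpx (\<sigma> - {v}) (link_gens v \<G>) \<Longrightarrow> card T = t \<Longrightarrow>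
      contr v g1 T = cobd u T"
    using vanishingE[OF link] by blast
  \<comment> \<open>The minus sign cancels the one in \<open>cobd_insert'\<close>.\<close>
  define h2 where "h2 = link_ext v (\<lambda>T. - u T)"
  have "g1 T = cobd h2 T" if T: "T \<in> cpx \<sigma> \<G>" "card T = Suc t" for T
    using T(1)
  proof (cases rule: cpx_cases)
    case 1
    then show ?thesis using g1_del T by (simp add: h2_def cobd_link_ext)
  next
    case (2 S)
    then have "card S = t" using T by simp
    have "cobd h2 (insert v S) = esgn v S * cobd u S"
      using 2 by (simp add: h2_def cobd_insert' cobd_contr_link_ext link_ext_def)
        (simp add: cobd_def sum_negf)
    also have "\<dots> = esgn v S * contr v g1 S" using u 2 \<open>card S = t\<close> by simp
    also have "\<dots> = g1 (insert v S)" using 2 by (simp add: contr_def)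
    finally show ?thesis using 2 by simp
  qed
  then have "g T = cobd (\<lambda>T. h1 T - - h2 T) T" if "T \<in> cpx \<sigma> \<G>" "card T = Suc t" for T
    using that by (simp add: g1_def cobd_diff diff_eq_eq) (simp add: cobd_def distrib_left sum.distrib)
  then show "\<exists>h. \<forall>T\<in>cpx \<sigma> \<G>. card T = Suc t \<longrightarrow> g T = cobd h T" by blast
qed

text \<open>Exactness at the deletion. A primitive \<open>u\<close> of the restriction of
  \<open>g\<close> to the link is what allows \<open>g\<close> to be extended over the simplices
  through \<open>v\<close> as a cocycle.\<close>

lemma vanishing_del_of_link:
  assumes full: "vanishing TYPE('k::field) t (cpx \<sigma> \<G>)"
    and link: "vanishing TYPE('k) t (cpx (\<sigma> - {v}) (link_gens v \<G>))"
  shows "vanishing TYPE('k) t (cpx (\<sigma> - {v}) \<G>)"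
  unfolding vanishing_def
proof (intro allI impI)
  fix g :: "'v set \<Rightarrow> 'k"
  assume g: "\<forall>T\<in>cpx (\<sigma> - {v}) \<G>. card T = Suc t \<longrightarrow> cobd g T = 0"
  have sub: "T \<in> cpx (\<sigma> - {v}) \<G>" if "T \<in> cpx (\<sigma> - {v}) (link_gens v \<G>)" for T
    using that by (rule cpx_link_subset)
  obtain u where u: "\<And>T. T \<in> cpx (\<sigma> - {v}) (link_gens v \<G>) \<Longrightarrow> card T = t \<Longrightarrow> g T = cobd u T"
    using vanishingE[OF link, of g] g sub by blast
  define g1 where "g1 = (\<lambda>T. if v \<in> T then link_ext v u T else g T)"
  have g1v: "cobd (contr v g1) S = cobd u S" if "v \<notin> S" for S
    using that by (intro cobd_cong) (auto simp: g1_def contr_def link_ext_def)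
  have "cobd g1 T = 0" if T: "T \<in> cpx \<sigma> \<G>" "card T = Suc t" for T
    using T(1)
  proof (cases rule: cpx_cases)
    case 1
    have "cobd g1 T = cobd g T" using 1 by (intro cobd_cong) (auto simp: g1_def)
    then show ?thesis using g 1 T by simp
  next
    case (2 S)
    then have "card S = t" using T by simp
    then show ?thesis using 2 u[of S] by (simp add: cobd_insert' g1v) (simp add: g1_def)
  qed
  then obtain h where h: "\<And>T. T \<in> cpx \<sigma> \<G> \<Longrightarrow> card T = t \<Longrightarrow> g1 T = cobd h T"
    using vanishingE[OF full] by blast
  have "g T = cobd h T" if "T \<in> cpx (\<sigma> - {v}) \<G>" "card T = t" for T
    using h[of T] that by (simp add: cpx_del g1_def)
  then show "\<exists>h. \<forall>T\<in>cpx (\<sigma> - {v}) \<G>. card T = t \<longrightarrow> g T = cobd h T" by blast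
qed

text \<open>Exactness at the link. Moved to the simplices through \<open>v\<close>, \<open>g\<close>
  is a cocycle of the complex that is 0 on the deletion. Its primitive \<open>h\<close> is therefore
  closed there; removing \<open>cobd w\<close> leaves a cochain whose contraction with
  \<open>v\<close> is, up to sign, a primitive of \<open>g\<close>.\<close>

lemma vanishing_link_of_del:
  assumes full: "vanishing TYPE('k::field) (Suc t) (cpx \<sigma> \<G>)"
    and del: "vanishing TYPE('k) t (cpx (\<sigma> - {v}) \<G>)"
  shows "vanishing TYPE('k) t (cpx (\<sigma> - {v}) (link_gens v \<G>))"
  unfolding vanishing_def
proof (intro allI impI)
  fix g :: "'v set \<Rightarrow> 'k"
  assume g: "\<forall>T\<in>cpx (\<sigma> - {v}) (link_gens v \<G>). card T = Suc t \<longrightarrow> cobd g T = 0"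
  have sub: "T \<in> cpx (\<sigma> - {v}) \<G>" if "T \<in> cpx (\<sigma> - {v}) (link_gens v \<G>)" for T
    using that by (rule cpx_link_subset)
  define g0 where "g0 = link_ext v g"
  have "cobd g0 T = 0" if T: "T \<in> cpx \<sigma> \<G>" "card T = Suc (Suc t)" for T
    using T(1)
  proof (cases rule: cpx_cases)
    case 1
    then show ?thesis by (simp add: g0_def cobd_link_ext)
  next
    case (2 S)
    then have "cobd g S = 0" using T g by simp
    then show ?thesis using 2
      by (simp add: g0_def cobd_insert' cobd_contr_link_ext) (simp add: link_ext_def)
  qed
  then obtain h where h: "\<And>T. T \<in> cpx \<sigma> \<G> \<Longrightarrow> card T = Suc t \<Longrightarrow> g0 T = cobd h T"
    using vanishingE[OF full] by blast
  have "cobd h T = 0" if "T \<in> cpx (\<sigma> - {v}) \<G>" "card T = Suc t" for T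
    using h[of T] that by (simp add: cpx_del g0_def link_ext_def)
  then obtain w where w: "\<And>T. T \<in> cpx (\<sigma> - {v}) \<G> \<Longrightarrow> card T = t \<Longrightarrow> h T = cobd w T"
    using vanishingE[OF del] by blast
  define h1 where "h1 = (\<lambda>T. h T - cobd (del_ext v w) T)"
  have "g T = cobd (\<lambda>T. - contr v h1 T) T"
    if T: "T \<in> cpx (\<sigma> - {v}) (link_gens v \<G>)" "card T = t" for T
  proof -
    have vT: "finite T" "v \<notin> T" "insert v T \<in> cpx \<sigma> \<G>"
      using T cpx_link[OF v] finite_del_simplex by blast+
    have h1T: "h1 T = 0" using w[OF sub[OF T(1)] T(2)] vT by (simp add: h1_def cobd_del_ext)
    have "g T = esgn v T * g0 (insert v T)" using vT by (simp add: g0_def link_ext_def)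
    also have "\<dots> = esgn v T * cobd h (insert v T)" using h[OF vT(3)] vT T by simp
    also have "cobd h (insert v T) = cobd h1 (insert v T)"
      using vT by (simp add: h1_def cobd_diff cobd_cobd)
    also have "esgn v T * cobd h1 (insert v T) = - cobd (contr v h1) T"
      using vT h1T by (simp add: cobd_insert)
    finally show ?thesis by (simp add: cobd_def sum_negf)
  qed
  then show "\<exists>h. \<forall>T\<in>cpx (\<sigma> - {v}) (link_gens v \<G>). card T = t \<longrightarrow> g T = cobd h T" by blast
qed

end

section \<open>Concentrated complexes and the splitting off of simplex boundaries\<close>

abbreviation van :: "'k::field itself \<Rightarrow> nat \<Rightarrow> 'v::linorder set \<Rightarrow> 'v set set \<Rightarrow> bool" where
  "van k t \<sigma> \<G> \<equiv> vanishing k t (cpx \<sigma> \<G>)"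

definition acyclic_cpx :: "'k::field itself \<Rightarrow> 'v::linorder set set \<Rightarrow> bool" where
  "acyclic_cpx k K \<longleftrightarrow> (\<forall>t. vanishing k t K)"

text \<open>Asserts that the cohomology in degree \<open>t\<^sub>0\<close> is nonzero, without
  fixing its dimension.\<close>

definition concentrated :: "'k::field itself \<Rightarrow> nat \<Rightarrow> 'v::linorder set set \<Rightarrow> bool" where
  "concentrated k t\<^sub>0 K \<longleftrightarrow> (\<forall>t. vanishing k t K \<longleftrightarrow> t \<noteq> t\<^sub>0)"

lemma cpx_cong:
  "(\<And>T. T \<subseteq> \<sigma> \<Longrightarrow> (\<exists>A\<in>\<G>. A \<subseteq> T) \<longleftrightarrow> (\<exists>A\<in>\<H>. A \<subseteq> T)) \<Longrightarrow> cpx \<sigma> \<G> = cpx \<sigma> \<H>"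
  unfolding cpx_def by (intro Collect_cong conj_cong refl) metis

lemma concentrated_empty:
  assumes "{} \<notin> \<G>"
  shows "concentrated TYPE('k::field) 0 (cpx ({} :: 'v::linorder set) \<G>)"
proof -
  have K: "cpx {} \<G> = {{}}" using assms by (auto simp: cpx_def)
  have "\<not> vanishing TYPE('k) 0 {{} :: 'v set}"
    unfolding vanishing_def by (auto simp: cobd_def intro!: exI[of _ "\<lambda>_. 1"])
  moreover have "vanishing TYPE('k) t {{} :: 'v set}" if "t \<noteq> 0" for t
    using that unfolding vanishing_def by auto
  ultimately show ?thesis unfolding concentrated_def K by metis
qed

lemma acyclic_cone:
  assumes "finite \<sigma>" "v \<in> \<sigma>"
    and "\<And>A. A \<in> \<G> \<Longrightarrow> A \<subseteq> \<sigma> \<Longrightarrow> v \<in> A \<Longrightarrow> \<exists>B\<in>\<G>. B \<subseteq> A - {v}"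
  shows "acyclic_cpx TYPE('k::field) (cpx \<sigma> \<G>)"
  unfolding acyclic_cpx_def using vanishing_cone[OF assms, where 'k = 'k] by simp

lemma vanishing_acyclic_link:
  assumes "finite \<sigma>" "v \<in> \<sigma>" "acyclic_cpx TYPE('k::field) (cpx (\<sigma> - {v}) (link_gens v \<G>))"
  shows "van TYPE('k) t \<sigma> \<G> \<longleftrightarrow> van TYPE('k) t (\<sigma> - {v}) \<G>"
  using assms vanishing_del_of_link[OF assms(1,2), where 'k = 'k] vanishing_0_of_del[OF assms(1,2), where 'k = 'k]
    vanishing_Suc_of_del_link[OF assms(1,2), where 'k = 'k]
  unfolding acyclic_cpx_def by (cases t) metis+

lemma vanishing_acyclic_del:
  assumes "finite \<sigma>" "v \<in> \<sigma>" "acyclic_cpx TYPE('k::field) (cpx (\<sigma> - {v}) \<G>)"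
  shows "van TYPE('k) (Suc t) \<sigma> \<G> \<longleftrightarrow> van TYPE('k) t (\<sigma> - {v}) (link_gens v \<G>)"
    and "van TYPE('k) 0 \<sigma> \<G>"
  using assms vanishing_link_of_del[OF assms(1,2), where 'k = 'k] vanishing_0_of_del[OF assms(1,2), where 'k = 'k]
    vanishing_Suc_of_del_link[OF assms(1,2), where 'k = 'k]
  unfolding acyclic_cpx_def by metis+

text \<open>The complex is the join of the boundary of the simplex on \<open>B\<close> with the
  complex on \<open>\<sigma> - B\<close>, and joining with this sphere shifts degrees by
  \<open>card B - 1\<close>. One vertex of \<open>B\<close> is treated at a time: its deletion is a
  cone over any other vertex of \<open>B\<close>, and in its link the block shrinks by that
  vertex.\<close>

lemma vanishing_block:
  assumes "finite \<sigma>" "B \<noteq> {}" "B \<subseteq> \<sigma>" "B \<in> \<G>"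
    and "\<And>A. A \<in> \<G> \<Longrightarrow> A \<subseteq> \<sigma> \<Longrightarrow> B \<subseteq> A \<or> A \<inter> B = {}"
  shows "(\<forall>t. van TYPE('k::field) (t + (card B - 1)) \<sigma> \<G> \<longleftrightarrow> van TYPE('k) t (\<sigma> - B) \<G>)
    \<and> (\<forall>t<card B - 1. van TYPE('k) t \<sigma> \<G>)"
  using assms
proof (induction "card B - 1" arbitrary: B \<sigma> \<G>)
  case 0
  have "finite B" using 0 finite_subset by blast
  then obtain v where v: "B = {v}" using 0 by (metis card_0_eq card_1_singletonE diff_is_0_eq
        le_Suc_eq le_zero_eq One_nat_def)
  \<comment> \<open>A singleton generator makes its element a non-vertex.\<close>
  have "cpx (\<sigma> - B) \<G> = cpx \<sigma> \<G>"
    using \<open>B \<in> \<G>\<close> unfolding v cpx_def by blast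
  then show ?case by (simp add: v)
next
  case (Suc b)
  have "finite B" using Suc.prems finite_subset by blast
  obtain v where v: "v \<in> B" using Suc.prems by blast
  have cB: "card (B - {v}) - 1 = b" "card (B - {v}) \<noteq> 0"
    using Suc.hyps(2) v \<open>finite B\<close> by auto
  then have Bv: "B - {v} \<noteq> {}" by force
  then obtain w where w: "w \<in> B" "w \<noteq> v" by blast
  have v\<sigma>: "v \<in> \<sigma>" using v Suc.prems by blast
  have "acyclic_cpx TYPE('k) (cpx (\<sigma> - {v}) \<G>)"
  proof (rule acyclic_cone[of _ w])
    show "w \<in> \<sigma> - {v}" using w Suc.prems(3) by blast
    show "\<exists>C\<in>\<G>. C \<subseteq> A - {w}" if "A \<in> \<G>" "A \<subseteq> \<sigma> - {v}" "w \<in> A" for A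
      using Suc.prems(5)[of A] that v w by blast
  qed (use Suc.prems(1) in simp)
  note del = vanishing_acyclic_del[OF Suc.prems(1) v\<sigma> this]
  have IH: "(\<forall>t. van TYPE('k) (t + (card (B - {v}) - 1)) (\<sigma> - {v}) (link_gens v \<G>) \<longleftrightarrow>
        van TYPE('k) t (\<sigma> - {v} - (B - {v})) (link_gens v \<G>))
      \<and> (\<forall>t<card (B - {v}) - 1. van TYPE('k) t (\<sigma> - {v}) (link_gens v \<G>))"
  proof (rule Suc.hyps(1))
    fix A assume "A \<in> link_gens v \<G>" "A \<subseteq> \<sigma> - {v}"
    then obtain A' where A': "A' \<in> \<G>" "A = A' - {v}" by (auto simp: link_gens_def)
    then have "A' \<subseteq> \<sigma>" using \<open>A \<subseteq> \<sigma> - {v}\<close> v\<sigma> by blast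
    then show "B - {v} \<subseteq> A \<or> A \<inter> (B - {v}) = {}" using Suc.prems(5)[of A'] A' by blast
  qed (use cB Bv Suc.prems in \<open>auto simp: link_gens_def\<close>)
  have "\<sigma> - {v} - (B - {v}) = \<sigma> - B" using v by blast
  moreover have "cpx (\<sigma> - B) (link_gens v \<G>) = cpx (\<sigma> - B) \<G>"
  proof (rule cpx_cong)
    fix T assume T: "T \<subseteq> \<sigma> - B"
    show "(\<exists>A\<in>link_gens v \<G>. A \<subseteq> T) \<longleftrightarrow> (\<exists>A\<in>\<G>. A \<subseteq> T)"
    proof
      assume "\<exists>A\<in>link_gens v \<G>. A \<subseteq> T"
      then obtain A where A: "A \<in> \<G>" "A - {v} \<subseteq> T" by (auto simp: link_gens_def)
      then have "B \<subseteq> A \<or> A \<inter> B = {}" using Suc.prems(5) T v\<sigma> by blast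
      \<comment> \<open>If \<open>B \<subseteq> A\<close>, then \<open>w\<close> would lie in
        \<open>T\<close>, which avoids \<open>B\<close>; so \<open>A\<close> is disjoint from
        \<open>B\<close>.\<close>
      then have "v \<notin> A" using A(2) T w v by blast
      then show "\<exists>A\<in>\<G>. A \<subseteq> T" using A by auto
    qed (auto simp: link_gens_def)
  qed
  ultimately have IH1: "van TYPE('k) (t + b) (\<sigma> - {v}) (link_gens v \<G>) \<longleftrightarrow> van TYPE('k) t (\<sigma> - B) \<G>"
    and IH2: "t < b \<Longrightarrow> van TYPE('k) t (\<sigma> - {v}) (link_gens v \<G>)" for t
    using IH unfolding cB(1) by simp_all
  show ?case
  proof (intro conjI allI impI)
    fix t
    show "van TYPE('k) (t + (card B - 1)) \<sigma> \<G> \<longleftrightarrow> van TYPE('k) t (\<sigma> - B) \<G>"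
      using del(1)[of "t + b"] IH1 unfolding Suc.hyps(2)[symmetric] by simp
  next
    fix t assume "t < card B - 1"
    then show "van TYPE('k) t \<sigma> \<G>"
      using del IH2 unfolding Suc.hyps(2)[symmetric] by (cases t) auto
  qed
qed

text \<open>\<open>b\<close> is the first vertex of the block \<open>B\<close> and \<open>w\<close>
  the vertex following it. Only \<open>B\<close> contains \<open>b\<close>, and in the link of
  \<open>w\<close> the next generator loses \<open>w\<close> and fits into \<open>B - {b}\<close>;
  so \<open>b\<close> is a cone point there and \<open>w\<close> may be deleted. All other
  generators meeting \<open>B\<close> pass through \<open>w\<close>, hence \<open>B\<close> is then
  an isolated block. If \<open>w\<close> lies outside \<open>\<sigma>\<close>, there is nothing to
  delete.\<close>

lemma vanishing_peel:
  assumes "finite \<sigma>" "B \<subseteq> \<sigma>" "B \<in> \<G>" "b \<in> B" "w \<notin> B"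
    and other: "\<And>A. A \<in> \<G> \<Longrightarrow> A \<subseteq> \<sigma> \<Longrightarrow> A \<noteq> B \<Longrightarrow> b \<notin> A \<and> (A \<inter> B = {} \<or> w \<in> A)"
    and next_gen: "w \<in> \<sigma> \<Longrightarrow> \<exists>C\<in>\<G>. C \<subseteq> insert w B - {b}"
  shows "van TYPE('k::field) (t + (card B - 1)) \<sigma> \<G> \<longleftrightarrow> van TYPE('k) t (\<sigma> - insert w B) \<G>"
    and "t < card B - 1 \<Longrightarrow> van TYPE('k) t \<sigma> \<G>"
proof -
  have eq: "van TYPE('k) t \<sigma> \<G> \<longleftrightarrow> van TYPE('k) t (\<sigma> - {w}) \<G>" for t
  proof (cases "w \<in> \<sigma>")
    case True
    have "acyclic_cpx TYPE('k) (cpx (\<sigma> - {w}) (link_gens w \<G>))"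
    proof (rule acyclic_cone[of _ b])
      fix A assume A: "A \<in> link_gens w \<G>" "A \<subseteq> \<sigma> - {w}" "b \<in> A"
      then obtain A' where A': "A' \<in> \<G>" "A = A' - {w}" by (auto simp: link_gens_def)
      then have "A' = B" using A True other[of A'] by blast
      then have "A = B" using A' assms by blast
      obtain C where "C \<in> \<G>" "C \<subseteq> insert w B - {b}" using next_gen True by blast
      then show "\<exists>C\<in>link_gens w \<G>. C \<subseteq> A - {b}"
        using \<open>A = B\<close> by (auto simp: link_gens_def)
    qed (use assms in auto)
    then show ?thesis by (rule vanishing_acyclic_link[OF assms(1) True])
  qed auto
  have block: "(\<forall>t. van TYPE('k) (t + (card B - 1)) (\<sigma> - {w}) \<G> \<longleftrightarrow> van TYPE('k) t (\<sigma> - {w} - B) \<G>)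
    \<and> (\<forall>t<card B - 1. van TYPE('k) t (\<sigma> - {w}) \<G>)"
  proof (rule vanishing_block)
    show "B \<subseteq> A \<or> A \<inter> B = {}" if "A \<in> \<G>" "A \<subseteq> \<sigma> - {w}" for A
      using other[of A] that by blast
  qed (use assms in auto)
  have "\<sigma> - {w} - B = \<sigma> - insert w B" by auto
  then show "van TYPE('k) (t + (card B - 1)) \<sigma> \<G> \<longleftrightarrow> van TYPE('k) t (\<sigma> - insert w B) \<G>"
    using block unfolding eq by simp
  show "van TYPE('k) t \<sigma> \<G>" if "t < card B - 1"
    using block that unfolding eq by simp
qed

text \<open>The path is scanned from position \<open>l\<close>: an absent vertex is skipped, a
  present one that starts no generator is a cone point, and otherwise peeling uses up
  \<open>r + 2\<close> positions and shifts by \<open>r\<close>. A final block may have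
  \<open>r + 1\<close> vertices and no successor; the extra position \<open>u\<close>, present in
  the injectivity of \<open>f\<close> and in the \<open>+ 1\<close> of the bound, supplies the
  missing place.\<close>

lemma vanishing_path_subset:
  fixes f :: "nat \<Rightarrow> 'v::linorder"
  assumes "r \<ge> 1" "inj_on f {l..u}" "\<sigma> \<subseteq> f ` {l..<u}"
    and gens: "\<And>A. A \<in> \<G> \<Longrightarrow> A \<subseteq> \<sigma> \<Longrightarrow> \<exists>s. l \<le> s \<and> s + r < u \<and> A = f ` {s..s+r}"
      "\<And>s. l \<le> s \<Longrightarrow> s + r < u \<Longrightarrow> f ` {s..s+r} \<subseteq> \<sigma> \<Longrightarrow> f ` {s..s+r} \<in> \<G>"
    and "t > r * ((u - l + 1) div (r + 2))"
  shows "van TYPE('k::field) t \<sigma> \<G>"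
  using assms(2-)
proof (induction "u - l" arbitrary: l \<sigma> t rule: less_induct)
  case less
  note inj = less.prems(1) and sub = less.prems(2) and g1 = less.prems(3) and g2 = less.prems(4)
  have fin: "finite \<sigma>" using sub finite_surj by blast
  have f_eq: "f i = f j \<longleftrightarrow> i = j" if "l \<le> i" "i \<le> u" "l \<le> j" "j \<le> u" for i j
    using inj that by (auto simp: inj_on_eq_iff)
  show ?case
  proof (cases "l < u")
    case False
    then have "\<sigma> = {}" using sub by auto
    then show ?thesis using less.prems(5) by (intro vanishing_trivial) auto
  next
    case lu: True
    show ?thesis
    proof (cases "f l \<in> \<sigma>")
      case False
      show ?thesis
      proof (rule less.hyps[of "Suc l"])
        show "inj_on f {Suc l..u}" using inj by (rule inj_on_subset) auto
        show "\<sigma> \<subseteq> f ` {Suc l..<u}"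
        proof
          fix x assume x: "x \<in> \<sigma>"
          then obtain j where "x = f j" "l \<le> j" "j < u" using sub by auto
          then show "x \<in> f ` {Suc l..<u}" using x False by (cases "j = l") auto
        qed
        show "\<exists>s. Suc l \<le> s \<and> s + r < u \<and> A = f ` {s..s+r}" if A: "A \<in> \<G>" "A \<subseteq> \<sigma>" for A
        proof -
          obtain s where s: "l \<le> s" "s + r < u" "A = f ` {s..s+r}" using g1[OF A] by blast
          then have "f s \<in> \<sigma>" using A by auto
          then have "s \<noteq> l" using False by auto
          then show ?thesis using s by (intro exI[of _ s]) auto
        qed
        have "r * ((u - Suc l + 1) div (r + 2)) \<le> r * ((u - l + 1) div (r + 2))"
          by (intro mult_le_mono2 div_le_mono) auto
        then show "r * ((u - Suc l + 1) div (r + 2)) < t"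
          using less.prems(5) by (rule le_less_trans)
      qed (use lu g2 in auto)
    next
      case fl: True
      show ?thesis
      proof (cases "l + r < u \<and> f ` {l..l+r} \<subseteq> \<sigma>")
        case False
        show ?thesis
        proof (rule vanishing_cone[OF fin fl])
          fix A assume A: "A \<in> \<G>" "A \<subseteq> \<sigma>" "f l \<in> A"
          then obtain s where s: "l \<le> s" "s + r < u" "A = f ` {s..s+r}" using g1 by blast
          then obtain j where j: "f l = f j" "s \<le> j" "j \<le> s + r" using A(3) by auto
          then have "l = j" using f_eq[of l j] s lu by auto
          then show "\<exists>B\<in>\<G>. B \<subseteq> A - {f l}" using False s j A by auto
        qed
      next
        case True
        define B where "B = f ` {l..l+r}"
        define w where "w = f (l + r + 1)"
        have "inj_on f {l..l+r}" using inj True by (auto intro: inj_on_subset)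
        then have cB: "card B - 1 = r" by (simp add: B_def card_image)
        have q: "(u - l + 1) div (r + 2) = Suc ((u - l - (r + 1)) div (r + 2))"
          using True by (subst le_div_geq) auto
        then have t: "t = (t - r) + (card B - 1)" using less.prems(5) cB by simp
        have "van TYPE('k) ((t - r) + (card B - 1)) \<sigma> \<G> \<longleftrightarrow>
            van TYPE('k) (t - r) (\<sigma> - insert w B) \<G>"
        proof (rule vanishing_peel(1)[OF fin, where b = "f l"])
          show "B \<subseteq> \<sigma>" "B \<in> \<G>" using True g2 by (auto simp: B_def)
          show "f l \<in> B" by (auto simp: B_def)
          show "w \<notin> B" using True by (auto simp: B_def w_def f_eq)
          show "f l \<notin> A \<and> (A \<inter> B = {} \<or> w \<in> A)" if A: "A \<in> \<G>" "A \<subseteq> \<sigma>" "A \<noteq> B" for A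
          proof -
            obtain s where s: "l \<le> s" "s + r < u" "A = f ` {s..s+r}" using g1[OF A(1,2)] by blast
            then have "s \<noteq> l" using A(3) by (auto simp: B_def)
            then have 1: "f l \<notin> A" using s by (auto simp: f_eq)
            have "w \<in> A" if xA: "x \<in> A" and xB: "x \<in> B" for x
            proof -
              obtain i where i: "x = f i" "s \<le> i" "i \<le> s + r" using xA s(3) by auto
              obtain j where "x = f j" "l \<le> j" "j \<le> l + r" using xB by (auto simp: B_def)
              with i have ij: "f i = f j" "s \<le> i" "i \<le> s + r" "l \<le> j" "j \<le> l + r" by auto
              then have "i = j" using f_eq[of i j] s True by auto
              then have "l + r + 1 \<in> {s..s+r}" using ij \<open>s \<noteq> l\<close> s(1) by auto
              then show ?thesis unfolding w_def s(3) by blast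
            qed
            with 1 show ?thesis by blast
          qed
          assume "w \<in> \<sigma>"
          then obtain j where "f (l + r + 1) = f j" "l \<le> j" "j < u" using sub by (auto simp: w_def)
          then have lt: "l + 1 + r < u" using f_eq[of "l + r + 1" j] True by auto
          have eq: "insert w B - {f l} = f ` {l+1..l+1+r}"
          proof -
            have "{l+1..l+1+r} = insert (l+r+1) {l..l+r} - {l}" by auto
            moreover have "f ` (insert (l+r+1) {l..l+r} - {l}) = f ` insert (l+r+1) {l..l+r} - f ` {l}"
              by (rule inj_on_image_set_diff[OF inj]) (use lt in auto)
            ultimately show ?thesis unfolding w_def B_def by simp
          qed
          moreover have "insert w B - {f l} \<subseteq> \<sigma>" using \<open>w \<in> \<sigma>\<close> True by (auto simp: B_def)
          ultimately show "\<exists>C\<in>\<G>. C \<subseteq> insert w B - {f l}" using g2[of "l+1"] lt by auto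
        qed
        moreover have "van TYPE('k) (t - r) (\<sigma> - insert w B) \<G>"
        proof (rule less.hyps[of "l + r + 2"])
          show "inj_on f {l + r + 2..u}" using inj by (rule inj_on_subset) auto
          show sub': "\<sigma> - insert w B \<subseteq> f ` {l + r + 2..<u}"
          proof
            fix x assume x: "x \<in> \<sigma> - insert w B"
            then obtain j where j: "x = f j" "l \<le> j" "j < u" using sub by auto
            then have "j \<notin> {l..l+r}" "j \<noteq> l + r + 1" using x by (auto simp: B_def w_def)
            then show "x \<in> f ` {l + r + 2..<u}" using j by auto
          qed
          show "\<exists>s. l + r + 2 \<le> s \<and> s + r < u \<and> A = f ` {s..s+r}"
            if A: "A \<in> \<G>" "A \<subseteq> \<sigma> - insert w B" for A
          proof -
            obtain s where s: "l \<le> s" "s + r < u" "A = f ` {s..s+r}" using g1[of A] A by blast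
            then have "f s \<in> A" by auto
            then have "f s \<in> \<sigma> - insert w B" using A by blast
            then obtain j where "f s = f j" "l + r + 2 \<le> j" "j < u" using sub' by auto
            then have "l + r + 2 \<le> s" using f_eq[of s j] s by auto
            then show ?thesis using s by auto
          qed
          \<comment> \<open>If the block reaches the end of the path, \<open>u - (l + r + 2)\<close>
            is truncated, but both quotients are then 0.\<close>
          have "(u - (l + r + 2) + 1) div (r + 2) = (u - l - (r + 1)) div (r + 2)"
          proof (cases "u = l + r + 1")
            case False
            then have "u - (l + r + 2) + 1 = u - l - (r + 1)" using True by arith
            then show ?thesis by simp
          qed simp
          then show "r * ((u - (l + r + 2) + 1) div (r + 2)) < t - r" using less.prems(5) q by simp
          show "f ` {s..s+r} \<in> \<G>"
            if "l + r + 2 \<le> s" "s + r < u" "f ` {s..s+r} \<subseteq> \<sigma> - insert w B" for s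
            using that by (intro g2) auto
        qed (use lu in auto)
        ultimately show ?thesis using t by simp
      qed
    qed
  qed
qed

section \<open>Paths and cycles\<close>

text \<open>The path on \<open>{l..<u}\<close> whose last generator \<open>{u - (r + 1)..<u}\<close> is shrunk to
  the last \<open>e\<close> vertices; only minimal generators are listed.\<close>

definition path_gens :: "nat \<Rightarrow> nat \<Rightarrow> nat \<Rightarrow> nat \<Rightarrow> nat set set" where
  "path_gens l u r e =
     {{s..s+r} | s. l \<le> s \<and> s + r + 1 < u} \<union> (if l + e \<le> u then {{u-e..<u}} else {})"

lemma path_gensE:
  assumes "A \<in> path_gens l u r e"
  obtains s where "l \<le> s" "s + r + 1 < u" "A = {s..s+r}" | "l + e \<le> u" "A = {u-e..<u}"
  using assms unfolding path_gens_def by (auto split: if_splits)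

lemma path_gens_mono: "l \<le> l' \<Longrightarrow> path_gens l' u r e \<subseteq> path_gens l u r e"
proof
  fix A assume "l \<le> l'" "A \<in> path_gens l' u r e"
  from this(2) show "A \<in> path_gens l u r e"
    by (cases rule: path_gensE) (use \<open>l \<le> l'\<close> in \<open>auto simp: path_gens_def\<close>)
qed

text \<open>Shrinking the last generator does not disturb peeling: it is an interval ending at
  \<open>u - 1 \<ge> l + r + 1\<close>, so it contains \<open>l + r + 1\<close> whenever it meets
  the block, and \<open>e \<le> r + 1\<close> keeps it away from \<open>l\<close>.\<close>

lemma vanishing_path_step:
  assumes "1 \<le> e" "e \<le> r + 1" "l + r + 2 \<le> u"
  shows "van TYPE('k::field) (t + r) {l..<u} (path_gens l u r e) \<longleftrightarrow>
      van TYPE('k) t {l+r+2..<u} (path_gens (l+r+2) u r e)"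
    and "t < r \<Longrightarrow> van TYPE('k) t {l..<u} (path_gens l u r e)"
proof -
  define B where "B = {l..l+r}"
  define \<sigma> where "\<sigma> = {l..<u}"
  define \<G> where "\<G> = path_gens l u r e"
  have cB: "card B - 1 = r" by (simp add: B_def)
  have fin: "finite \<sigma>" and B: "B \<subseteq> \<sigma>" "B \<in> \<G>" "l \<in> B" "l + r + 1 \<notin> B"
    using assms by (auto simp: B_def \<sigma>_def \<G>_def path_gens_def)
  have other: "l \<notin> A \<and> (A \<inter> B = {} \<or> l + r + 1 \<in> A)" if "A \<in> \<G>" "A \<noteq> B" for A
    using that(1) unfolding \<G>_def
  proof (cases rule: path_gensE)
    case (1 s)
    with that(2) have "s \<noteq> l" by (auto simp: B_def)
    with 1 show ?thesis by (auto simp: B_def)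
  qed (use assms in \<open>auto simp: B_def\<close>)
  have next_gen: "\<exists>C\<in>\<G>. C \<subseteq> insert (l + r + 1) B - {l}"
  proof (cases "l + r + 2 < u")
    case True
    then have "{l+1..l+1+r} \<in> \<G>" unfolding \<G>_def path_gens_def by fastforce
    then show ?thesis by (intro bexI) (auto simp: B_def)
  next
    case False
    then have "u = l + r + 2" using assms by simp
    \<comment> \<open>No full generator starts at \<open>l + 1\<close> here; the shrunk one takes
      its place.\<close>
    then have "{u-e..<u} \<in> \<G>" using assms by (simp add: \<G>_def path_gens_def)
    then show ?thesis using assms \<open>u = l + r + 2\<close> by (intro bexI) (auto simp: B_def)
  qed
  have rest: "\<sigma> - insert (l + r + 1) B = {l+r+2..<u}"
    by (auto simp: \<sigma>_def B_def)
  have "cpx {l+r+2..<u} \<G> = cpx {l+r+2..<u} (path_gens (l+r+2) u r e)"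
  proof (rule cpx_cong)
    fix T assume T: "T \<subseteq> {l+r+2..<u}"
    show "(\<exists>A\<in>\<G>. A \<subseteq> T) \<longleftrightarrow> (\<exists>A\<in>path_gens (l+r+2) u r e. A \<subseteq> T)"
    proof
      assume "\<exists>A\<in>\<G>. A \<subseteq> T"
      then obtain A where A: "A \<in> \<G>" "A \<subseteq> T" by blast
      from A(1) have "A \<in> path_gens (l+r+2) u r e" unfolding \<G>_def
      proof (cases rule: path_gensE)
        case (1 s)
        then have "s \<in> A" by auto
        then have "s \<in> {l+r+2..<u}" using A(2) T by blast
        with 1 show ?thesis by (auto simp: path_gens_def)
      next
        case 2
        then have "u - e \<in> A" using assms by auto
        then have "u - e \<in> {l+r+2..<u}" using A(2) T by blast
        with 2 show ?thesis by (auto simp: path_gens_def)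
      qed
      with A show "\<exists>A\<in>path_gens (l+r+2) u r e. A \<subseteq> T" by blast
    next
      assume "\<exists>A\<in>path_gens (l+r+2) u r e. A \<subseteq> T"
      then show "\<exists>A\<in>\<G>. A \<subseteq> T" unfolding \<G>_def using path_gens_mono[of l "l+r+2" u r e] by (meson le_add1 add.assoc subsetD trans_le_add1)
    qed
  qed
  then show "van TYPE('k) (t + r) {l..<u} (path_gens l u r e) \<longleftrightarrow>
      van TYPE('k) t {l+r+2..<u} (path_gens (l+r+2) u r e)"
    using vanishing_peel(1)[OF fin B other next_gen, of t, where 'k = 'k]
    unfolding cB rest by (simp add: \<sigma>_def \<G>_def)
  show "van TYPE('k) t {l..<u} (path_gens l u r e)" if "t < r"
    using vanishing_peel(2)[OF fin B other next_gen, of t, where 'k = 'k] that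
    unfolding cB by (simp add: \<sigma>_def \<G>_def)
qed

text \<open>Peeling leaves fewer than \<open>r + 2\<close> vertices, where at most the shrunk
  generator survives. What remains is the complex \<open>{{}}\<close> (degree 0), the boundary of
  the simplex on \<open>e\<close> vertices (degree \<open>e - 1\<close>), or a cone over
  \<open>l\<close>; each peeled block adds \<open>r\<close>.\<close>

lemma vanishing_path_iff:
  assumes "1 \<le> e" "e \<le> r + 1"
  shows "van TYPE('k::field) t {l..<u} (path_gens l u r e) \<longleftrightarrow>
    \<not> ((u - l) mod (r + 2) = 0 \<and> t = r * ((u - l) div (r + 2))) \<and>
    \<not> ((u - l) mod (r + 2) = e \<and> t = r * ((u - l) div (r + 2)) + e - 1)"
proof (induction "u - l" arbitrary: l t rule: less_induct)
  case less
  have no_empty: "{} \<notin> path_gens l u r e" for l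
    using assms by (auto simp: path_gens_def)
  show ?case
  proof (cases "l + r + 2 \<le> u")
    case True
    have split: "u - l = (r + 2) + (u - (l + r + 2))" using True by simp
    have m: "(u - l) mod (r + 2) = (u - (l + r + 2)) mod (r + 2)"
      unfolding split by (rule mod_add_self1)
    have d: "(u - l) div (r + 2) = Suc ((u - (l + r + 2)) div (r + 2))"
      unfolding split by (subst div_add_self1) auto
    show ?thesis
    proof (cases "t < r")
      case False
      then obtain t' where t': "t = t' + r" by (metis add.commute le_Suc_ex not_less)
      have "u - (l + r + 2) < u - l" using True by simp
      note IH = less.hyps[OF this, of t']
      have "t' + r = r * Suc d \<longleftrightarrow> t' = r * d"
        "t' + r = r * Suc d + e - 1 \<longleftrightarrow> t' = r * d + e - 1" for d
        using assms by auto
      then show ?thesis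
        unfolding t' vanishing_path_step(1)[OF assms True] m d IH by simp
    next
      case lt: True
      have "t \<noteq> r * Suc k" "t \<noteq> r * Suc k + e - 1" for k using lt assms by auto
      then show ?thesis using vanishing_path_step(2)[OF assms True lt] unfolding d by simp
    qed
  next
    case False
    then have N: "(u - l) mod (r + 2) = u - l" "(u - l) div (r + 2) = 0"
      by simp_all
    have gens: "path_gens l u r e = (if l + e \<le> u then {{u-e..<u}} else {})"
      using False by (auto simp: path_gens_def)
    consider "u \<le> l" | "l < u" "u - l \<noteq> e" | "l < u" "u - l = e" by linarith
    then show ?thesis
    proof cases
      case 1
      then show ?thesis
        using concentrated_empty[OF no_empty, of l, where 'k = 'k] N assms
        by (simp add: concentrated_def)
    next
      case 2
      have "van TYPE('k) t {l..<u} (path_gens l u r e)"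
        by (rule vanishing_cone[of _ l]) (use 2 gens in \<open>auto split: if_splits\<close>)
      then show ?thesis using 2 N by simp
    next
      case 3
      define B where "B = {l..<u}"
      have "path_gens l u r e = {B}" using 3 gens by (auto simp: B_def)
      moreover have "(\<forall>t. van TYPE('k) (t + (card B - 1)) B {B} \<longleftrightarrow> van TYPE('k) t (B - B) {B})
          \<and> (\<forall>t<card B - 1. van TYPE('k) t B {B})"
        by (rule vanishing_block) (use 3 in \<open>auto simp: B_def\<close>)
      moreover have "van TYPE('k) t (B - B) {B} \<longleftrightarrow> t \<noteq> 0" for t
        using concentrated_empty[of "{B}", where 'k = 'k] 3 by (simp add: concentrated_def B_def)
      moreover have "card B - 1 = e - 1" using 3 by (simp add: B_def)
      ultimately have *: "van TYPE('k) (t + (e - 1)) {l..<u} (path_gens l u r e) \<longleftrightarrow> t \<noteq> 0"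
        and **: "t < e - 1 \<Longrightarrow> van TYPE('k) t {l..<u} (path_gens l u r e)" for t
        by (simp_all flip: B_def)
      show ?thesis
      proof (cases "t < e - 1")
        case True
        then show ?thesis using ** 3 N by auto
      next
        case False
        then show ?thesis using *[of "t - (e - 1)"] 3 N by auto
      qed
    qed
  qed
qed

section \<open>Arcs of the cycle and iterated links\<close>

definition arc :: "nat \<Rightarrow> nat \<Rightarrow> nat \<Rightarrow> nat set" where
  "arc n r s = (\<lambda>i. (s + i) mod n) ` {..r}"

definition arc_sets :: "nat \<Rightarrow> nat \<Rightarrow> nat set set" where
  "arc_sets n r = arc n r ` {..<n}"

lemma arc_eq:
  assumes "s < n" "r < n"
  shows "arc n r s = (if s + r < n then {s..s+r} else {s..<n} \<union> {..s + r - n})"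
proof (rule Set.set_eqI)
  fix x
  have "(s + i) mod n = (if s + i < n then s + i else s + i - n)" if "i \<le> r" for i
    using assms that by (simp add: le_mod_geq)
  then have "x \<in> arc n r s \<longleftrightarrow> (\<exists>i\<le>r. x = (if s + i < n then s + i else s + i - n))"
    by (auto simp: arc_def image_iff simp del: mod_less)
  also have "\<dots> \<longleftrightarrow> x \<in> (if s + r < n then {s..s+r} else {s..<n} \<union> {..s + r - n})"
  proof
    assume R: "x \<in> (if s + r < n then {s..s+r} else {s..<n} \<union> {..s + r - n})"
    show "\<exists>i\<le>r. x = (if s + i < n then s + i else s + i - n)"
    proof (cases "s \<le> x \<and> x < n")
      case True
      then show ?thesis using R by (intro exI[of _ "x - s"]) (auto split: if_splits)
    next
      case False
      then show ?thesis using R assms by (intro exI[of _ "x + n - s"]) (auto split: if_splits)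
    qed
  qed (auto split: if_splits)
  finally show "x \<in> arc n r s \<longleftrightarrow> x \<in> (if s + r < n then {s..s+r} else {s..<n} \<union> {..s + r - n})" .
qed

text \<open>Generators of the link of \<open>{..<a}\<close> in the complex of the cycle.\<close>

definition arc_link :: "nat \<Rightarrow> nat \<Rightarrow> nat \<Rightarrow> nat set set" where
  "arc_link n r a = (\<lambda>A. A - {..<a}) ` arc_sets n r"

lemma arc_link_0: "arc_link n r 0 = arc_sets n r"
  by (simp add: arc_link_def)

lemma link_gens_arc_link: "link_gens a (arc_link n r a) = arc_link n r (Suc a)"
proof -
  have "A - {..<a} - {a} = A - {..<Suc a}" for A by auto
  then show ?thesis by (simp add: link_gens_def arc_link_def image_image)
qed

lemma arc_link_mem: "s < n \<Longrightarrow> arc n r s - {..<a} \<in> arc_link n r a"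
  by (auto simp: arc_link_def arc_sets_def)

lemma arc_linkE:
  assumes "A \<in> arc_link n r a"
  obtains s where "s < n" "A = arc n r s - {..<a}"
  using assms by (auto simp: arc_link_def arc_sets_def)

text \<open>An arc avoiding \<open>a\<close> lies beyond \<open>a\<close> or reaches
  \<open>n - 1\<close>, and past 0 it can only cover the \<open>a\<close> vertices already in the
  link. So in the second case it retains at least the last \<open>r + 1 - a\<close> vertices, with
  equality for the arc starting in \<open>n - (r + 1 - a)\<close>.\<close>

lemma cpx_arc_link_del:
  assumes "a < r" "r + 2 \<le> n"
  shows "cpx {Suc a..<n} (arc_link n r a) = cpx {Suc a..<n} (path_gens (Suc a) n r (r + 1 - a))"
proof (rule cpx_cong)
  fix T assume T: "T \<subseteq> {Suc a..<n}"
  show "(\<exists>A\<in>arc_link n r a. A \<subseteq> T) \<longleftrightarrow> (\<exists>A\<in>path_gens (Suc a) n r (r + 1 - a). A \<subseteq> T)"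
  proof
    assume "\<exists>A\<in>arc_link n r a. A \<subseteq> T"
    then obtain s where s: "s < n" "arc n r s - {..<a} \<subseteq> T"
      by (metis arc_linkE)
    then have a: "a \<notin> arc n r s" using T by auto
    show "\<exists>A\<in>path_gens (Suc a) n r (r + 1 - a). A \<subseteq> T"
    proof (cases "s + r + 1 < n")
      case True
      then have A: "arc n r s = {s..s+r}" using assms s by (simp add: arc_eq)
      then have "s > a" using a assms by auto
      then have "{s..s+r} \<in> path_gens (Suc a) n r (r + 1 - a)" "{s..s+r} \<subseteq> T"
        using True s A by (auto simp: path_gens_def)
      then show ?thesis by blast
    next
      case False
      have "{n - (r + 1 - a)..<n} \<subseteq> arc n r s - {..<a}"
        using a False assms s by (auto simp: arc_eq split: if_splits)
      then have "{n - (r + 1 - a)..<n} \<subseteq> T" using s by blast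
      moreover have "{n - (r + 1 - a)..<n} \<in> path_gens (Suc a) n r (r + 1 - a)"
        using assms by (auto simp: path_gens_def)
      ultimately show ?thesis by blast
    qed
  next
    assume "\<exists>A\<in>path_gens (Suc a) n r (r + 1 - a). A \<subseteq> T"
    then obtain A where A: "A \<in> path_gens (Suc a) n r (r + 1 - a)" "A \<subseteq> T" by blast
    from A(1) have "\<exists>s<n. arc n r s - {..<a} = A"
    proof (cases rule: path_gensE)
      case (1 s)
      then show ?thesis using assms by (intro exI[of _ s]) (auto simp: arc_eq)
    next
      case 2
      then show ?thesis using assms
        by (intro exI[of _ "n - (r + 1 - a)"]) (auto simp: arc_eq)
    qed
    then show "\<exists>A\<in>arc_link n r a. A \<subseteq> T" using A(2) arc_link_mem by blast
  qed
qed

text \<open>The arcs starting in 0 and in \<open>n - 1\<close> leave just \<open>{r}\<close> and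
  \<open>{n - 1}\<close>, so these two points are not vertices of the link. Every other arc through
  them, in particular each one that wraps, is redundant, and an ordinary path on
  \<open>n - r - 2\<close> vertices remains.\<close>

lemma cpx_arc_link_last:
  assumes "r + 2 \<le> n"
  shows "cpx {r..<n} (arc_link n r r) = cpx {Suc r..<n-1} (path_gens (Suc r) (n - 1) r (r + 1))"
proof (rule Set.set_eqI)
  fix T
  have ends: "{r} \<in> arc_link n r r" "{n - 1} \<in> arc_link n r r"
  proof -
    have "arc n r 0 - {..<r} = {r}" "arc n r (n - 1) - {..<r} = {n - 1}"
      using assms by (auto simp: arc_eq)
    then show "{r} \<in> arc_link n r r" "{n - 1} \<in> arc_link n r r"
      using arc_link_mem[of 0 n r r] arc_link_mem[of "n - 1" n r r] assms by auto
  qed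
  have sub: "{Suc r..<n-1} \<subseteq> {r..<n}" by auto
  have sub': "T \<subseteq> {Suc r..<n-1}" if "T \<in> cpx {r..<n} (arc_link n r r)"
  proof
    fix x assume x: "x \<in> T"
    have "r \<notin> T" "n - 1 \<notin> T" using that ends by (auto simp: cpx_def)
    then have "x \<noteq> r" "x \<noteq> n - 1" using x by auto
    moreover have "x \<in> {r..<n}" using that x by (auto simp: cpx_def)
    ultimately show "x \<in> {Suc r..<n-1}" by auto
  qed
  have gens: "(\<exists>A\<in>arc_link n r r. A \<subseteq> T) \<longleftrightarrow>
      (\<exists>A\<in>path_gens (Suc r) (n - 1) r (r + 1). A \<subseteq> T)"
    if T: "T \<subseteq> {Suc r..<n-1}"
  proof
    assume "\<exists>A\<in>arc_link n r r. A \<subseteq> T"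
    then obtain s where s: "s < n" "arc n r s - {..<r} \<subseteq> T"
      by (metis arc_linkE)
    then have "x \<in> {Suc r..<n-1}" if "x \<in> arc n r s" "r \<le> x" for x
      using that T by (metis Diff_iff in_mono lessThan_iff not_le)
    note in_T = this
    have "r \<notin> arc n r s" using in_T[of r] by auto
    moreover have "n - 1 \<notin> arc n r s" using in_T[of "n - 1"] assms
      by (cases "r \<le> n - 1") auto
    ultimately have *: "s + r < n - 1" "r < s" "arc n r s = {s..s+r}"
      using s(1) assms by (auto simp: arc_eq split: if_splits)
    then have "{s..s+r} \<in> path_gens (Suc r) (n - 1) r (r + 1)"
    proof (cases "s + r + 1 < n - 1")
      case False
      then have "s = n - 1 - (r + 1)" "s + r + 1 = n - 1" using * by auto
      then have "{n - 1 - (r + 1)..<n - 1} = {s..s+r}" by auto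
      then show ?thesis using * by (auto simp: path_gens_def)
    qed (use * in \<open>auto simp: path_gens_def\<close>)
    moreover have "{s..s+r} \<subseteq> T" using s * by auto
    ultimately show "\<exists>A\<in>path_gens (Suc r) (n - 1) r (r + 1). A \<subseteq> T" by blast
  next
    assume "\<exists>A\<in>path_gens (Suc r) (n - 1) r (r + 1). A \<subseteq> T"
    then obtain A where A: "A \<in> path_gens (Suc r) (n - 1) r (r + 1)" "A \<subseteq> T" by blast
    from A(1) have "\<exists>s<n. arc n r s - {..<r} = A"
    proof (cases rule: path_gensE)
      case (1 s)
      then show ?thesis using assms by (intro exI[of _ s]) (auto simp: arc_eq)
    next
      case 2
      then show ?thesis using assms
        by (intro exI[of _ "n - 1 - (r + 1)"]) (auto simp: arc_eq)
    qed
    then show "\<exists>A\<in>arc_link n r r. A \<subseteq> T" using A(2) arc_link_mem by blast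
  qed
  show "T \<in> cpx {r..<n} (arc_link n r r) \<longleftrightarrow>
      T \<in> cpx {Suc r..<n-1} (path_gens (Suc r) (n - 1) r (r + 1))"
  proof (cases "T \<subseteq> {Suc r..<n-1}")
    case True
    with sub have "T \<subseteq> {r..<n}" by (rule subset_trans[rotated])
    with True gens[OF True] show ?thesis unfolding cpx_def mem_Collect_eq by metis
  next
    case False
    then show ?thesis using sub' unfolding cpx_def mem_Collect_eq by metis
  qed
qed

context
  fixes n r p q :: nat
  assumes r: "1 \<le> r" and p: "1 \<le> p" and n: "n = (r + 2) * p + q" and q: "q \<le> r + 1"
begin

lemma cycle_length_ge: "r + 2 \<le> n"
  using n p by (cases p) auto

text \<open>The path has \<open>n - (a + 1)\<close> vertices and a last generator of size
  \<open>r + 1 - a\<close>. Modulo \<open>r + 2\<close> its length is 0 exactly for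
  \<open>q = a + 1\<close>, and it agrees with that size exactly for \<open>q = 0\<close>.\<close>

lemma arc_link_del_iff:
  assumes "a < r"
  shows "van TYPE('k::field) t {Suc a..<n} (arc_link n r a) \<longleftrightarrow>
    \<not> (q = Suc a \<and> t = r * p) \<and> \<not> (q = 0 \<and> t = r * p - a)"
proof -
  have e: "1 \<le> r + 1 - a" "r + 1 - a \<le> r + 1" using assms by auto
  have *: "van TYPE('k) t {Suc a..<n} (arc_link n r a) \<longleftrightarrow>
    \<not> ((n - Suc a) mod (r + 2) = 0 \<and> t = r * ((n - Suc a) div (r + 2))) \<and>
    \<not> ((n - Suc a) mod (r + 2) = r + 1 - a \<and>
        t = r * ((n - Suc a) div (r + 2)) + (r + 1 - a) - 1)"
    using cpx_arc_link_del[OF assms cycle_length_ge] vanishing_path_iff[OF e] by simp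
  \<comment> \<open>Remainder and quotient of \<open>n - (a + 1)\<close>; for
    \<open>q < a + 1\<close> one period is borrowed from \<open>p \<ge> 1\<close>.\<close>
  define m where "m = (if Suc a \<le> q then q - Suc a else r + 2 + q - Suc a)"
  define k where "k = (if Suc a \<le> q then p else p - 1)"
  have m: "m < r + 2" using q assms by (auto simp: m_def)
  have eq: "n - Suc a = (r + 2) * k + m"
  proof (cases "Suc a \<le> q")
    case True
    then show ?thesis using n by (simp add: k_def m_def)
  next
    case False
    obtain p' where "p = Suc p'" using p by (cases p) auto
    then show ?thesis using False n assms by (simp add: k_def m_def)
  qed
  have "(n - Suc a) mod (r + 2) = m"
    unfolding eq mod_mult_self4 using m by simp
  moreover have "(n - Suc a) div (r + 2) = k"
    unfolding eq using m by (subst div_mult_self4) auto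
  moreover have "m = 0 \<longleftrightarrow> q = Suc a" "m = r + 1 - a \<longleftrightarrow> q = 0"
    using q assms by (auto simp: m_def)
  moreover have "q = 0 \<Longrightarrow> r * k + (r + 1 - a) - 1 = r * p - a"
    using p assms by (cases p) (auto simp: k_def)
  moreover have "q = Suc a \<Longrightarrow> k = p" by (simp add: k_def)
  moreover have "q = Suc a \<Longrightarrow> q \<noteq> 0" by simp
  ultimately show ?thesis using * by metis
qed

lemma arc_link_last_iff:
  "van TYPE('k::field) t {r..<n} (arc_link n r r) \<longleftrightarrow>
    \<not> (q = 0 \<and> t = r * p - r) \<and> \<not> (q = r + 1 \<and> t = r * p)"
proof -
  have eq: "n - 1 - Suc r = (r + 2) * (p - 1) + q" using n p by (cases p) auto
  have "(n - 1 - Suc r) mod (r + 2) = q"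
    unfolding eq mod_mult_self4 using q by simp
  moreover have "(n - 1 - Suc r) div (r + 2) = p - 1"
    unfolding eq using q by (subst div_mult_self4) auto
  moreover have "r * (p - 1) = r * p - r" by (simp add: diff_mult_distrib2)
  moreover have "r * (p - 1) + (r + 1) - 1 = r * p" using p by (cases p) auto
  ultimately show ?thesis
    using cpx_arc_link_last[OF cycle_length_ge] vanishing_path_iff[of "r + 1" r, where u = "n - 1" and l = "Suc r"]
    by simp
qed

lemma arc_link_simps:
  "{a..<n} - {a} = {Suc a..<n}" "link_gens a (arc_link n r a) = arc_link n r (Suc a)"
  by (auto simp: link_gens_arc_link)

text \<open>Only one path met on the way has cohomology, in degree \<open>r * p\<close>: the
  deletion of \<open>q - 1\<close>, or the last link if \<open>q = r + 1\<close>. The links of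
  \<open>{..<a}\<close> with \<open>q \<le> a\<close> are acyclic, so at \<open>a = q - 1\<close>
  the cohomology is that of the deletion, unshifted. For smaller \<open>a\<close> the deletion is
  acyclic, and each step down adds one.\<close>

lemma cycle_concentrated:
  assumes "q \<noteq> 0"
  shows "concentrated TYPE('k::field) (r * p + q - 1) (cpx {..<n} (arc_sets n r))"
proof -
  have acyc: "acyclic_cpx TYPE('k) (cpx {a..<n} (arc_link n r a))" if "q \<le> a" "a \<le> r" for a
    using that(2,1)
  proof (induction rule: inc_induct)
    case base
    then show ?case using assms q by (auto simp: acyclic_cpx_def arc_link_last_iff)
  next
    case (step b)
    have "acyclic_cpx TYPE('k) (cpx ({b..<n} - {b}) (link_gens b (arc_link n r b)))"
      using step by (simp add: arc_link_simps)
    from vanishing_acyclic_link[OF _ _ this] show ?case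
      using step cycle_length_ge assms by (auto simp: acyclic_cpx_def arc_link_simps(1) arc_link_del_iff)
  qed
  have top: "concentrated TYPE('k) (r * p) (cpx {q-1..<n} (arc_link n r (q-1)))"
  proof (cases "q = r + 1")
    case True
    then show ?thesis using assms by (auto simp: concentrated_def arc_link_last_iff)
  next
    case False
    obtain b where b: "q = Suc b" using assms by (cases q) auto
    have "acyclic_cpx TYPE('k) (cpx ({b..<n} - {b}) (link_gens b (arc_link n r b)))"
      using acyc[of q] False q b by (simp add: arc_link_simps)
    from vanishing_acyclic_link[OF _ _ this] show ?thesis
      using cycle_length_ge False q b by (auto simp: concentrated_def arc_link_simps(1) arc_link_del_iff)
  qed
  have "a \<le> q - 1 \<Longrightarrow>
      concentrated TYPE('k) (r * p + (q - 1 - a)) (cpx {a..<n} (arc_link n r a))" for a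
  proof (induction a rule: inc_induct)
    case base
    then show ?case using top by simp
  next
    case (step b)
    have "acyclic_cpx TYPE('k) (cpx ({b..<n} - {b}) (arc_link n r b))"
      using step.hyps assms q by (auto simp: arc_link_simps(1) acyclic_cpx_def arc_link_del_iff)
    note del = vanishing_acyclic_del[OF _ _ this]
    have "van TYPE('k) t {b..<n} (arc_link n r b) \<longleftrightarrow> t \<noteq> r * p + (q - 1 - b)" for t
    proof (cases t)
      case 0
      then show ?thesis using del(2) step.hyps cycle_length_ge q by auto
    next
      case (Suc t')
      have "van TYPE('k) t {b..<n} (arc_link n r b) \<longleftrightarrow> t' \<noteq> r * p + (q - 1 - Suc b)"
        using del(1)[of t'] step cycle_length_ge q Suc unfolding arc_link_simps
        by (auto simp: concentrated_def)
      then show ?thesis using Suc step.hyps by auto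
    qed
    then show ?case by (simp add: concentrated_def)
  qed
  from this[of 0] show ?thesis by (simp add: arc_link_0 atLeast0LessThan)
      (metis Nat.add_diff_assoc One_nat_def assms less_one not_le)
qed

text \<open>Deletion and shifted link of each stage live in the same degree
  \<open>r * p - a\<close>, so vanishing in all other degrees descends from the last link to the
  cycle.\<close>

lemma cycle_vanishing_0:
  assumes "q = 0" "t \<noteq> r * p"
  shows "van TYPE('k::field) t {..<n} (arc_sets n r)"
proof -
  have "a \<le> r \<Longrightarrow> (\<forall>t. t \<noteq> r * p - a \<longrightarrow> van TYPE('k) t {a..<n} (arc_link n r a))" for a
  proof (induction a rule: inc_induct)
    case base
    then show ?case by (auto simp: arc_link_last_iff assms)
  next
    case (step b)
    have b: "b \<in> {b..<n}" using step.hyps cycle_length_ge by simp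
    \<comment> \<open>Keeps \<open>r * p - a\<close> from being truncated for
      \<open>a \<le> r\<close>.\<close>
    have rp: "r \<le> r * p" using p by simp
    show ?case
    proof (intro allI impI)
      fix t assume t: "t \<noteq> r * p - b"
      then have del: "van TYPE('k) t ({b..<n} - {b}) (arc_link n r b)"
        using step.hyps assms(1) by (auto simp: arc_link_simps(1) arc_link_del_iff)
      show "van TYPE('k) t {b..<n} (arc_link n r b)"
      proof (cases t)
        case 0
        then show ?thesis using vanishing_0_of_del[OF _ b] del by simp
      next
        case (Suc t')
        have "r * p - b = Suc (r * p - Suc b)" using step.hyps rp by linarith
        then have "t' \<noteq> r * p - Suc b" using t Suc by simp
        then show ?thesis
          using vanishing_Suc_of_del_link[OF _ b, of t', where 'k = 'k] del step.IH Suc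
          by (simp add: arc_link_simps)
      qed
    qed
  qed
  from this[of 0] show ?thesis using assms by (simp add: arc_link_0 atLeast0LessThan)
qed

text \<open>\<open>{1..<n}\<close> is the deletion of 0, a path on \<open>n - 1\<close> vertices; it
  is the witness for the lower bound when \<open>q = 0\<close>.\<close>

lemma cycle_nonvanishing_0:
  assumes "q = 0"
  shows "\<not> van TYPE('k::field) (r * p) {1..<n} (arc_sets n r)"
  using arc_link_del_iff[of 0 "r * p", where 'k = 'k] r assms by (simp add: arc_link_0)

text \<open>The circle is cut open at a vertex \<open>c\<close> outside \<open>\<sigma>\<close>:
  \<open>f\<close> runs through the vertices from \<open>c + 1\<close> on and puts \<open>c\<close>
  at position \<open>n - 1\<close>, the extra position of \<open>vanishing_path_subset\<close>. The
  bound therefore counts all \<open>n\<close> positions, and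
  \<open>n div (r + 2) = p\<close>.\<close>

lemma cycle_proper_subset_vanishing:
  assumes \<sigma>: "\<sigma> \<subset> {..<n}" and t: "t > r * p"
  shows "van TYPE('k::field) t \<sigma> (arc_sets n r)"
proof -
  obtain c where c: "c < n" "c \<notin> \<sigma>" using \<sigma> by auto
  define f where "f i = (c + 1 + i) mod n" for i
  have n0: "0 < n" using c by simp
  have f_last: "f (n - 1) = c" using c by (simp add: f_def)
  have f_surj: "\<exists>i<n. x = f i" if "x < n" for x
  proof -
    have "f ((x + n - (c + 1)) mod n) = (c + 1 + (x + n - (c + 1))) mod n"
      unfolding f_def by (rule mod_add_right_eq)
    also have "\<dots> = x" using c that by simp
    finally show ?thesis using n0 by (metis mod_less_divisor)
  qed
  have "f ` {..<n} = {..<n}" using f_surj n0 by (auto simp: f_def)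
  then have inj: "inj_on f {..<n}" by (intro eq_card_imp_inj_on) auto
  have sub: "\<sigma> \<subseteq> f ` {0..<n-1}"
  proof
    fix x assume x: "x \<in> \<sigma>"
    then obtain i where i: "i < n" "x = f i" using f_surj \<sigma> by blast
    then have "i \<noteq> n - 1" using x c f_last by auto
    then show "x \<in> f ` {0..<n-1}" using i by auto
  qed
  have arc_f: "arc n r (f s) = f ` {s..s+r}" for s
  proof -
    have "{s..s+r} = (\<lambda>i. s + i) ` {..r}"
      using image_add_atLeastAtMost[of s 0 r] by (simp add: atLeast0AtMost add.commute)
    then show ?thesis by (simp add: arc_def f_def image_image mod_add_left_eq add.assoc)
  qed
  show ?thesis
  proof (rule vanishing_path_subset[OF r, of f 0 "n - 1"])
    show "inj_on f {0..n - 1}" using inj by (rule inj_on_subset) (use n0 in auto)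
    show "\<sigma> \<subseteq> f ` {0..<n - 1}" by (rule sub)
    show "\<exists>s\<ge>0. s + r < n - 1 \<and> A = f ` {s..s+r}" if A: "A \<in> arc_sets n r" "A \<subseteq> \<sigma>" for A
    proof -
      obtain s0 where "s0 < n" "A = arc n r s0" using A by (auto simp: arc_sets_def)
      then obtain s where s: "s < n" "A = f ` {s..s+r}" using f_surj arc_f by metis
      have "n - 1 \<notin> {s..s+r}" using s(2) A(2) c(2) f_last by blast
      then show ?thesis using s by (intro exI[of _ s]) auto
    qed
    show "f ` {s..s+r} \<in> arc_sets n r" for s
      using arc_f[of s, symmetric] n0 by (auto simp: arc_sets_def f_def)
    have "n div (r + 2) = p" unfolding n using q by (subst div_mult_self4) auto
    then have "(n - 1 - 0 + 1) div (r + 2) = p" using n0 by simp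
    then show "r * ((n - 1 - 0 + 1) div (r + 2)) < t" using t by simp
  qed
qed

end

section \<open>Upper and lower bounds for cycles and wheels\<close>

lemma arc_sets_full: "arc_sets (Suc r) r = {{..<Suc r}}"
proof -
  have "arc (Suc r) r s = {..<Suc r}" if "s < Suc r" for s
    using that by (auto simp: arc_eq)
  then show ?thesis by (auto simp: arc_sets_def)
qed

text \<open>For \<open>q \<noteq> 0\<close> this is positive, so the subtraction is not truncated.\<close>

definition cycle_reg :: "nat \<Rightarrow> nat \<Rightarrow> nat \<Rightarrow> nat" where
  "cycle_reg r p q = (if q \<noteq> 0 then r * p + q - 1 else r * p)"

text \<open>A set containing the hub \<open>n\<close> is always connected, so any \<open>r\<close>
  rim vertices complete it to a generator.\<close>

definition wheel_gens :: "nat \<Rightarrow> nat \<Rightarrow> nat set set" where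
  "wheel_gens n r = arc_sets n r \<union> insert n ` {S. S \<subseteq> {..<n} \<and> card S = r}"

context
  fixes n r p q :: nat
  assumes r: "1 \<le> r" and rn: "r < n" and n: "n = (r + 2) * p + q" and q: "q \<le> r + 1"
begin

lemma length_of_p_0: "p = 0 \<Longrightarrow> n = r + 1 \<and> q = r + 1"
  using n q rn by auto

text \<open>Aimed at the hub: its link has no simplices with \<open>r\<close> or more vertices, so
  with this bound it cannot contribute in a degree above \<open>cycle_reg r p q\<close>.\<close>

lemma cycle_reg_ge: "r \<le> cycle_reg r p q"
  using length_of_p_0 by (cases p) (auto simp: cycle_reg_def)

text \<open>The case \<open>p = 0\<close>, outside the range of the path arguments: all arcs
  coincide with the vertex set, which leaves the boundary of an \<open>r\<close>-simplex.\<close>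

lemma cycle_simplex_boundary:
  assumes "n = r + 1"
  shows "concentrated TYPE('k::field) r (cpx {..<n} (arc_sets n r))"
proof -
  have "(\<forall>t. van TYPE('k) (t + (card {..<n} - 1)) {..<n} {{..<n}} \<longleftrightarrow>
        van TYPE('k) t ({..<n} - {..<n}) {{..<n}})
      \<and> (\<forall>t<card {..<n} - 1. van TYPE('k) t {..<n} {{..<n}})"
    by (rule vanishing_block) (use assms in auto)
  moreover have "van TYPE('k) t ({..<n} - {..<n}) {{..<n}} \<longleftrightarrow> t \<noteq> 0" for t
    using concentrated_empty[of "{{..<n}}", where 'k = 'k] assms by (auto simp: concentrated_def)
  ultimately have *: "van TYPE('k) (t + r) {..<n} {{..<n}} \<longleftrightarrow> t \<noteq> 0"
    and **: "t < r \<Longrightarrow> van TYPE('k) t {..<n} {{..<n}}" for t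
    using assms by auto
  have "van TYPE('k) t {..<n} {{..<n}} \<longleftrightarrow> t \<noteq> r" for t
    using *[of "t - r"] **[of t] by (cases "t < r") auto
  then show ?thesis by (simp add: concentrated_def arc_sets_full assms)
qed

lemma cycle_vanishing:
  assumes "\<sigma> \<subseteq> {..<n}" "t > cycle_reg r p q"
  shows "van TYPE('k::field) t \<sigma> (arc_sets n r)"
proof (cases "p = 0")
  case True
  have t: "t > r" using assms(2) cycle_reg_ge by simp
  show ?thesis
  proof (cases "\<sigma> = {..<n}")
    case True
    then show ?thesis
      using cycle_simplex_boundary[where 'k = 'k] length_of_p_0[OF \<open>p = 0\<close>] t by (simp add: concentrated_def)
  next
    case False
    then have "card \<sigma> < n" using assms(1) by (metis card_lessThan finite_lessThan psubsetI psubset_card_mono)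
    then have "card \<sigma> < t" using t length_of_p_0[OF True] by simp
    then show ?thesis
      using assms(1) finite_subset by (intro vanishing_trivial) auto
  qed
next
  case False
  then have p: "1 \<le> p" by simp
  have rp: "r * p \<le> cycle_reg r p q" by (auto simp: cycle_reg_def)
  show ?thesis
  proof (cases "\<sigma> = {..<n}")
    case True
    then show ?thesis
      using cycle_concentrated[OF r p n q, where 'k = 'k] cycle_vanishing_0[OF r p n q, of t, where 'k = 'k] assms(2)
      by (auto simp: cycle_reg_def concentrated_def split: if_splits)
  next
    case False
    then show ?thesis
      using cycle_proper_subset_vanishing[OF r p n q, of \<sigma> t, where 'k = 'k] assms rp by auto
  qed
qed

lemma cycle_nonvanishing:
  "\<exists>\<sigma>\<subseteq>{..<n}. \<not> van TYPE('k::field) (cycle_reg r p q) \<sigma> (arc_sets n r)"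
proof -
  consider "p = 0" | "1 \<le> p" "q = 0" | "1 \<le> p" "q \<noteq> 0" by linarith
  then show ?thesis
  proof cases
    case 1
    then show ?thesis using cycle_simplex_boundary[where 'k = 'k] length_of_p_0
      by (intro exI[of _ "{..<n}"]) (auto simp: cycle_reg_def concentrated_def)
  next
    case 2
    then show ?thesis using cycle_nonvanishing_0[OF r 2(1) n q 2(2), where 'k = 'k]
      by (intro exI[of _ "{1..<n}"]) (auto simp: cycle_reg_def)
  next
    case 3
    then show ?thesis using cycle_concentrated[OF r 3(1) n q 3(2), where 'k = 'k]
      by (intro exI[of _ "{..<n}"]) (auto simp: cycle_reg_def concentrated_def)
  qed
qed

lemma cpx_wheel_rim: "n \<notin> \<sigma> \<Longrightarrow> cpx \<sigma> (wheel_gens n r) = cpx \<sigma> (arc_sets n r)"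
  by (rule cpx_cong) (auto simp: wheel_gens_def)

lemma wheel_vanishing:
  assumes "\<sigma> \<subseteq> {..n}" "t > cycle_reg r p q"
  shows "van TYPE('k::field) t \<sigma> (wheel_gens n r)"
proof (cases "n \<in> \<sigma>")
  case False
  then have "\<sigma> \<subseteq> {..<n}" using assms(1) by (force simp: less_le)
  then show ?thesis using cycle_vanishing assms(2) cpx_wheel_rim[OF False] by simp
next
  case True
  have fin: "finite \<sigma>" using assms(1) finite_subset by blast
  have rim: "\<sigma> - {n} \<subseteq> {..<n}" using assms(1) by (force simp: less_le)
  obtain t' where t': "t = Suc t'" "r \<le> t'" using assms(2) cycle_reg_ge
    by (cases t) auto
  have "van TYPE('k) t (\<sigma> - {n}) (wheel_gens n r)"
    using cycle_vanishing[OF rim] assms(2) by (simp add: cpx_wheel_rim)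
  moreover have "card T < r" if "T \<in> cpx (\<sigma> - {n}) (link_gens n (wheel_gens n r))" for T
  proof (rule ccontr)
    assume "\<not> card T < r"
    then obtain S where S: "S \<subseteq> T" "card S = r" by (meson not_less obtain_subset_with_card_n)
    then have "S \<subseteq> {..<n}" using that rim by (auto simp: cpx_def)
    then have "insert n S \<in> wheel_gens n r" "insert n S - {n} = S"
      using S by (auto simp: wheel_gens_def)
    then have "S \<in> link_gens n (wheel_gens n r)" unfolding link_gens_def by (metis image_eqI)
    then show False using that S by (auto simp: cpx_def)
  qed
  then have "van TYPE('k) t' (\<sigma> - {n}) (link_gens n (wheel_gens n r))"
    using t'(2) unfolding vanishing_def by (metis not_le)
  ultimately show ?thesis using vanishing_Suc_of_del_link[OF fin True] t'(1) by blast
qed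

lemma wheel_nonvanishing:
  "\<exists>\<sigma>\<subseteq>{..n}. \<not> van TYPE('k::field) (cycle_reg r p q) \<sigma> (wheel_gens n r)"
proof -
  obtain \<sigma> where "\<sigma> \<subseteq> {..<n}" "\<not> van TYPE('k) (cycle_reg r p q) \<sigma> (arc_sets n r)"
    using cycle_nonvanishing by blast
  moreover from this have "cpx \<sigma> (wheel_gens n r) = cpx \<sigma> (arc_sets n r)"
    by (intro cpx_wheel_rim) auto
  ultimately show ?thesis by (intro exI[of _ \<sigma>]) auto
qed

end

section \<open>Monomial ideals and homogeneous components\<close>

abbreviation keysp where "keysp \<equiv> Poly_Mapping.keys"
abbreviation coef where "coef \<equiv> Poly_Mapping.lookup"

text \<open>Common form of homogeneous components (\<open>hcomp\<close>) and normal forms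
  (\<open>nf\<close>), which both inherit linearity from it.\<close>

definition restr :: "(('v \<Rightarrow>\<^sub>0 nat) \<Rightarrow> bool) \<Rightarrow> ('v, 'k::field) mpoly \<Rightarrow> ('v, 'k) mpoly" where
  "restr Q = Poly_Mapping.mapp (\<lambda>m c. if Q m then c else 0)"

lemma lookup_restr [simp]: "coef (restr Q f) m = (if Q m then coef f m else 0)"
  by (simp add: restr_def lookup_mapp in_keys_iff when_def)

lemma keys_restr: "keysp (restr Q f) = {m \<in> keysp f. Q m}"
  by (auto simp: in_keys_iff split: if_splits)

lemma restr_0 [simp]: "restr Q 0 = 0"
  by (rule poly_mapping_eqI) simp

lemma restr_add: "restr Q (f + g) = restr Q f + restr Q g"
  by (rule poly_mapping_eqI) (simp add: lookup_add)

lemma restr_uminus: "restr Q (- f) = - restr Q f"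
  by (rule poly_mapping_eqI) simp

lemma restr_diff: "restr Q (f - g) = restr Q f - restr Q g"
  by (rule poly_mapping_eqI) (simp add: lookup_minus)

lemma restr_sum: "restr Q (sum f A) = (\<Sum>x\<in>A. restr Q (f x))"
  by (rule poly_mapping_eqI) (simp add: lookup_sum)

lemma restr_eq_0_iff: "restr Q f = 0 \<longleftrightarrow> (\<forall>m\<in>keysp f. \<not> Q m)"
proof
  assume *: "restr Q f = 0"
  show "\<forall>m\<in>keysp f. \<not> Q m"
  proof
    fix m assume "m \<in> keysp f"
    moreover have "coef (restr Q f) m = 0" using * by simp
    ultimately show "\<not> Q m" by (cases "Q m") (simp_all add: in_keys_iff)
  qed
qed (auto intro!: poly_mapping_eqI simp: in_keys_iff)

lemma restr_id_iff: "restr Q f = f \<longleftrightarrow> (\<forall>m\<in>keysp f. Q m)"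
proof
  assume *: "restr Q f = f"
  show "\<forall>m\<in>keysp f. Q m"
  proof
    fix m assume "m \<in> keysp f"
    moreover have "coef (restr Q f) m = coef f m" using * by simp
    ultimately show "Q m" by (cases "Q m") (simp_all add: in_keys_iff)
  qed
qed (auto intro!: poly_mapping_eqI simp: in_keys_iff)

lemma mono_deg_eq_sum: "finite S \<Longrightarrow> keysp m \<subseteq> S \<Longrightarrow> mono_deg m = (\<Sum>x\<in>S. coef m x)"
  unfolding mono_deg_def by (rule sum.mono_neutral_left) (auto simp: in_keys_iff)

lemma mono_deg_add [simp]: "mono_deg (m + m') = mono_deg m + mono_deg m'"
proof -
  have "mono_deg (m + m') = (\<Sum>x\<in>keysp m \<union> keysp m'. coef (m + m') x)"
    by (rule mono_deg_eq_sum) (use keys_add[of m m'] in auto)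
  also have "\<dots> = mono_deg m + mono_deg m'"
    by (simp add: lookup_add sum.distrib mono_deg_eq_sum[of "keysp m \<union> keysp m'" m]
        mono_deg_eq_sum[of "keysp m \<union> keysp m'" m'])
  finally show ?thesis .
qed

lemma mono_deg_0 [simp]: "mono_deg 0 = 0"
  by (simp add: mono_deg_def)

lemma mono_deg_single [simp]: "mono_deg (Poly_Mapping.single x n) = n"
  by (simp add: mono_deg_def)

lemma mono_deg_eq_0_iff: "mono_deg m = 0 \<longleftrightarrow> m = 0"
  by (auto simp: mono_deg_def in_keys_iff intro!: poly_mapping_eqI)

lemma keys_add_nat: "keysp (m + m' :: 'v \<Rightarrow>\<^sub>0 nat) = keysp m \<union> keysp m'"
  by (auto simp: in_keys_iff lookup_add)

definition hpoly :: "'v set \<Rightarrow> int \<Rightarrow> ('v, 'k::field) mpoly set" where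
  "hpoly V d = {f \<in> poly_ring V. homogeneous d f}"

lemma hpoly_iff: "f \<in> hpoly V d \<longleftrightarrow> (\<forall>m\<in>keysp f. keysp m \<subseteq> V \<and> int (mono_deg m) = d)"
  by (auto simp: hpoly_def poly_ring_def homogeneous_def)

lemma hpoly_0 [simp]: "0 \<in> hpoly V d"
  by (simp add: hpoly_iff)

lemma hpoly_add [intro]: "f \<in> hpoly V d \<Longrightarrow> g \<in> hpoly V d \<Longrightarrow> f + g \<in> hpoly V d"
  using keys_add[of f g] by (fastforce simp: hpoly_iff)

lemma hpoly_uminus [intro]: "f \<in> hpoly V d \<Longrightarrow> - f \<in> hpoly V d"
  by (simp add: hpoly_iff)

lemma hpoly_diff [intro]: "f \<in> hpoly V d \<Longrightarrow> g \<in> hpoly V d \<Longrightarrow> f - g \<in> hpoly V d"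
  using hpoly_add[of f V d "- g"] by auto

lemma hpoly_sum [intro]: "(\<And>x. x \<in> A \<Longrightarrow> f x \<in> hpoly V d) \<Longrightarrow> sum f A \<in> hpoly V d"
  by (induction A rule: infinite_finite_induct) auto

lemma hpoly_mult [intro]: "f \<in> hpoly V a \<Longrightarrow> g \<in> hpoly V b \<Longrightarrow> f * g \<in> hpoly V (a + b)"
  using keys_mult[of f g] by (fastforce simp: hpoly_iff keys_add_nat)

lemma hpoly_neg: "d < 0 \<Longrightarrow> f \<in> hpoly V d \<Longrightarrow> f = 0"
  by (rule poly_mapping_eqI) (fastforce simp: hpoly_iff in_keys_iff)

lemma hpoly_0_coef: "f \<in> hpoly V d \<Longrightarrow> d \<noteq> 0 \<Longrightarrow> coef f 0 = 0"
  by (auto simp: hpoly_iff in_keys_iff dest: bspec[of _ _ 0])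

lemma hpoly_1 [simp]: "1 \<in> hpoly V 0"
  by (simp add: hpoly_iff)

lemma hpoly_Var [intro]: "x \<in> V \<Longrightarrow> Var x \<in> hpoly V 1"
  by (auto simp: hpoly_iff Var_def)

lemma hpoly_restr [intro]: "f \<in> hpoly V d \<Longrightarrow> restr Q f \<in> hpoly V d"
  by (auto simp: hpoly_iff keys_restr)

lemma hpoly_poly_ring: "f \<in> hpoly V d \<Longrightarrow> f \<in> poly_ring V"
  by (simp add: hpoly_def)

lemma poly_ring_0 [simp]: "0 \<in> poly_ring V"
  by (simp add: poly_ring_def)

lemma poly_ring_add [intro]: "f \<in> poly_ring V \<Longrightarrow> g \<in> poly_ring V \<Longrightarrow> f + g \<in> poly_ring V"
  using keys_add[of f g] by (fastforce simp: poly_ring_def)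

lemma poly_ring_uminus [intro]: "(f :: ('v, 'k::field) mpoly) \<in> poly_ring V \<Longrightarrow> - f \<in> poly_ring V"
  by (simp add: poly_ring_def)

lemma poly_ring_diff [intro]:
  "(f :: ('v, 'k::field) mpoly) \<in> poly_ring V \<Longrightarrow> g \<in> poly_ring V \<Longrightarrow> f - g \<in> poly_ring V"
  using poly_ring_add[of f V "- g"] by auto

lemma poly_ring_sum [intro]: "(\<And>x. x \<in> A \<Longrightarrow> f x \<in> poly_ring V) \<Longrightarrow> sum f A \<in> poly_ring V"
  by (induction A rule: infinite_finite_induct) auto

lemma poly_ring_mult [intro]: "f \<in> poly_ring V \<Longrightarrow> g \<in> poly_ring V \<Longrightarrow> f * g \<in> poly_ring V"
  using keys_mult[of f g] by (fastforce simp: poly_ring_def keys_add_nat)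

lemma poly_ring_restr [intro]: "f \<in> poly_ring V \<Longrightarrow> restr Q f \<in> poly_ring V"
  by (auto simp: poly_ring_def keys_restr)

lemma poly_ring_single [intro]: "keysp m \<subseteq> V \<Longrightarrow> Poly_Mapping.single m c \<in> poly_ring V"
  by (auto simp: poly_ring_def)

definition hcomp :: "int \<Rightarrow> ('v, 'k::field) mpoly \<Rightarrow> ('v, 'k) mpoly" where
  "hcomp d = restr (\<lambda>m. int (mono_deg m) = d)"

lemma hcomp_hpoly [intro]: "f \<in> poly_ring V \<Longrightarrow> hcomp d f \<in> hpoly V d"
  by (auto simp: hcomp_def hpoly_iff keys_restr poly_ring_def)

lemma hcomp_id: "f \<in> hpoly V d \<Longrightarrow> hcomp d f = f"
  by (simp add: hcomp_def restr_id_iff hpoly_iff)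

lemma mpoly_sum_single: "f = (\<Sum>m\<in>keysp f. Poly_Mapping.single m (coef f m))"
  by (rule poly_mapping_eqI) (simp add: lookup_sum lookup_single when_def in_keys_iff)

lemma restr_single: "restr Q (Poly_Mapping.single m c) = (if Q m then Poly_Mapping.single m c else 0)"
  by (rule poly_mapping_eqI) (auto simp: lookup_single when_def)

text \<open>Serves two purposes: \<open>Q'\<close> is a degree condition shifted by the degree of a
  homogeneous \<open>g\<close>, or constantly false when all terms of the product violate
  \<open>Q\<close>.\<close>

lemma restr_mult_general:
  assumes "\<And>m m'. m \<in> keysp g \<Longrightarrow> m' \<in> keysp f \<Longrightarrow> Q (m + m') \<longleftrightarrow> Q' m'"
  shows "restr Q (g * f) = g * restr Q' f"
proof -
  have "restr Q (g * f) = restr Q ((\<Sum>m\<in>keysp g. Poly_Mapping.single m (coef g m)) *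
      (\<Sum>m\<in>keysp f. Poly_Mapping.single m (coef f m)))"
    by (simp flip: mpoly_sum_single)
  also have "\<dots> = (\<Sum>m\<in>keysp g. \<Sum>m'\<in>keysp f.
      Poly_Mapping.single m (coef g m) * restr Q' (Poly_Mapping.single m' (coef f m')))"
    unfolding sum_product restr_sum using assms
    by (intro sum.cong refl) (simp add: mult_single restr_single)
  also have "\<dots> = (\<Sum>m\<in>keysp g. Poly_Mapping.single m (coef g m)) *
      restr Q' (\<Sum>m\<in>keysp f. Poly_Mapping.single m (coef f m))"
    unfolding sum_product restr_sum ..
  finally show ?thesis by (simp flip: mpoly_sum_single)
qed

lemma hcomp_mult:
  assumes "homogeneous a g"
  shows "hcomp d (g * f) = g * hcomp (d - a) f"
  unfolding hcomp_def
  by (rule restr_mult_general) (use assms in \<open>auto simp: homogeneous_def\<close>)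

section \<open>Normal forms modulo squarefree monomial ideals\<close>

definition std_mono :: "'v set set \<Rightarrow> ('v \<Rightarrow>\<^sub>0 nat) \<Rightarrow> bool" where
  "std_mono \<G> m \<longleftrightarrow> (\<forall>A\<in>\<G>. \<not> A \<subseteq> keysp m)"

text \<open>The normal form modulo the squarefree monomial ideal with generators indexed by \<open>\<G>\<close>.\<close>

definition nf :: "'v set set \<Rightarrow> ('v, 'k::field) mpoly \<Rightarrow> ('v, 'k) mpoly" where
  "nf \<G> = restr (std_mono \<G>)"

text \<open>\<open>g\<close> differs from its normal form by nonstandard monomials, which stay
  nonstandard under multiplication. So reduction may be postponed, and normal forms model the
  quotient ring.\<close>

lemma nf_mult: "nf \<G> (f * nf \<G> g) = nf \<G> (f * g)"
proof -
  have "nf \<G> (f * (g - nf \<G> g)) = f * 0"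
    unfolding nf_def
  proof (subst restr_mult_general[where Q' = "\<lambda>_. False"])
    fix m m' assume "m' \<in> keysp (g - restr (std_mono \<G>) g)"
    then have "\<not> std_mono \<G> m'" by (auto simp: in_keys_iff lookup_minus split: if_splits)
    then show "std_mono \<G> (m + m') \<longleftrightarrow> False" by (auto simp: std_mono_def keys_add_nat)
  qed (simp add: restr_eq_0_iff[THEN iffD2])
  then show ?thesis by (simp add: right_diff_distrib nf_def restr_diff)
qed

lemma nf_idem [simp]: "nf \<G> (nf \<G> f) = nf \<G> f"
  by (rule poly_mapping_eqI) (simp add: nf_def)

definition expo :: "'v set \<Rightarrow> 'v \<Rightarrow>\<^sub>0 nat" where
  "expo A = (\<Sum>x\<in>A. Poly_Mapping.single x 1)"

lemma lookup_expo: "finite A \<Longrightarrow> coef (expo A) x = (if x \<in> A then 1 else 0)"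
  by (auto simp: expo_def lookup_sum lookup_single when_def)

lemma keys_expo: "finite A \<Longrightarrow> keysp (expo A) = A"
  by (auto simp: in_keys_iff lookup_expo split: if_splits)

lemma mono_deg_expo: "finite A \<Longrightarrow> mono_deg (expo A) = card A"
  by (simp add: mono_deg_def keys_expo lookup_expo)

lemma prod_Var: "finite A \<Longrightarrow> (\<Prod>x\<in>A. Var x) = Poly_Mapping.single (expo A) (1 :: 'k::field)"
  by (induction A rule: finite_induct) (simp_all add: Var_def expo_def mult_single)

text \<open>Membership in a monomial ideal is decided term by term: a term belongs to it if its
  support contains some \<open>A \<in> \<G>\<close>.\<close>

lemma monomial_ideal_iff:
  fixes f :: "('v, 'k::field) mpoly"
  assumes fin: "\<And>A. A \<in> \<G> \<Longrightarrow> finite A \<and> A \<subseteq> V"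
  shows "f \<in> ideal_gen V {\<Prod>x\<in>A. Var x | A. A \<in> \<G>} \<longleftrightarrow> f \<in> poly_ring V \<and> nf \<G> f = 0"
proof
  assume "f \<in> ideal_gen V {\<Prod>x\<in>A. Var x | A. A \<in> \<G>}"
  then obtain T c where T: "f = (\<Sum>s\<in>T. c s * s)" "T \<subseteq> {\<Prod>x\<in>A. Var x | A. A \<in> \<G>}"
    "\<And>s. s \<in> T \<Longrightarrow> c s \<in> poly_ring V"
    by (auto simp: ideal_gen_def)
  have "c s * s \<in> poly_ring V \<and> nf \<G> (c s * s) = 0" if "s \<in> T" for s
  proof -
    have "s \<in> {\<Prod>x\<in>A. Var x | A. A \<in> \<G>}" using T(2) that by (rule subsetD)
    then obtain A where A: "A \<in> \<G>" "s = (\<Prod>x\<in>A. Var x)" by auto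
    then have s: "s = Poly_Mapping.single (expo A) 1" using fin[OF A(1)] by (simp add: prod_Var)
    have "s \<in> poly_ring V" using s fin[OF A(1)] by (simp add: poly_ring_single keys_expo)
    moreover have "\<not> std_mono \<G> m" if m: "m \<in> keysp (c s * s)" for m
    proof -
      obtain m' where "m = m' + expo A" using m keys_mult[of "c s" s] by (auto simp: s)
      then show ?thesis using A(1) fin[OF A(1)] by (auto simp: std_mono_def keys_add_nat keys_expo)
    qed
    ultimately show ?thesis using T(3) that by (auto simp: nf_def restr_eq_0_iff)
  qed
  then show "f \<in> poly_ring V \<and> nf \<G> f = 0" by (auto simp: T(1) nf_def restr_sum)
next
  assume f: "f \<in> poly_ring V \<and> nf \<G> f = 0"
  then have "\<forall>m\<in>keysp f. \<exists>A. A \<in> \<G> \<and> A \<subseteq> keysp m"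
    by (auto simp: nf_def restr_eq_0_iff std_mono_def)
  then obtain A where A: "\<And>m. m \<in> keysp f \<Longrightarrow> A m \<in> \<G> \<and> A m \<subseteq> keysp m" by metis
  define g where "g m = (\<Prod>x\<in>A m. Var x :: ('v, 'k) mpoly)" for m
  define h where "h m = Poly_Mapping.single (m - expo (A m)) (coef f m)" for m
  have hg: "h m * g m = Poly_Mapping.single m (coef f m)" if "m \<in> keysp f" for m
  proof -
    have "finite (A m)" using A fin that by blast
    moreover have "m - expo (A m) + expo (A m) = m"
      using A[OF that] \<open>finite (A m)\<close>
      by (intro poly_mapping_eqI) (auto simp: lookup_add lookup_minus lookup_expo in_keys_iff)
    ultimately show ?thesis by (simp add: h_def g_def prod_Var mult_single)
  qed
  have h: "h m \<in> poly_ring V" if "m \<in> keysp f" for m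
  proof -
    have "keysp (m - expo (A m)) \<subseteq> keysp m" by (auto simp: in_keys_iff lookup_minus)
    then show ?thesis using that f by (auto simp: h_def poly_ring_def)
  qed
  have "f = (\<Sum>m\<in>keysp f. h m * g m)"
    using hg mpoly_sum_single[of f] by simp
  \<comment> \<open>Different terms of \<open>f\<close> may use the same generator, whereas
    \<open>ideal_gen\<close> sums over distinct ones; the terms are collected by generator.\<close>
  also have "\<dots> = (\<Sum>s\<in>g ` keysp f. \<Sum>m\<in>{m. m \<in> keysp f \<and> g m = s}. h m * g m)"
    by (rule sum.image_gen) simp
  also have "\<dots> = (\<Sum>s\<in>g ` keysp f. (\<Sum>m\<in>{m. m \<in> keysp f \<and> g m = s}. h m) * s)"
    by (simp add: sum_distrib_right)
  finally show "f \<in> ideal_gen V {\<Prod>x\<in>A. Var x | A. A \<in> \<G>}"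
    unfolding ideal_gen_def mem_Collect_eq
    using A h by (intro exI[of _ "g ` keysp f"] exI conjI) (assumption, auto simp: g_def)
qed

text \<open>The variables generate the squarefree monomial ideal of the singletons. Minimality of a
  resolution thus becomes the vanishing of constant coefficients.\<close>

lemma irrelevant_ideal_iff:
  fixes f :: "('v, 'k::field) mpoly"
  shows "f \<in> ideal_gen V (Var ` V) \<longleftrightarrow> f \<in> poly_ring V \<and> coef f 0 = 0"
proof -
  have "Var ` V = {\<Prod>x\<in>A. Var x :: ('v, 'k) mpoly | A. A \<in> (\<lambda>x. {x}) ` V}" by force
  moreover have "nf ((\<lambda>x. {x}) ` V) f = 0 \<longleftrightarrow> coef f 0 = 0" if f: "f \<in> poly_ring V"
  proof -
    have "\<not> std_mono ((\<lambda>x. {x}) ` V) m \<longleftrightarrow> m \<noteq> 0" if "m \<in> keysp f" for m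
    proof -
      have "\<not> std_mono ((\<lambda>x. {x}) ` V) m \<longleftrightarrow> keysp m \<noteq> {}"
        using f that unfolding std_mono_def poly_ring_def by blast
      then show ?thesis by simp
    qed
    then show ?thesis unfolding nf_def restr_eq_0_iff by (metis in_keys_iff)
  qed
  ultimately show ?thesis
    using monomial_ideal_iff[of "(\<lambda>x. {x}) ` V" V f] by auto
qed

section \<open>Koszul homology and Hochster's formula\<close>

text \<open>The Koszul complex of the variables over the quotient ring: \<open>f S\<close> is the
  coefficient, in normal form, of the exterior basis element indexed by \<open>S\<close>. The
  differential is written from its target, collecting at \<open>S\<close> the contributions of all
  \<open>insert x S\<close>. For \<open>\<G> = {}\<close> the coefficients are polynomials.\<close>

definition koszul :: "'v::linorder set set \<Rightarrow> 'v set \<Rightarrow> ('v set \<Rightarrow> ('v, 'k::field) mpoly) \<Rightarrow>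
    'v set \<Rightarrow> ('v, 'k) mpoly" where
  "koszul \<G> V f S = nf \<G> (\<Sum>x\<in>V - S. esgn x S * Var x * f (insert x S))"

text \<open>Homological degree \<open>p\<close> and internal degree \<open>j\<close>: the exterior
  basis element has degree \<open>p\<close>, which leaves \<open>j - p\<close> for its coefficient.
  With value 0 elsewhere, equality of functions is equality of chains.\<close>

definition koszul_chains :: "'v::linorder set set \<Rightarrow> 'v set \<Rightarrow> nat \<Rightarrow> int \<Rightarrow>
    ('v set \<Rightarrow> ('v, 'k::field) mpoly) set" where
  "koszul_chains \<G> V p j = {f. \<forall>S. if S \<subseteq> V \<and> card S = p
     then f S \<in> hpoly V (j - int p) \<and> nf \<G> (f S) = f S else f S = 0}"

lemma koszul_chains_0:
  assumes "f \<in> koszul_chains \<G> V p j" "\<not> (S \<subseteq> V \<and> card S = p)"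
  shows "f S = 0"
proof -
  have "if S \<subseteq> V \<and> card S = p then f S \<in> hpoly V (j - int p) \<and> nf \<G> (f S) = f S else f S = 0"
    using assms(1) unfolding koszul_chains_def mem_Collect_eq by (rule spec)
  then show ?thesis using assms(2) by (simp only: if_False)
qed

lemma lookup_esgn_mult: "coef (esgn x S * f) m = esgn x S * coef f m"
  unfolding esgn_def by (cases "even (card {z \<in> S. z < x})") simp_all

lemma esgn_const: "esgn x S \<in> hpoly V 0"
  unfolding esgn_def by (cases "even (card {z \<in> S. z < x})") auto

lemma lookup_Var_mult:
  "coef (Var x * f) m = (if x \<in> keysp m then coef f (m - Poly_Mapping.single x 1) else 0)"
proof -
  have "Var x * f = (\<Sum>m'\<in>keysp f. Poly_Mapping.single (Poly_Mapping.single x 1 + m') (coef f m'))"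
    unfolding Var_def by (subst mpoly_sum_single[of f]) (simp add: sum_distrib_left mult_single)
  then have 1: "coef (Var x * f) m =
      (\<Sum>m'\<in>keysp f. coef f m' when Poly_Mapping.single x 1 + m' = m)"
    by (simp add: lookup_sum lookup_single)
  show ?thesis
  proof (cases "x \<in> keysp m")
    case True
    have "Poly_Mapping.single x 1 + m' = m \<longleftrightarrow> m' = m - Poly_Mapping.single x 1" for m'
    proof
      assume m': "m' = m - Poly_Mapping.single x 1"
      show "Poly_Mapping.single x 1 + m' = m"
        unfolding m' using True
        by (intro poly_mapping_eqI) (auto simp: lookup_add lookup_minus lookup_single when_def in_keys_iff)
    qed auto
    then have "coef (Var x * f) m =
        (\<Sum>m'\<in>keysp f. if m' = m - Poly_Mapping.single x 1 then coef f m' else 0)"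
      unfolding 1 when_def by simp
    also have "\<dots> = coef f (m - Poly_Mapping.single x 1)"
      by (simp add: in_keys_iff)
    finally show ?thesis using True by simp
  next
    case False
    then have "Poly_Mapping.single x 1 + m' \<noteq> m" for m' by (auto simp: keys_add_nat)
    then show ?thesis using False unfolding 1 by simp
  qed
qed

lemma lookup_koszul:
  "coef (koszul \<G> V f S) m = (if std_mono \<G> m then \<Sum>x\<in>V - S. esgn x S *
     (if x \<in> keysp m then coef (f (insert x S)) (m - Poly_Mapping.single x 1) else 0) else 0)"
  by (simp add: koszul_def nf_def lookup_sum mult.assoc lookup_esgn_mult lookup_Var_mult
      cong: if_cong)

lemma koszul_in_chains:
  assumes V: "finite V" and f: "f \<in> koszul_chains \<G> V (Suc p) j"
  shows "koszul \<G> V f \<in> koszul_chains \<G> V p j"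
  unfolding koszul_chains_def mem_Collect_eq
proof
  fix S
  show "if S \<subseteq> V \<and> card S = p then koszul \<G> V f S \<in> hpoly V (j - int p) \<and>
      nf \<G> (koszul \<G> V f S) = koszul \<G> V f S else koszul \<G> V f S = 0"
  proof (cases "S \<subseteq> V \<and> card S = p")
    case True
    have "finite S" using True V finite_subset[of S V] by simp
    have summand: "esgn x S * Var x * f (insert x S) \<in> hpoly V (j - int p)" if "x \<in> V - S" for x
    proof -
      have "f (insert x S) \<in> hpoly V (j - int (Suc p))"
        using f True that \<open>finite S\<close> unfolding koszul_chains_def mem_Collect_eq
        by (auto dest!: spec[of _ "insert x S"])
      then have "esgn x S * Var x * f (insert x S) \<in> hpoly V (0 + 1 + (j - int (Suc p)))"
        using that by (intro hpoly_mult esgn_const hpoly_Var) auto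
      then show ?thesis by simp
    qed
    have "koszul \<G> V f S \<in> hpoly V (j - int p)"
      unfolding koszul_def nf_def by (intro hpoly_restr hpoly_sum summand)
    moreover have "nf \<G> (koszul \<G> V f S) = koszul \<G> V f S" by (simp add: koszul_def)
    ultimately show ?thesis using True by simp
  next
    case False
    have "f (insert x S) = 0" if "x \<in> V - S" for x
    proof -
      have "\<not> (insert x S \<subseteq> V \<and> card (insert x S) = Suc p)"
      proof
        assume *: "insert x S \<subseteq> V \<and> card (insert x S) = Suc p"
        then have "finite S" using V finite_subset[of S V] by simp
        then show False using * False that by simp
      qed
      then show ?thesis by (rule koszul_chains_0[OF f])
    qed
    then show ?thesis using False by (auto simp: koszul_def nf_def)
  qed
qed

lemma koszul_diff: "koszul \<G> V (f - g) = koszul \<G> V f - koszul \<G> V g"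
  by (rule ext) (simp add: koszul_def nf_def right_diff_distrib sum_subtractf restr_diff)

section \<open>Multigraded strands of the Koszul complex\<close>

definition twist :: "'v::linorder set \<Rightarrow> 'v set \<Rightarrow> 'k::field" where
  "twist W \<tau> = (\<Prod>y\<in>\<tau>. esgn y W)"

lemma twist_square [simp]: "twist W \<tau> * twist W \<tau> = (1 :: 'k::field)"
  unfolding twist_def by (simp flip: prod.distrib)

lemma twist_square_left [simp]: "twist W \<tau> * (twist W \<tau> * x) = (x :: 'k::field)"
  by (simp flip: mult.assoc)

lemma esgn_split:
  assumes "finite W" "\<tau> \<subseteq> W"
  shows "esgn x W = esgn x \<tau> * (esgn x (W - \<tau>) :: 'k::field)"
proof -
  have "{z \<in> W. z < x} = {z \<in> \<tau>. z < x} \<union> {z \<in> W - \<tau>. z < x}" using assms by auto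
  moreover have "finite \<tau>" using assms finite_subset by blast
  ultimately have "card {z \<in> W. z < x} = card {z \<in> \<tau>. z < x} + card {z \<in> W - \<tau>. z < x}"
    using assms by (simp, intro card_Un_disjoint) auto
  then show ?thesis by (simp add: esgn_def power_add)
qed

text \<open>Koszul signs count in the complement \<open>W - \<tau>\<close>, coboundary signs in
  \<open>\<tau>\<close>. Their product is the sign in all of \<open>W\<close>, which does not depend
  on \<open>\<tau>\<close>; multiplied over \<open>\<tau>\<close> it converts one convention into
  the other.\<close>

lemma twist_remove:
  assumes "finite W" "\<tau> \<subseteq> W" "x \<in> \<tau>"
  shows "twist W \<tau> * esgn x (W - \<tau>) = esgn x \<tau> * (twist W (\<tau> - {x}) :: 'k::field)"
proof -
  have "finite \<tau>" using assms finite_subset by blast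
  then have "twist W \<tau> = esgn x W * (twist W (\<tau> - {x}) :: 'k)"
    unfolding twist_def using assms by (subst prod.remove[of _ x]) auto
  then show ?thesis using esgn_split[OF assms(1,2), of x, where 'k = 'k] by (simp add: mult_ac)
qed

text \<open>The strand of a Koszul chain in multidegree \<open>a\<close>. The Koszul differential removes a vertex from
  the exterior index \<open>S\<close>, so on the complements \<open>keysp a - S\<close> it becomes a simplicial
  coboundary; \<open>twist\<close> adjusts the signs.\<close>

definition strand :: "('v::linorder \<Rightarrow>\<^sub>0 nat) \<Rightarrow> ('v set \<Rightarrow> ('v, 'k::field) mpoly) \<Rightarrow> 'v set \<Rightarrow> 'k" where
  "strand a f \<tau> = twist (keysp a) \<tau> * coef (f (keysp a - \<tau>)) (a - expo (keysp a - \<tau>))"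

text \<open>In a multidegree that is not squarefree, a vertex of exponent at least 2 is a cone point of the
  complex with these generators, so that only squarefree multidegrees contribute.\<close>

definition strand_gens :: "'v set set \<Rightarrow> ('v \<Rightarrow>\<^sub>0 nat) \<Rightarrow> 'v set set" where
  "strand_gens \<G> a = (\<lambda>A. A - {x. 2 \<le> coef a x}) ` \<G>"

text \<open>With one copy of each vertex outside \<open>\<tau>\<close> removed, the monomial is
  supported on \<open>\<tau>\<close> and on the vertices of exponent at least 2, and the latter are
  the ones stripped off in \<open>strand_gens\<close>.\<close>

lemma std_mono_strand:
  assumes "\<tau> \<subseteq> keysp a"
  shows "std_mono \<G> (a - expo (keysp a - \<tau>)) \<longleftrightarrow> \<tau> \<in> cpx (keysp a) (strand_gens \<G> a)"
proof -
  have "keysp (a - expo (keysp a - \<tau>)) = \<tau> \<union> {x. 2 \<le> coef a x}"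
    using assms by (auto simp: in_keys_iff lookup_minus lookup_expo split: if_splits)
  then show ?thesis using assms
    by (auto simp: std_mono_def cpx_def strand_gens_def)
qed

text \<open>In multidegree \<open>a\<close> the coefficient at \<open>S\<close> sits at the monomial
  \<open>a - expo S\<close>. A variable \<open>x\<close> outside \<open>S\<close> divides it exactly
  if \<open>x \<in> \<tau>\<close>, so the Koszul sum over \<open>V - S\<close> shrinks to the sum
  of a coboundary; \<open>twist_remove\<close> matches the signs.\<close>

lemma strand_koszul:
  assumes V: "finite V" "keysp a \<subseteq> V" and \<tau>: "\<tau> \<in> cpx (keysp a) (strand_gens \<G> a)"
  shows "strand a (koszul \<G> V f) \<tau> = cobd (strand a f) \<tau>"
proof -
  define W where "W = keysp a"
  define S where "S = W - \<tau>"
  define m where "m = a - expo S"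
  have sub: "\<tau> \<subseteq> W" using \<tau> by (simp add: cpx_def W_def)
  have std: "std_mono \<G> m" using std_mono_strand[of \<tau> a \<G>] sub \<tau> by (simp add: m_def S_def W_def)
  have finS: "finite S" by (simp add: S_def W_def)
  have keys_m: "x \<in> keysp m \<longleftrightarrow> x \<in> \<tau>" if "x \<notin> S" for x
    using that sub by (auto simp: m_def in_keys_iff lookup_minus lookup_expo finS S_def W_def)
  have step: "m - Poly_Mapping.single x 1 = a - expo (W - (\<tau> - {x}))" "insert x S = W - (\<tau> - {x})"
    if "x \<in> \<tau>" for x
  proof -
    show ins: "insert x S = W - (\<tau> - {x})" using that sub by (auto simp: S_def)
    show "m - Poly_Mapping.single x 1 = a - expo (W - (\<tau> - {x}))"
      unfolding ins[symmetric] m_def using finS that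
      by (intro poly_mapping_eqI) (auto simp: lookup_minus lookup_expo lookup_single when_def S_def)
  qed
  have "coef (koszul \<G> V f S) m = (\<Sum>x\<in>V - S. if x \<in> \<tau> then esgn x S *
      coef (f (insert x S)) (m - Poly_Mapping.single x 1) else 0)"
    using std by (auto simp: lookup_koszul keys_m intro!: sum.cong)
  also have "\<dots> = (\<Sum>x\<in>\<tau>. esgn x S * coef (f (insert x S)) (m - Poly_Mapping.single x 1))"
    using V sub by (subst sum.inter_restrict[symmetric]) (auto simp: W_def S_def intro!: sum.cong)
  finally have "strand a (koszul \<G> V f) \<tau> = (\<Sum>x\<in>\<tau>. (twist W \<tau> * esgn x S) *
      coef (f (insert x S)) (m - Poly_Mapping.single x 1))"
    by (simp add: strand_def m_def S_def W_def sum_distrib_left mult.assoc)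
  also have "\<dots> = cobd (strand a f) \<tau>"
    unfolding cobd_def strand_def W_def[symmetric]
  proof (intro sum.cong refl)
    fix x assume x: "x \<in> \<tau>"
    have tw: "twist W \<tau> * esgn x S = esgn x \<tau> * (twist W (\<tau> - {x}) :: 'b)"
      unfolding S_def using twist_remove[OF _ sub x] by (simp add: W_def)
    show "twist W \<tau> * esgn x S * coef (f (insert x S)) (m - Poly_Mapping.single x 1) =
        esgn x \<tau> * (twist W (\<tau> - {x}) * coef (f (W - (\<tau> - {x}))) (a - expo (W - (\<tau> - {x}))))"
      unfolding tw unfolding step[OF x] by (simp only: mult.assoc)
  qed
  finally show ?thesis .
qed

lemma coef_eq_strand:
  assumes "finite S"
  shows "coef (f S) m = twist (keysp (m + expo S)) (keysp m - S) *
    strand (m + expo S) f (keysp m - S)"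
proof -
  have "keysp (m + expo S) - (keysp m - S) = S" using assms by (auto simp: keys_add_nat keys_expo)
  then show ?thesis by (simp add: strand_def)
qed

lemma strand_complement:
  assumes "finite S" "std_mono \<G> m"
  shows "keysp m - S \<in> cpx (keysp (m + expo S)) (strand_gens \<G> (m + expo S))"
proof -
  have "keysp (m + expo S) - (keysp m - S) = S" using assms by (auto simp: keys_add_nat keys_expo)
  moreover have "keysp m - S \<subseteq> keysp (m + expo S)" by (auto simp: keys_add_nat)
  ultimately show ?thesis using std_mono_strand[of "keysp m - S" "m + expo S" \<G>] assms by simp
qed

text \<open>Read in one multidegree at a time, this is \<open>cobd_cobd\<close>.\<close>

lemma koszul_koszul:
  assumes V: "finite V" and f: "f \<in> koszul_chains {} V (Suc (Suc p)) j"
  shows "koszul {} V (koszul {} V f) = 0"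
proof
  fix S
  have in_ch: "koszul {} V (koszul {} V f) \<in> koszul_chains {} V p j"
    using V f by (intro koszul_in_chains)
  show "koszul {} V (koszul {} V f) S = 0 S"
  proof (rule poly_mapping_eqI)
    fix m
    show "coef (koszul {} V (koszul {} V f) S) m = coef (0 S) m"
    proof (cases "S \<subseteq> V \<and> card S = p \<and> keysp m \<subseteq> V")
      case True
      then have S: "finite S" "keysp (m + expo S) \<subseteq> V"
        using V finite_subset[of S V] by (auto simp: keys_add_nat keys_expo)
      let ?a = "m + expo S" and ?\<tau> = "keysp m - S"
      have \<tau>: "?\<tau> \<in> cpx (keysp ?a) (strand_gens {} ?a)"
        using strand_complement[OF S(1), of "{}"] by (simp add: std_mono_def)
      have "strand ?a (koszul {} V (koszul {} V f)) ?\<tau> = cobd (strand ?a (koszul {} V f)) ?\<tau>"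
        by (rule strand_koszul[OF V S(2) \<tau>])
      also have "\<dots> = cobd (cobd (strand ?a f)) ?\<tau>"
        by (intro cobd_cong strand_koszul[OF V S(2)] cpx_subset[OF \<tau>]) auto
      also have "\<dots> = 0" by (simp add: cobd_cobd)
      finally show ?thesis using S by (simp add: coef_eq_strand)
    next
      case False
      show ?thesis
      proof (cases "S \<subseteq> V \<and> card S = p")
        case True
        then have "koszul {} V (koszul {} V f) S \<in> hpoly V (j - int p)"
          using in_ch by (simp add: koszul_chains_def)
        then have "m \<notin> keysp (koszul {} V (koszul {} V f) S)"
          using True False by (auto simp: hpoly_iff)
        then show ?thesis by (simp add: in_keys_iff)
      next
        case False
        then show ?thesis using in_ch by (simp add: koszul_chains_def)
      qed
    qed
  qed
qed

definition koszul_acyclic :: "'k::field itself \<Rightarrow> 'v::linorder set set \<Rightarrow> 'v set \<Rightarrow> nat \<Rightarrow> int \<Rightarrow> bool" where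
  "koszul_acyclic _ \<G> V p j \<longleftrightarrow> (\<forall>f :: 'v set \<Rightarrow> ('v, 'k) mpoly. f \<in> koszul_chains \<G> V p j \<longrightarrow>
     koszul \<G> V f = 0 \<longrightarrow> (\<exists>g\<in>koszul_chains \<G> V (Suc p) j. f = koszul \<G> V g))"

text \<open>Lets a polynomial be assembled from coefficients prescribed in one degree, and makes
  graded pieces finite-dimensional.\<close>

lemma finite_monomials: "finite V \<Longrightarrow> finite {m :: 'v \<Rightarrow>\<^sub>0 nat. keysp m \<subseteq> V \<and> mono_deg m = d}"
proof -
  assume V: "finite V"
  have "Poly_Mapping.lookup ` {m. keysp m \<subseteq> V \<and> mono_deg m = d} \<subseteq>
      {h. \<forall>x. (x \<in> V \<longrightarrow> h x \<in> {..d}) \<and> (x \<notin> V \<longrightarrow> h x = 0)}"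
  proof clarify
    fix m x assume m: "keysp m \<subseteq> V" "d = mono_deg m"
    have "coef m x \<le> mono_deg m"
    proof (cases "x \<in> keysp m")
      case True
      then show ?thesis unfolding mono_deg_def by (intro member_le_sum) auto
    qed (simp add: in_keys_iff)
    then show "(x \<in> V \<longrightarrow> coef m x \<in> {..mono_deg m}) \<and> (x \<notin> V \<longrightarrow> coef m x = 0)"
      using m by (auto simp: in_keys_iff)
  qed
  moreover have "finite {h. \<forall>x. (x \<in> V \<longrightarrow> h x \<in> {..d}) \<and> (x \<notin> V \<longrightarrow> h x = (0::nat))}"
    using V by (intro finite_set_of_finite_funs) auto
  ultimately have "finite (Poly_Mapping.lookup ` {m. keysp m \<subseteq> V \<and> mono_deg m = d})"
    by (rule finite_subset)
  then show ?thesis by (rule finite_imageD) (auto simp: inj_on_def intro: poly_mapping_eqI)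
qed

lemma lookup_Abs_support:
  assumes "finite D"
  shows "coef (Abs_poly_mapping (\<lambda>m. if m \<in> D then h m else 0)) m = (if m \<in> D then h m else 0)"
proof -
  have "finite {m. (if m \<in> D then h m else 0) \<noteq> 0}"
    by (rule finite_subset[OF _ assms]) auto
  then show ?thesis by simp
qed

text \<open>A cycle is split into multidegrees. In a non-squarefree one the simplicial complex is a
  cone, in a squarefree one it is the induced subcomplex on a support of cardinality
  \<open>j\<close>. Either way the strand has a primitive, and these primitives are glued into one
  chain \<open>g\<close>.\<close>

lemma koszul_acyclicI:
  fixes V :: "'v::linorder set"
  assumes V: "finite V"
    and van: "\<And>\<sigma>. \<sigma> \<subseteq> V \<Longrightarrow> int (card \<sigma>) = j \<Longrightarrow> p \<le> card \<sigma> \<Longrightarrow>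
      vanishing TYPE('k::field) (card \<sigma> - p) (cpx \<sigma> \<G>)"
  shows "koszul_acyclic TYPE('k) \<G> V p j"
  unfolding koszul_acyclic_def
proof (intro allI impI)
  fix f :: "'v set \<Rightarrow> ('v, 'k) mpoly"
  assume f: "f \<in> koszul_chains \<G> V p j" and cyc: "koszul \<G> V f = 0"
  have "\<exists>h. \<forall>\<tau>\<in>cpx (keysp a) (strand_gens \<G> a). card \<tau> = card (keysp a) - p \<longrightarrow>
      strand a f \<tau> = cobd h \<tau>"
    if a: "keysp a \<subseteq> V" "int (mono_deg a) = j" "p \<le> card (keysp a)" for a
  proof -
    have A: "vanishing TYPE('k) (card (keysp a) - p) (cpx (keysp a) (strand_gens \<G> a))"
    proof (cases "\<exists>x. 2 \<le> coef a x")
      case True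
      then obtain x where x: "2 \<le> coef a x" by blast
      then show ?thesis
        by (intro vanishing_cone[of _ x]) (auto simp: in_keys_iff strand_gens_def)
    next
      case False
      then have "mono_deg a = card (keysp a)"
        unfolding mono_deg_def by (subst card_eq_sum, intro sum.cong)
          (auto simp: in_keys_iff, metis Suc_1 not_less_eq_eq le_antisym Suc_leI One_nat_def neq0_conv)
      moreover have "strand_gens \<G> a = \<G>" using False by (simp add: strand_gens_def)
      ultimately show ?thesis using van[of "keysp a"] a by simp
    qed
    have B: "cobd (strand a f) \<tau> = 0" if "\<tau> \<in> cpx (keysp a) (strand_gens \<G> a)" for \<tau>
      using strand_koszul[OF V a(1) that, of f] cyc by (simp add: strand_def)
    show ?thesis by (rule vanishingE[OF A, of "strand a f"]) (use B in blast)+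
  qed
  then obtain h where h: "\<And>a \<tau>. keysp a \<subseteq> V \<Longrightarrow> int (mono_deg a) = j \<Longrightarrow> p \<le> card (keysp a) \<Longrightarrow>
      \<tau> \<in> cpx (keysp a) (strand_gens \<G> a) \<Longrightarrow> card \<tau> = card (keysp a) - p \<Longrightarrow>
      strand a f \<tau> = cobd (h a) \<tau>"
    by metis
  \<comment> \<open>The monomials admissible in a chain of homological degree \<open>p + 1\<close>;
    the clause \<open>int (Suc p) \<le> j\<close> excludes a truncation by
    \<open>nat\<close>.\<close>
  define D where "D = {m. keysp m \<subseteq> V \<and> mono_deg m = nat (j - int (Suc p)) \<and>
      int (Suc p) \<le> j \<and> std_mono \<G> m}"
  have "finite D"
    by (rule finite_subset[OF _ finite_monomials[OF V, of "nat (j - int (Suc p))"]]) (auto simp: D_def)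
  \<comment> \<open>Inverts the formula of \<open>strand\<close>, with the primitive
    \<open>h a\<close> in multidegree \<open>a = m + expo S\<close>.\<close>
  define g where "g S = (if S \<subseteq> V \<and> card S = Suc p then
      Abs_poly_mapping (\<lambda>m. if m \<in> D then twist (keysp (m + expo S)) (keysp m - S) *
        h (m + expo S) (keysp m - S) else 0) else 0)" for S
  have coef_g: "coef (g S) m = (if S \<subseteq> V \<and> card S = Suc p \<and> m \<in> D then
      twist (keysp (m + expo S)) (keysp m - S) * h (m + expo S) (keysp m - S) else 0)" for S m
    by (simp add: g_def lookup_Abs_support[OF \<open>finite D\<close>])
  have g_keys: "m \<in> D" if "m \<in> keysp (g S)" for m S
    using that by (auto simp: in_keys_iff coef_g split: if_splits)
  have g: "g \<in> koszul_chains \<G> V (Suc p) j"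
    unfolding koszul_chains_def mem_Collect_eq
  proof
    fix S
    have "nf \<G> (g S) = g S"
      unfolding nf_def restr_id_iff using g_keys by (auto simp: D_def)
    moreover have "g S \<in> hpoly V (j - int (Suc p))"
      unfolding hpoly_iff using g_keys[of _ S] by (auto simp: D_def)
    ultimately show "if S \<subseteq> V \<and> card S = Suc p then g S \<in> hpoly V (j - int (Suc p)) \<and>
        nf \<G> (g S) = g S else g S = 0"
      by (auto simp: g_def)
  qed
  have kg: "koszul \<G> V g \<in> koszul_chains \<G> V p j" by (rule koszul_in_chains[OF V g])
  have "f S = koszul \<G> V g S" for S
  proof (rule poly_mapping_eqI)
    fix m
    show "coef (f S) m = coef (koszul \<G> V g S) m"
    proof (cases "S \<subseteq> V \<and> card S = p \<and> keysp m \<subseteq> V \<and> int (mono_deg m) = j - int p \<and> std_mono \<G> m")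
      case True
      have finS: "finite S" using True V finite_subset[of S V] by simp
      define a where "a = m + expo S"
      define \<tau> where "\<tau> = keysp m - S"
      have W: "keysp a = keysp m \<union> S" using finS by (simp add: a_def keys_add_nat keys_expo)
      have aV: "keysp a \<subseteq> V" "int (mono_deg a) = j"
        using True finS W by (auto simp: a_def mono_deg_expo)
      have \<tau>: "\<tau> \<in> cpx (keysp a) (strand_gens \<G> a)"
        using strand_complement[OF finS] True by (simp add: a_def \<tau>_def)
      have "keysp a = \<tau> \<union> S" "\<tau> \<inter> S = {}" "finite \<tau>" using W by (auto simp: \<tau>_def)
      then have card: "card (keysp a) = card \<tau> + p"
        using finS True by (simp only: card_Un_disjoint)
      have "strand a f \<tau> = cobd (h a) \<tau>" by (rule h[OF aV _ \<tau>]) (simp_all add: card)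
      also have "\<dots> = cobd (strand a g) \<tau>"
      proof (rule cobd_cong)
        fix y assume y: "y \<in> \<tau>"
        define S' where "S' = insert y S"
        define m' where "m' = a - expo S'"
        have S': "S' \<subseteq> V" "card S' = Suc p" "finite S'"
          using y True finS by (auto simp: S'_def \<tau>_def)
        have aS': "m' + expo S' = a"
          using y finS
          by (intro poly_mapping_eqI)
            (auto simp: m'_def S'_def a_def lookup_add lookup_minus lookup_expo \<tau>_def in_keys_iff)
        have compl: "keysp a - (\<tau> - {y}) = S'" using W y by (auto simp: S'_def \<tau>_def)
        have "std_mono \<G> m'"
          using std_mono_strand[of "\<tau> - {y}" a \<G>] cpx_subset[OF \<tau>, of "\<tau> - {y}"] W
          unfolding compl m'_def by (auto simp: \<tau>_def)
        moreover have "mono_deg m' + Suc p = mono_deg a"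
          using mono_deg_add[of m' "expo S'"] S' by (simp add: aS' mono_deg_expo)
        moreover have "keysp m' \<subseteq> V" using aV aS' keys_add_nat[of m' "expo S'"] by auto
        ultimately have "m' \<in> D" using aV by (auto simp: D_def)
        have "keysp a = keysp m' \<union> S'" using aS' S'(3) keys_add_nat[of m' "expo S'"]
          by (simp add: keys_expo)
        then show "h a (\<tau> - {y}) = strand a g (\<tau> - {y})"
        proof -
          have ty: "\<tau> - {y} = keysp m' - S'"
            using compl W y \<open>keysp a = keysp m' \<union> S'\<close> by (auto simp: \<tau>_def S'_def)
          have "coef (g S') m' = twist (keysp a) (\<tau> - {y}) * h a (\<tau> - {y})"
            using S' \<open>m' \<in> D\<close> unfolding coef_g aS' ty by simp
          then show ?thesis unfolding strand_def compl m'_def[symmetric] by simp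
        qed
      qed
      also have "\<dots> = strand a (koszul \<G> V g) \<tau>" by (rule strand_koszul[OF V aV(1) \<tau>, symmetric])
      finally show ?thesis by (simp add: coef_eq_strand[OF finS] flip: a_def \<tau>_def)
    next
      case False
      have zero: "coef (u S) m = 0" if u: "u \<in> koszul_chains \<G> V p j" for u :: "'v set \<Rightarrow> ('v, 'k) mpoly"
      proof (cases "S \<subseteq> V \<and> card S = p")
        case True
        then have "u S \<in> hpoly V (j - int p)" "nf \<G> (u S) = u S"
          using u by (auto simp: koszul_chains_def)
        then have "m \<notin> keysp (u S)"
          using False True by (auto simp: hpoly_iff nf_def restr_id_iff)
        then show ?thesis by (simp add: in_keys_iff)
      next
        case False
        then show ?thesis using u by (simp add: koszul_chains_def)
      qed
      show ?thesis using zero[OF f] zero[OF kg] by simp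
    qed
  qed
  then show "\<exists>g\<in>koszul_chains \<G> V (Suc p) j. f = koszul \<G> V g" using g by blast
qed

text \<open>A simplicial cocycle is placed into the single squarefree multidegree
  \<open>expo \<sigma>\<close> and becomes a Koszul cycle. The strand of a chain bounding it, in
  that multidegree, is a primitive of the cocycle.\<close>

lemma koszul_acyclicD:
  fixes V :: "'v::linorder set"
  assumes V: "finite V" and ac: "koszul_acyclic TYPE('k::field) \<G> V p (int (card \<sigma>))"
    and \<sigma>: "\<sigma> \<subseteq> V" "p \<le> card \<sigma>"
  shows "vanishing TYPE('k) (card \<sigma> - p) (cpx \<sigma> \<G>)"
  unfolding vanishing_def
proof (intro allI impI)
  fix g :: "'v set \<Rightarrow> 'k"
  assume g: "\<forall>\<tau>\<in>cpx \<sigma> \<G>. card \<tau> = Suc (card \<sigma> - p) \<longrightarrow> cobd g \<tau> = 0"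
  have fin: "finite \<sigma>" using V \<sigma> finite_subset by blast
  define a where "a = expo \<sigma>"
  have a: "keysp a = \<sigma>" "strand_gens \<G> a = \<G>"
    using fin by (auto simp: a_def keys_expo strand_gens_def lookup_expo)
  have aV: "keysp a \<subseteq> V" using a \<sigma> by simp
  define f where "f S = (if S \<subseteq> \<sigma> \<and> card S = p \<and> \<sigma> - S \<in> cpx \<sigma> \<G> then
      Poly_Mapping.single (expo (\<sigma> - S)) (twist \<sigma> (\<sigma> - S) * g (\<sigma> - S)) else 0)" for S
  have keys_f: "m \<in> keysp (f S) \<Longrightarrow>
      m = expo (\<sigma> - S) \<and> S \<subseteq> \<sigma> \<and> card S = p \<and> \<sigma> - S \<in> cpx \<sigma> \<G>" for m S
    by (auto simp: f_def split: if_splits)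
  have f: "f \<in> koszul_chains \<G> V p (int (card \<sigma>))"
    unfolding koszul_chains_def mem_Collect_eq
  proof
    fix S
    have "f S \<in> hpoly V (int (card \<sigma>) - int p)"
      unfolding hpoly_iff
    proof
      fix m assume "m \<in> keysp (f S)"
      then have m: "m = expo (\<sigma> - S)" "S \<subseteq> \<sigma>" "card S = p" using keys_f by blast+
      then have "card (\<sigma> - S) = card \<sigma> - p" using fin card_Diff_subset finite_subset by metis
      then show "keysp m \<subseteq> V \<and> int (mono_deg m) = int (card \<sigma>) - int p"
        using m fin \<sigma> by (auto simp: keys_expo mono_deg_expo)
    qed
    moreover have "nf \<G> (f S) = f S"
      unfolding nf_def restr_id_iff
    proof
      fix m assume "m \<in> keysp (f S)"
      then show "std_mono \<G> m" using keys_f[of m S] fin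
        by (auto simp: std_mono_def cpx_def keys_expo)
    qed
    moreover have "f S = 0" if "\<not> (S \<subseteq> V \<and> card S = p)" using that \<sigma> by (auto simp: f_def)
    ultimately show "if S \<subseteq> V \<and> card S = p then f S \<in> hpoly V (int (card \<sigma>) - int p) \<and>
        nf \<G> (f S) = f S else f S = 0" by simp
  qed
  have strand_f: "strand a f \<tau> = g \<tau>" if "\<tau> \<in> cpx \<sigma> \<G>" "card \<tau> = card \<sigma> - p" for \<tau>
  proof -
    have sub: "\<tau> \<subseteq> \<sigma>" using that by (simp add: cpx_def)
    then have c: "\<sigma> - (\<sigma> - \<tau>) = \<tau>" by auto
    have "card (\<sigma> - \<tau>) = p" using that sub fin \<sigma>(2)
      by (simp add: card_Diff_subset finite_subset)
    moreover have "a - expo (\<sigma> - \<tau>) = expo \<tau>"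
      using sub fin finite_subset[OF sub fin]
      by (intro poly_mapping_eqI) (auto simp: a_def lookup_minus lookup_expo)
    ultimately show ?thesis using that(1) by (simp add: strand_def a f_def c)
  qed
  have "koszul \<G> V f S = 0" for S
  proof (cases "finite S")
    case True
    show ?thesis
    proof (rule poly_mapping_eqI)
      fix m
      show "coef (koszul \<G> V f S) m = coef 0 m"
      \<comment> \<open>A nonzero coefficient at \<open>m\<close> and \<open>S\<close> forces the
        multidegree \<open>m + expo S\<close> to be \<open>a\<close>.\<close>
      proof (cases "std_mono \<G> m \<and> m + expo S = a")
        case std: True
        have \<tau>: "keysp m - S \<in> cpx (keysp a) (strand_gens \<G> a)"
          using strand_complement[OF True, of \<G> m] std by simp
        have "cobd (strand a f) (keysp m - S) = 0"
        proof (cases "card (keysp m - S) = Suc (card \<sigma> - p)")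
          case cd: True
          have "cobd (strand a f) (keysp m - S) = cobd g (keysp m - S)"
            using \<tau> cd by (intro cobd_cong strand_f) (auto simp: a intro: cpx_subset)
          then show ?thesis using g \<tau> cd by (simp add: a)
        next
          \<comment> \<open>In other cardinalities all terms of the coboundary vanish, since
            \<open>f S = 0\<close> unless \<open>card S = p\<close>.\<close>
          case cd: False
          have "strand a f (keysp m - S - {y}) = 0" if "y \<in> keysp m - S" for y
          proof -
            have "keysp m - S \<subseteq> \<sigma>" using \<tau> by (simp add: cpx_def a)
            then have "card (\<sigma> - (keysp m - S - {y})) = card \<sigma> - (card (keysp m - S) - 1)"
              using that fin by (subst card_Diff_subset) (auto intro: finite_subset)
            moreover have "card (keysp m - S) \<le> card \<sigma>"
              using \<open>keysp m - S \<subseteq> \<sigma>\<close> fin by (rule card_mono[rotated])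
            moreover have "1 \<le> card (keysp m - S)"
              using that card_gt_0_iff[of "keysp m - S"] by auto
            ultimately have "card (\<sigma> - (keysp m - S - {y})) \<noteq> p"
              using cd \<sigma>(2) by linarith
            then show ?thesis by (simp add: strand_def a f_def)
          qed
          then show ?thesis by (rule cobd_zero)
        qed
        then have "strand a (koszul \<G> V f) (keysp m - S) = 0"
          using strand_koszul[OF V aV \<tau>, of f] by simp
        then show ?thesis using std coef_eq_strand[OF True, of "koszul \<G> V f" m] by simp
      next
        case False
        have "coef (f (insert x S)) (m - Poly_Mapping.single x 1) = 0"
          if x: "x \<in> V - S" "x \<in> keysp m" "std_mono \<G> m" for x
        proof (rule ccontr)
          assume "coef (f (insert x S)) (m - Poly_Mapping.single x 1) \<noteq> 0"
          then have m: "m - Poly_Mapping.single x 1 = expo (\<sigma> - insert x S)" "insert x S \<subseteq> \<sigma>"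
            using keys_f[of "m - Poly_Mapping.single x 1" "insert x S"] by (auto simp: in_keys_iff)
          have "m = expo (\<sigma> - insert x S) + Poly_Mapping.single x 1"
            unfolding m(1)[symmetric] using x
            by (intro poly_mapping_eqI) (auto simp: lookup_add lookup_minus lookup_single when_def in_keys_iff)
          then have "m + expo S = a" using m(2) True fin x(1)
            by (intro poly_mapping_eqI)
              (auto simp: lookup_add lookup_single when_def lookup_expo a_def)
          then show False using False x by simp
        qed
        then show ?thesis by (auto simp: lookup_koszul intro!: sum.neutral)
      qed
    qed
  next
    case False
    then have "f (insert x S) = 0" for x using fin finite_subset by (auto simp: f_def)
    then show ?thesis by (simp add: koszul_def nf_def)
  qed
  then obtain u where "f = koszul \<G> V u" using ac f unfolding koszul_acyclic_def by fastforce
  then have "g \<tau> = cobd (strand a u) \<tau>" if "\<tau> \<in> cpx \<sigma> \<G>" "card \<tau> = card \<sigma> - p" for \<tau>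
    using strand_f[OF that] strand_koszul[OF V aV, of \<tau> \<G> u] that by (simp add: a)
  then show "\<exists>h. \<forall>\<tau>\<in>cpx \<sigma> \<G>. card \<tau> = card \<sigma> - p \<longrightarrow> g \<tau> = cobd h \<tau>" by blast
qed

section \<open>Graded modules and dimension shifting\<close>

text \<open>Dimension shifting along \<open>0 \<longrightarrow> ker d \<longrightarrow> A \<longrightarrow> Z \<longrightarrow> 0\<close> with \<open>A\<close> acyclic. The hypothesis
  \<open>minimal\<close> makes the shift work in the lowest degree as well.\<close>

lemma koszul_shift:
  fixes d :: "'g::ab_group_add \<Rightarrow> 'h::ab_group_add"
  assumes surj: "\<And>p. d ` A p = Z p"
    and bA: "\<And>p x. x \<in> A (Suc p) \<Longrightarrow> bA x \<in> A p"
    and bb: "\<And>p x. x \<in> A (Suc p) \<Longrightarrow> bA (bA x) = 0"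
    and comm: "\<And>x. d (bA x) = bZ (d x)"
    and diffs: "\<And>x y. d (x - y) = d x - d y" "\<And>x y. bA (x - y) = bA x - bA y"
      "\<And>p x y. x \<in> A p \<Longrightarrow> y \<in> A p \<Longrightarrow> x - y \<in> A p"
    and exact: "\<And>p x. x \<in> A (Suc p) \<Longrightarrow> bA x = 0 \<Longrightarrow> \<exists>y\<in>A (Suc (Suc p)). x = bA y"
    and minimal: "\<And>x. x \<in> A 0 \<Longrightarrow> d x = 0 \<Longrightarrow> \<exists>y\<in>A (Suc 0). x = bA y"
  shows "(\<forall>x\<in>Z (Suc p). bZ x = 0 \<longrightarrow> (\<exists>y\<in>Z (Suc (Suc p)). x = bZ y)) \<longleftrightarrow>
    (\<forall>x\<in>{x \<in> A p. d x = 0}. bA x = 0 \<longrightarrow> (\<exists>y\<in>{x \<in> A (Suc p). d x = 0}. x = bA y))"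
    (is "?L \<longleftrightarrow> ?R")
proof
  have d0: "d 0 = 0" using diffs(1)[of 0 0] by simp
  have bA0: "bA 0 = 0" using diffs(2)[of 0 0] by simp
  show ?R if L: ?L
  proof (intro ballI impI)
    fix x assume "x \<in> {x \<in> A p. d x = 0}" "bA x = 0"
    then have x: "x \<in> A p" "d x = 0" "bA x = 0" by auto
    \<comment> \<open>For \<open>p = 0\<close> this comes from \<open>minimal\<close>, for larger
      \<open>p\<close> from \<open>exact\<close>.\<close>
    obtain a where a: "a \<in> A (Suc p)" "x = bA a"
      using exact minimal x by (cases p) blast+
    have "d a \<in> Z (Suc p)" "bZ (d a) = 0"
      using a surj x(2) comm[of a] by auto
    then obtain b where b: "b \<in> Z (Suc (Suc p))" "d a = bZ b" using L by blast
    then obtain c where c: "c \<in> A (Suc (Suc p))" "b = d c" using surj by blast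
    have "a - bA c \<in> A (Suc p)" using a c bA diffs(3) by blast
    moreover have "d (a - bA c) = 0" using b c by (simp add: diffs comm)
    moreover have "x = bA (a - bA c)" using a bb[OF c(1)] by (simp add: diffs)
    ultimately show "\<exists>y\<in>{x \<in> A (Suc p). d x = 0}. x = bA y" by blast
  qed
  show ?L if R: ?R
  proof (intro ballI impI)
    fix x assume x: "x \<in> Z (Suc p)" "bZ x = 0"
    then obtain a where a: "a \<in> A (Suc p)" "x = d a" using surj by blast
    have "d (bA a) = 0" using a x by (simp add: comm)
    then obtain b where b: "b \<in> A (Suc p)" "d b = 0" "bA a = bA b"
      using R bA[OF a(1)] bb[OF a(1)] by blast
    then have "a - b \<in> A (Suc p)" "bA (a - b) = 0" using a diffs by simp_all
    then obtain c where c: "c \<in> A (Suc (Suc p))" "a - b = bA c" using exact by blast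
    have "x = d (a - b)" using a b by (simp add: diffs)
    then have "x = bZ (d c)" using c comm by simp
    then show "\<exists>y\<in>Z (Suc (Suc p)). x = bZ y" using c surj by blast
  qed
qed

section \<open>Graded modules, presentations and their Koszul homology\<close>

type_synonym ('v, 'k) grmod = "int \<Rightarrow> (nat \<Rightarrow> ('v, 'k) mpoly) set"

text \<open>Elements of free modules are coordinate functions on \<open>nat\<close> that vanish beyond the rank; a graded
  module is given by its homogeneous pieces. \<open>grfree V l\<close> is free on basis elements of degrees \<open>l\<close>.\<close>

definition grfree :: "'v set \<Rightarrow> int list \<Rightarrow> ('v, 'k::field) grmod" where
  "grfree V l d = {v. \<forall>k. if k < length l then v k \<in> hpoly V (d - l ! k) else v k = 0}"

text \<open>The linear map sending the \<open>k\<close>-th basis element to \<open>gens k\<close>,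
  with values in normal form. It serves the augmentation onto the quotient ring and, for
  \<open>\<G> = {}\<close>, the differentials.\<close>

definition pmap :: "'v set set \<Rightarrow> nat \<Rightarrow> (nat \<Rightarrow> nat \<Rightarrow> ('v, 'k::field) mpoly) \<Rightarrow>
    (nat \<Rightarrow> ('v, 'k) mpoly) \<Rightarrow> nat \<Rightarrow> ('v, 'k) mpoly" where
  "pmap \<G> L gens w = (\<lambda>i. nf \<G> (\<Sum>k<L. w k * gens k i))"

definition syzygies :: "'v set set \<Rightarrow> 'v set \<Rightarrow> int list \<Rightarrow> (nat \<Rightarrow> nat \<Rightarrow> ('v, 'k::field) mpoly) \<Rightarrow>
    ('v, 'k) grmod" where
  "syzygies \<G> V l gens d = {w \<in> grfree V l d. pmap \<G> (length l) gens w = 0}"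

text \<open>Koszul chains with coefficients in \<open>M\<close>: the tensor product with the
  \<open>p\<close>-th exterior power, in internal degree \<open>j\<close>.\<close>

definition tens :: "'v set \<Rightarrow> ('v, 'k::field) grmod \<Rightarrow> nat \<Rightarrow> int \<Rightarrow>
    ('v set \<Rightarrow> nat \<Rightarrow> ('v, 'k) mpoly) set" where
  "tens V M p j = {F. \<forall>S. if S \<subseteq> V \<and> card S = p then F S \<in> M (j - int p) else F S = 0}"

definition mkoszul :: "'v::linorder set set \<Rightarrow> 'v set \<Rightarrow> ('v set \<Rightarrow> nat \<Rightarrow> ('v, 'k::field) mpoly) \<Rightarrow>
    'v set \<Rightarrow> nat \<Rightarrow> ('v, 'k) mpoly" where
  "mkoszul \<G> V F = (\<lambda>S i. koszul \<G> V (\<lambda>S. F S i) S)"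

text \<open>Vanishing of the Koszul homology of a graded module in homological degree \<open>p\<close> and internal
  degree \<open>j\<close>.\<close>

definition hvan :: "'v::linorder set set \<Rightarrow> 'v set \<Rightarrow> ('v, 'k::field) grmod \<Rightarrow> nat \<Rightarrow> int \<Rightarrow> bool" where
  "hvan \<G> V M p j \<longleftrightarrow> (\<forall>F\<in>tens V M p j. mkoszul \<G> V F = 0 \<longrightarrow>
     (\<exists>G\<in>tens V M (Suc p) j. F = mkoszul \<G> V G))"

text \<open>The second clause is minimality: syzygies without constant coefficients lie in the
  maximal ideal times the free module.\<close>

definition presents :: "'v set set \<Rightarrow> 'v set \<Rightarrow> ('v, 'k::field) grmod \<Rightarrow> int list \<Rightarrow>
    (nat \<Rightarrow> nat \<Rightarrow> ('v, 'k) mpoly) \<Rightarrow> bool" where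
  "presents \<G> V M l gens \<longleftrightarrow> (\<forall>d. M d = pmap \<G> (length l) gens ` grfree V l d) \<and>
     (\<forall>d. \<forall>w\<in>syzygies \<G> V l gens d. \<forall>k. coef (w k) 0 = 0)"

lemma nf_empty [simp]: "nf {} f = f"
  by (rule poly_mapping_eqI) (simp add: nf_def std_mono_def)

lemma nf_0 [simp]: "nf \<G> 0 = 0"
  by (simp add: nf_def)

lemma nf_sum_mult: "nf \<G> (\<Sum>x\<in>X. f x * nf \<G> (g x)) = nf \<G> (\<Sum>x\<in>X. f x * g x)"
proof -
  have "nf \<G> (\<Sum>x\<in>X. f x * nf \<G> (g x)) = (\<Sum>x\<in>X. nf \<G> (f x * nf \<G> (g x)))"
    by (simp add: nf_def restr_sum)
  also have "\<dots> = nf \<G> (\<Sum>x\<in>X. f x * g x)"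
    unfolding nf_mult by (simp add: nf_def restr_sum)
  finally show ?thesis .
qed

lemma grfreeD: "v \<in> grfree V l d \<Longrightarrow> k < length l \<Longrightarrow> v k \<in> hpoly V (d - l ! k)"
  "v \<in> grfree V l d \<Longrightarrow> \<not> k < length l \<Longrightarrow> v k = 0"
  by (auto simp: grfree_def split: if_splits dest: spec[of _ k])

lemma grfreeI:
  "(\<And>k. k < length l \<Longrightarrow> v k \<in> hpoly V (d - l ! k)) \<Longrightarrow> (\<And>k. length l \<le> k \<Longrightarrow> v k = 0) \<Longrightarrow>
    v \<in> grfree V l d"
  by (simp add: grfree_def)

lemma grfree_0 [simp]: "0 \<in> grfree V l d"
  by (simp add: grfree_def)

lemma grfree_add: "v \<in> grfree V l d \<Longrightarrow> w \<in> grfree V l d \<Longrightarrow> v + w \<in> grfree V l d"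
  by (intro grfreeI) (auto simp: grfreeD intro!: hpoly_add)

lemma grfree_diff: "v \<in> grfree V l d \<Longrightarrow> w \<in> grfree V l d \<Longrightarrow> v - w \<in> grfree V l d"
  by (intro grfreeI) (auto simp: grfreeD intro!: hpoly_diff)

lemma grfree_scale:
  assumes "f \<in> hpoly V a" "v \<in> grfree V l d"
  shows "(\<lambda>i. f * v i) \<in> grfree V l (a + d)"
proof (rule grfreeI)
  fix k assume "k < length l"
  then have "f * v k \<in> hpoly V (a + (d - l ! k))" using assms by (intro hpoly_mult grfreeD)
  then show "f * v k \<in> hpoly V (a + d - l ! k)" by (simp add: algebra_simps)
qed (use grfreeD(2)[OF assms(2)] in simp)

lemma grfree_neg:
  assumes "\<forall>e\<in>set l. 0 \<le> e" "d < 0" "v \<in> grfree V l d"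
  shows "v = 0"
proof
  fix k
  show "v k = 0 k"
  proof (cases "k < length l")
    case True
    then have "0 \<le> l ! k" using assms(1) by simp
    then have "d - l ! k < 0" using assms(2) by simp
    then have "v k = 0" by (rule hpoly_neg) (rule grfreeD(1)[OF assms(3) True])
    then show ?thesis by simp
  qed (use grfreeD(2)[OF assms(3)] in simp)
qed

lemma pmap_0 [simp]: "pmap \<G> L gens 0 = 0"
  by (rule ext) (simp add: pmap_def)

lemma pmap_add: "pmap \<G> L gens (v + w) = pmap \<G> L gens v + pmap \<G> L gens w"
  by (rule ext) (simp add: pmap_def distrib_right sum.distrib nf_def restr_add)

lemma pmap_diff: "pmap \<G> L gens (v - w) = pmap \<G> L gens v - pmap \<G> L gens w"
  by (rule ext) (simp add: pmap_def left_diff_distrib sum_subtractf nf_def restr_diff)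

lemma pmap_scale: "pmap \<G> L gens (\<lambda>i. f * w i) = (\<lambda>i. nf \<G> (f * pmap \<G> L gens w i))"
  by (rule ext) (simp add: pmap_def nf_mult sum_distrib_left mult.assoc)

lemma tensD: "F \<in> tens V M p j \<Longrightarrow> S \<subseteq> V \<Longrightarrow> card S = p \<Longrightarrow> F S \<in> M (j - int p)"
  by (simp add: tens_def)

lemma tens_0:
  assumes "F \<in> tens V M p j" "\<not> (S \<subseteq> V \<and> card S = p)"
  shows "F S = 0"
proof -
  have "if S \<subseteq> V \<and> card S = p then F S \<in> M (j - int p) else F S = 0"
    using assms(1) unfolding tens_def mem_Collect_eq by (rule spec)
  then show ?thesis using assms(2) by (simp only: if_False)
qed

lemma tensI:
  "(\<And>S. S \<subseteq> V \<Longrightarrow> card S = p \<Longrightarrow> F S \<in> M (j - int p)) \<Longrightarrow>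
    (\<And>S. \<not> (S \<subseteq> V \<and> card S = p) \<Longrightarrow> F S = 0) \<Longrightarrow> F \<in> tens V M p j"
  by (simp add: tens_def)

lemma mkoszul_diff: "mkoszul \<G> V (F - G) = mkoszul \<G> V F - mkoszul \<G> V G"
proof (intro ext)
  fix S i
  show "mkoszul \<G> V (F - G) S i = (mkoszul \<G> V F - mkoszul \<G> V G) S i"
    using fun_cong[OF koszul_diff[of \<G> V "\<lambda>S. F S i" "\<lambda>S. G S i"], of S]
    by (simp add: mkoszul_def fun_diff_def)
qed

lemma tens_component:
  assumes "F \<in> tens V (grfree V l) p j" "k < length l"
  shows "(\<lambda>S. F S k) \<in> koszul_chains {} V p (j - l ! k)"
  unfolding koszul_chains_def mem_Collect_eq
proof
  fix S
  show "if S \<subseteq> V \<and> card S = p then F S k \<in> hpoly V (j - l ! k - int p) \<and> nf {} (F S k) = F S k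
      else F S k = 0"
  proof (cases "S \<subseteq> V \<and> card S = p")
    case True
    then have "F S k \<in> hpoly V (j - int p - l ! k)"
      using assms by (intro grfreeD(1) tensD) auto
    then show ?thesis using True by (simp add: algebra_simps)
  qed (use tens_0[OF assms(1)] in auto)
qed

lemma tens_of_components:
  assumes "\<And>k. k < length l \<Longrightarrow> g k \<in> koszul_chains {} V p (j - l ! k)"
  shows "(\<lambda>S k. if k < length l then g k S else 0) \<in> tens V (grfree V l) p j"
proof (rule tensI)
  fix S assume "S \<subseteq> V" "card S = p"
  then have "g k S \<in> hpoly V (j - l ! k - int p)" if "k < length l" for k
    using assms[OF that] by (simp add: koszul_chains_def)
  then show "(\<lambda>k. if k < length l then g k S else 0) \<in> grfree V l (j - int p)"
    by (intro grfreeI) (auto simp: algebra_simps)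
next
  fix S assume "\<not> (S \<subseteq> V \<and> card S = p)"
  then show "(\<lambda>k. if k < length l then g k S else 0) = 0"
    using koszul_chains_0[OF assms] by (intro ext) auto
qed

text \<open>Membership in the ideal of the variables gives coefficients of mixed degrees; since
  \<open>f\<close> is homogeneous, their components of degree \<open>d - 1\<close> suffice.\<close>

lemma hpoly_decompose:
  fixes f :: "('v, 'k::field) mpoly"
  assumes V: "finite V" and f: "f \<in> hpoly V d" "coef f 0 = 0"
  shows "\<exists>g. (\<forall>x\<in>V. g x \<in> hpoly V (d - 1)) \<and> f = (\<Sum>x\<in>V. Var x * g x)"
proof -
  have "f \<in> ideal_gen V (Var ` V)" using f by (simp add: irrelevant_ideal_iff hpoly_poly_ring)
  then obtain T c where T: "f = (\<Sum>s\<in>T. c s * s)" "T \<subseteq> Var ` V"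
    and c: "\<And>s. s \<in> T \<Longrightarrow> c s \<in> poly_ring V" by (auto simp: ideal_gen_def)
  have inj: "inj_on (Var :: 'v \<Rightarrow> ('v, 'k) mpoly) V"
  proof (rule inj_onI)
    fix x y assume "(Var x :: ('v, 'k) mpoly) = Var y"
    then have "keysp (Var x :: ('v, 'k) mpoly) = keysp (Var y :: ('v, 'k) mpoly)" by simp
    then have "Poly_Mapping.single x (1::nat) = Poly_Mapping.single y 1" by (simp add: Var_def)
    then have "keysp (Poly_Mapping.single x (1::nat)) = keysp (Poly_Mapping.single y (1::nat))" by simp
    then show "x = y" by simp
  qed
  define c' where "c' x = (if Var x \<in> T then c (Var x) else 0)" for x
  have c': "c' x \<in> poly_ring V" for x using c by (simp add: c'_def)
  have "f = (\<Sum>s\<in>Var ` V. if s \<in> T then c s * s else 0)"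
    unfolding T(1) using T(2) V by (intro sum.mono_neutral_cong_left) auto
  also have "\<dots> = (\<Sum>x\<in>V. Var x * c' x)"
    by (subst sum.reindex[OF inj]) (auto simp: c'_def mult.commute intro!: sum.cong)
  finally have "hcomp d f = (\<Sum>x\<in>V. hcomp d (Var x * c' x))" by (simp add: hcomp_def restr_sum)
  also have "\<dots> = (\<Sum>x\<in>V. Var x * hcomp (d - 1) (c' x))"
    by (intro sum.cong refl hcomp_mult) (auto simp: homogeneous_def Var_def)
  finally show ?thesis
    using hcomp_id[OF f(1)] hcomp_hpoly[OF c'] by (intro exI[of _ "\<lambda>x. hcomp (d - 1) (c' x)"]) auto
qed

lemma mkoszul_tens_0:
  assumes "F \<in> tens V M 0 j" "finite V"
  shows "mkoszul \<G> V F = 0"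
proof (intro ext)
  fix S i
  have "F (insert x S) = 0" if "x \<in> V - S" for x
  proof (rule tens_0[OF assms(1)])
    show "\<not> (insert x S \<subseteq> V \<and> card (insert x S) = 0)"
      using assms(2) finite_subset[of "insert x S" V] card_0_eq[of "insert x S"] by blast
  qed
  then show "mkoszul \<G> V F S i = 0 S i" by (simp add: mkoszul_def koszul_def)
qed

lemma mkoszul_empty_set:
  "mkoszul \<G> V F {} i = nf \<G> (\<Sum>x\<in>V. Var x * F {x} i)"
  by (simp add: mkoszul_def koszul_def esgn_def)

text \<open>Koszul homology of a free module in degree 0 is the module modulo the maximal ideal, so
  0-chains without constant coefficients are boundaries.\<close>

lemma boundary_of_irrelevant:
  assumes V: "finite V" and F: "F \<in> tens V (grfree V l) 0 j" and c: "\<And>k. coef (F {} k) 0 = 0"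
  shows "\<exists>G\<in>tens V (grfree V l) (Suc 0) j. F = mkoszul {} V G"
proof -
  have "\<exists>g. (\<forall>x\<in>V. g x \<in> hpoly V (j - l ! k - 1)) \<and> F {} k = (\<Sum>x\<in>V. Var x * g x)"
    if "k < length l" for k
    using tensD[OF F, of "{}"] grfreeD(1)[OF _ that, of "F {}" V j] c by (intro hpoly_decompose V) auto
  then obtain g where g: "\<And>k x. k < length l \<Longrightarrow> x \<in> V \<Longrightarrow> g k x \<in> hpoly V (j - l ! k - 1)"
    "\<And>k. k < length l \<Longrightarrow> F {} k = (\<Sum>x\<in>V. Var x * g k x)" by metis
  define G where "G S k = (if S \<subseteq> V \<and> card S = 1 \<and> k < length l then g k (the_elem S) else 0)" for S k
  have "G \<in> tens V (grfree V l) (Suc 0) j"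
  proof (rule tensI)
    fix S assume S: "S \<subseteq> V" "card S = Suc 0"
    then obtain x where "S = {x}" by (metis card_1_singletonE One_nat_def)
    then show "G S \<in> grfree V l (j - int (Suc 0))"
      using S g(1)[of _ x] by (intro grfreeI) (auto simp: G_def algebra_simps)
  next
    fix S assume "\<not> (S \<subseteq> V \<and> card S = Suc 0)"
    then show "G S = 0" by (intro ext) (auto simp: G_def)
  qed
  moreover have "F S k = mkoszul {} V G S k" for S k
  proof (cases "S = {}")
    case True
    have "F {} k = (\<Sum>x\<in>V. Var x * G {x} k)"
    proof (cases "k < length l")
      case True
      then show ?thesis by (simp add: g(2) G_def)
    next
      case False
      have "F {} \<in> grfree V l j" using tensD[OF F, of "{}"] by simp
      then show ?thesis using False grfreeD(2) by (simp add: G_def)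
    qed
    then show ?thesis using True by (simp add: mkoszul_empty_set)
  next
    case False
    have "G (insert x S) k = 0" if "x \<in> V - S" for x
    proof -
      have "card (insert x S) \<noteq> 1" using that False by (auto simp: card_1_singleton_iff)
      then show ?thesis by (simp add: G_def)
    qed
    then have "mkoszul {} V G S k = 0" by (simp add: mkoszul_def koszul_def)
    moreover have "\<not> (S \<subseteq> V \<and> card S = 0)" using False V finite_subset[of S V] by auto
    then have "F S = 0" by (rule tens_0[OF F])
    ultimately show ?thesis by simp
  qed
  ultimately show ?thesis by blast
qed

text \<open>Without generators all complexes in question are full simplices on nonempty vertex sets,
  hence cones.\<close>

lemma koszul_free_exact:
  assumes V: "finite V" and F: "F \<in> tens V (grfree V l) (Suc p) j" and cyc: "mkoszul {} V F = 0"
  shows "\<exists>G\<in>tens V (grfree V l) (Suc (Suc p)) j. F = mkoszul {} V G"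
proof -
  have ac: "koszul_acyclic TYPE('b) {} V (Suc p) j'" for j'
  proof (rule koszul_acyclicI[OF V])
    fix \<sigma> :: "'a set" assume \<sigma>: "\<sigma> \<subseteq> V" "Suc p \<le> card \<sigma>"
    then obtain x where "x \<in> \<sigma>" by (metis card.empty equals0I not_less_eq_eq zero_le)
    then show "vanishing TYPE('b) (card \<sigma> - Suc p) (cpx \<sigma> {})"
      using \<sigma> V finite_subset by (intro vanishing_cone[of _ x]) auto
  qed
  have "\<exists>g\<in>koszul_chains {} V (Suc (Suc p)) (j - l ! k). (\<lambda>S. F S k) = koszul {} V g"
    if "k < length l" for k
  proof -
    have "koszul {} V (\<lambda>S. F S k) = 0"
      using fun_cong[OF fun_cong[OF cyc]] by (intro ext) (simp add: mkoszul_def)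
    then show ?thesis using ac tens_component[OF F that] unfolding koszul_acyclic_def by blast
  qed
  then obtain g where g: "\<And>k. k < length l \<Longrightarrow> g k \<in> koszul_chains {} V (Suc (Suc p)) (j - l ! k)"
    "\<And>k. k < length l \<Longrightarrow> (\<lambda>S. F S k) = koszul {} V (g k)" by metis
  define G where "G S k = (if k < length l then g k S else 0)" for S k
  have "G \<in> tens V (grfree V l) (Suc (Suc p)) j"
    unfolding G_def by (rule tens_of_components) (rule g(1))
  moreover have "F S k = mkoszul {} V G S k" for S k
  proof (cases "k < length l")
    case True
    then show ?thesis using fun_cong[OF g(2)[OF True], of S] by (simp add: mkoszul_def G_def)
  next
    case False
    have "F S k = 0"
    proof (cases "S \<subseteq> V \<and> card S = Suc p")
      case True
      then have "F S \<in> grfree V l (j - int (Suc p))" using tensD[OF F] by blast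
      then show ?thesis using False grfreeD(2) by blast
    qed (use tens_0[OF F] in simp)
    then show ?thesis using False by (simp add: mkoszul_def G_def koszul_def)
  qed
  ultimately show ?thesis by blast
qed

lemma mkoszul_grfree:
  assumes "finite V" "F \<in> tens V (grfree V l) (Suc p) j"
  shows "mkoszul {} V F \<in> tens V (grfree V l) p j"
proof -
  have "(\<lambda>S k. if k < length l then koszul {} V (\<lambda>S. F S k) S else 0) \<in> tens V (grfree V l) p j"
    by (rule tens_of_components) (rule koszul_in_chains[OF assms(1) tens_component[OF assms(2)]])
  moreover have "mkoszul {} V F = (\<lambda>S k. if k < length l then koszul {} V (\<lambda>S. F S k) S else 0)"
  proof (intro ext)
    fix S k
    have "F S k = 0" if "\<not> k < length l" for S
    proof (cases "S \<subseteq> V \<and> card S = Suc p")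
      case True
      then have "F S \<in> grfree V l (j - int (Suc p))" using tensD[OF assms(2)] by blast
      then show ?thesis using that grfreeD(2) by blast
    qed (use tens_0[OF assms(2)] in simp)
    then show "mkoszul {} V F S k = (if k < length l then koszul {} V (\<lambda>S. F S k) S else 0)"
      by (simp add: mkoszul_def koszul_def)
  qed
  ultimately show ?thesis by simp
qed

lemma mkoszul_mkoszul:
  assumes V: "finite V" and F: "F \<in> tens V (grfree V l) (Suc p) j"
  shows "mkoszul {} V (mkoszul {} V F) = 0"
proof (cases p)
  case 0
  then show ?thesis using mkoszul_tens_0[OF mkoszul_grfree[OF V F[unfolded 0]] V] by simp
next
  case (Suc q)
  show ?thesis
  proof (intro ext)
    fix S k
    show "mkoszul {} V (mkoszul {} V F) S k = 0 S k"
    proof (cases "k < length l")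
      case True
      then show ?thesis
        using koszul_koszul[OF V tens_component[OF F[unfolded Suc] True]] by (simp add: mkoszul_def)
    next
      case False
      have "mkoszul {} V F S k = 0" for S
      proof (cases "S \<subseteq> V \<and> card S = p")
        case True
        then have "mkoszul {} V F S \<in> grfree V l (j - int p)"
          using tensD[OF mkoszul_grfree[OF V F]] by blast
        then show ?thesis using False grfreeD(2) by blast
      qed (use tens_0[OF mkoszul_grfree[OF V F]] in simp)
      then show ?thesis by (subst mkoszul_def) (simp add: koszul_def)
    qed
  qed
qed

lemma pmap_mkoszul:
  "(\<lambda>S. pmap \<G> L gens (mkoszul {} V F S)) = mkoszul \<G> V (\<lambda>S. pmap \<G> L gens (F S))"
proof (intro ext)
  fix S i
  have "(\<Sum>k<L. (\<Sum>x\<in>V - S. esgn x S * Var x * F (insert x S) k) * gens k i) =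
      (\<Sum>x\<in>V - S. esgn x S * Var x * (\<Sum>k<L. F (insert x S) k * gens k i))"
    unfolding sum_distrib_right sum_distrib_left by (subst sum.swap) (simp add: mult.assoc)
  then show "pmap \<G> L gens (mkoszul {} V F S) i = mkoszul \<G> V (\<lambda>S. pmap \<G> L gens (F S)) S i"
    by (simp add: pmap_def mkoszul_def koszul_def nf_sum_mult)
qed

lemma tens_pmap_image:
  assumes "presents \<G> V M l gens"
  shows "(\<lambda>F S. pmap \<G> (length l) gens (F S)) ` tens V (grfree V l) p j = tens V M p j"
proof (intro equalityI subsetI)
  fix Z assume "Z \<in> (\<lambda>F S. pmap \<G> (length l) gens (F S)) ` tens V (grfree V l) p j"
  then obtain F where F: "F \<in> tens V (grfree V l) p j" "Z = (\<lambda>S. pmap \<G> (length l) gens (F S))" by blast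
  show "Z \<in> tens V M p j"
  proof (rule tensI)
    show "Z S \<in> M (j - int p)" if "S \<subseteq> V" "card S = p" for S
      using assms tensD[OF F(1) that] by (auto simp: presents_def F(2))
    show "Z S = 0" if "\<not> (S \<subseteq> V \<and> card S = p)" for S
      using tens_0[OF F(1) that] by (simp add: F(2))
  qed
next
  fix Z assume Z: "Z \<in> tens V M p j"
  have "\<exists>w\<in>grfree V l (j - int p). Z S = pmap \<G> (length l) gens w" if "S \<subseteq> V" "card S = p" for S
    using tensD[OF Z that] assms unfolding presents_def by auto
  then obtain w where w: "\<And>S. S \<subseteq> V \<Longrightarrow> card S = p \<Longrightarrow>
      w S \<in> grfree V l (j - int p) \<and> Z S = pmap \<G> (length l) gens (w S)" by metis
  define F where "F S = (if S \<subseteq> V \<and> card S = p then w S else 0)" for S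
  have "F \<in> tens V (grfree V l) p j" by (rule tensI) (auto simp: F_def w)
  moreover have "Z S = pmap \<G> (length l) gens (F S)" for S
    using w tens_0[OF Z] by (auto simp: F_def)
  ultimately show "Z \<in> (\<lambda>F S. pmap \<G> (length l) gens (F S)) ` tens V (grfree V l) p j" by blast
qed

lemma tens_syzygies:
  "{F \<in> tens V (grfree V l) p j. (\<lambda>S. pmap \<G> (length l) gens (F S)) = 0} =
    tens V (syzygies \<G> V l gens) p j"
proof (intro equalityI subsetI)
  fix F assume F: "F \<in> {F \<in> tens V (grfree V l) p j. (\<lambda>S. pmap \<G> (length l) gens (F S)) = 0}"
  then have F1: "F \<in> tens V (grfree V l) p j" and "pmap \<G> (length l) gens (F S) = 0" for S
    using fun_cong[of "\<lambda>S. pmap \<G> (length l) gens (F S)" 0 S] by simp_all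
  then show "F \<in> tens V (syzygies \<G> V l gens) p j"
    by (intro tensI) (auto simp: syzygies_def tensD tens_0)
next
  fix F assume F: "F \<in> tens V (syzygies \<G> V l gens) p j"
  have "F \<in> tens V (grfree V l) p j"
    using tensD[OF F] tens_0[OF F] by (intro tensI) (auto simp: syzygies_def)
  moreover have "pmap \<G> (length l) gens (F S) = 0" for S
    using tensD[OF F, of S] tens_0[OF F, of S]
    by (cases "S \<subseteq> V \<and> card S = p") (auto simp: syzygies_def)
  then have "(\<lambda>S. pmap \<G> (length l) gens (F S)) = 0" by (intro ext) simp
  ultimately show "F \<in> {F \<in> tens V (grfree V l) p j. (\<lambda>S. pmap \<G> (length l) gens (F S)) = 0}"
    by simp
qed

text \<open>The long exact sequence of a minimal presentation: the free module has no homology in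
  positive degrees, and in degree 0 the syzygies, having no constant coefficients, become boundaries
  in it.\<close>

lemma hvan_shift:
  assumes V: "finite V" and pres: "presents \<G> V M l gens"
  shows "hvan \<G> V M (Suc p) j \<longleftrightarrow> hvan {} V (syzygies \<G> V l gens) p j"
  unfolding hvan_def tens_syzygies[symmetric]
proof (rule koszul_shift[of "\<lambda>F S. pmap \<G> (length l) gens (F S)" "\<lambda>p. tens V (grfree V l) p j"
      "\<lambda>p. tens V M p j" "mkoszul {} V" "mkoszul \<G> V" p])
  fix F assume F: "F \<in> tens V (grfree V l) 0 j" "(\<lambda>S. pmap \<G> (length l) gens (F S)) = 0"
  then have "F {} \<in> syzygies \<G> V l gens j"
    using tensD[OF F(1), of "{}"] fun_cong[OF F(2), of "{}"] by (simp add: syzygies_def)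
  then have "coef (F {} k) 0 = 0" for k using pres by (auto simp: presents_def)
  then show "\<exists>y\<in>tens V (grfree V l) (Suc 0) j. F = mkoszul {} V y"
    by (intro boundary_of_irrelevant V F(1))
next
  show "F - G \<in> tens V (grfree V l) p j"
    if "F \<in> tens V (grfree V l) p j" "G \<in> tens V (grfree V l) p j" for p F G
    using that by (intro tensI) (auto simp: tensD tens_0 intro!: grfree_diff)
next
  show "(\<lambda>S. pmap \<G> (length l) gens ((F - G) S)) =
      (\<lambda>S. pmap \<G> (length l) gens (F S)) - (\<lambda>S. pmap \<G> (length l) gens (G S))" for F G
    by (intro ext) (simp add: pmap_diff)
  show "(\<lambda>F S. pmap \<G> (length l) gens (F S)) ` tens V (grfree V l) p j = tens V M p j" for p
    by (rule tens_pmap_image[OF pres])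
  show "mkoszul {} V F \<in> tens V (grfree V l) p j" "mkoszul {} V (mkoszul {} V F) = 0"
    if "F \<in> tens V (grfree V l) (Suc p) j" for p F
    using mkoszul_grfree[OF V that] mkoszul_mkoszul[OF V that] by simp_all
  show "\<exists>G\<in>tens V (grfree V l) (Suc (Suc p)) j. F = mkoszul {} V G"
    if "F \<in> tens V (grfree V l) (Suc p) j" "mkoszul {} V F = 0" for p F
    by (rule koszul_free_exact[OF V that])
qed (rule mkoszul_diff pmap_mkoszul)+

section \<open>Existence of minimal generators and resolutions\<close>

lemma coef_single_mult [simp]: "coef (Poly_Mapping.single 0 c * f) m = c * coef f m"
proof -
  have "Poly_Mapping.single 0 c * f = (\<Sum>m'\<in>keysp f. Poly_Mapping.single m' (c * coef f m'))"
    by (subst mpoly_sum_single[of f]) (simp add: sum_distrib_left mult_single)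
  then show ?thesis by (simp add: lookup_sum lookup_single when_def in_keys_iff)
qed

lemma hpoly_single_0: "Poly_Mapping.single 0 c \<in> hpoly V 0"
  by (auto simp: hpoly_iff)

lemma hpoly_degree_0: "f \<in> hpoly V 0 \<Longrightarrow> f = Poly_Mapping.single 0 (coef f 0)"
  by (rule poly_mapping_eqI)
    (auto simp: hpoly_iff lookup_single when_def in_keys_iff mono_deg_eq_0_iff dest: bspec)

lemma coef_Var_mult_0 [simp]: "coef (Var x * f) 0 = 0"
  by (simp add: lookup_Var_mult)

text \<open>Koszul homology in degree 0 is \<open>M\<close> modulo the maximal ideal; for a minimal
  presentation the generators form a basis of it.\<close>

lemma hvan_0_iff:
  assumes V: "finite V" and pres: "presents \<G> V M l gens"
  shows "hvan \<G> V M 0 j \<longleftrightarrow> j \<notin> set l"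
proof
  assume hv: "hvan \<G> V M 0 j"
  show "j \<notin> set l"
  proof
    assume "j \<in> set l"
    then obtain k where k: "k < length l" "l ! k = j" by (auto simp: in_set_conv_nth)
    \<comment> \<open>The \<open>k\<close>-th basis element as a 0-chain. If its image bounds, it
      differs from a boundary by a syzygy with constant coefficient 1.\<close>
    define X where "X S = (if S = {} then (\<lambda>i. if i = k then 1 else 0) else 0 :: nat \<Rightarrow> ('a, 'b) mpoly)"
      for S :: "'a set"
    have card0: "S \<subseteq> V \<and> card S = 0 \<longleftrightarrow> S = {}" for S using V finite_subset[of S V] by auto
    have X: "X \<in> tens V (grfree V l) 0 j"
    proof (rule tensI)
      fix S assume "S \<subseteq> V" "card S = 0"
      then have "S = {}" using card0 by blast
      then show "X S \<in> grfree V l (j - int 0)" using k by (intro grfreeI) (auto simp: X_def)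
    qed (use card0 in \<open>auto simp: X_def\<close>)
    define F where "F = (\<lambda>S. pmap \<G> (length l) gens (X S))"
    have F: "F \<in> tens V M 0 j"
      unfolding tens_pmap_image[OF pres, symmetric] F_def using X by blast
    obtain G where G: "G \<in> tens V M (Suc 0) j" "F = mkoszul \<G> V G"
      using hv F mkoszul_tens_0[OF F V] unfolding hvan_def by blast
    obtain Y where Y: "Y \<in> tens V (grfree V l) (Suc 0) j" "G = (\<lambda>S. pmap \<G> (length l) gens (Y S))"
      using G(1) unfolding tens_pmap_image[OF pres, symmetric] by blast
    have "F = (\<lambda>S. pmap \<G> (length l) gens (mkoszul {} V Y S))"
      unfolding G(2) Y(2) by (rule pmap_mkoszul[symmetric])
    then have eq: "pmap \<G> (length l) gens (X {}) = pmap \<G> (length l) gens (mkoszul {} V Y {})"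
      unfolding F_def by (rule fun_cong)
    have "mkoszul {} V Y \<in> tens V (grfree V l) 0 j" by (rule mkoszul_grfree[OF V Y(1)])
    then have "X {} - mkoszul {} V Y {} \<in> syzygies \<G> V l gens j"
      using eq X tensD[of _ V "grfree V l" 0 j "{}"]
      by (auto simp: syzygies_def pmap_diff intro!: grfree_diff)
    then have "coef ((X {} - mkoszul {} V Y {}) k) 0 = 0"
      using pres unfolding presents_def by blast
    then show False
      by (simp add: X_def mkoszul_empty_set lookup_minus lookup_sum)
  qed
next
  assume j: "j \<notin> set l"
  show "hvan \<G> V M 0 j"
    unfolding hvan_def
  proof (intro ballI impI)
    fix F assume "F \<in> tens V M 0 j"
    then obtain X where X: "X \<in> tens V (grfree V l) 0 j" "F = (\<lambda>S. pmap \<G> (length l) gens (X S))"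
      unfolding tens_pmap_image[OF pres, symmetric] by blast
    have "X {} \<in> grfree V l j" using tensD[OF X(1), of "{}"] by simp
    then have "coef (X {} k) 0 = 0" for k
      using j grfreeD[of "X {}" V l j k] hpoly_0_coef[of "X {} k" V "j - l ! k"]
      by (cases "k < length l") (auto dest: nth_mem)
    then obtain G where G: "G \<in> tens V (grfree V l) (Suc 0) j" "X = mkoszul {} V G"
      using boundary_of_irrelevant[OF V X(1)] by blast
    have "F = mkoszul \<G> V (\<lambda>S. pmap \<G> (length l) gens (G S))"
      unfolding X(2) G(2) by (rule pmap_mkoszul)
    moreover have "(\<lambda>S. pmap \<G> (length l) gens (G S)) \<in> tens V M (Suc 0) j"
      unfolding tens_pmap_image[OF pres, symmetric] using G(1) by blast
    ultimately show "\<exists>G\<in>tens V M (Suc 0) j. F = mkoszul \<G> V G" by blast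
  qed
qed

section \<open>Finite generation and minimal generators\<close>

definition graded_module :: "'v::linorder set set \<Rightarrow> 'v set \<Rightarrow> ('v, 'k::field) grmod \<Rightarrow> bool" where
  "graded_module \<G> V M \<longleftrightarrow>
     (\<exists>l. (\<forall>e\<in>set l. 0 \<le> e) \<and> (\<forall>d. M d \<subseteq> grfree V l d)) \<and>
     (\<forall>d. 0 \<in> M d) \<and> (\<forall>d. \<forall>v\<in>M d. \<forall>w\<in>M d. v + w \<in> M d) \<and>
     (\<forall>a d. \<forall>f\<in>hpoly V a. \<forall>v\<in>M d. (\<lambda>i. nf \<G> (f * v i)) \<in> M (a + d)) \<and>
     (\<forall>d. \<forall>v\<in>M d. \<forall>i. nf \<G> (v i) = v i)"

lemma graded_moduleD:
  assumes "graded_module \<G> V M"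
  shows "0 \<in> M d" "v \<in> M d \<Longrightarrow> w \<in> M d \<Longrightarrow> v + w \<in> M d"
    "f \<in> hpoly V a \<Longrightarrow> v \<in> M d \<Longrightarrow> (\<lambda>i. nf \<G> (f * v i)) \<in> M (a + d)"
    "v \<in> M d \<Longrightarrow> nf \<G> (v i) = v i"
  using assms unfolding graded_module_def by blast+

lemma graded_module_sum:
  assumes "graded_module \<G> V M" "finite P" "\<And>x. x \<in> P \<Longrightarrow> v x \<in> M d"
  shows "(\<lambda>i. \<Sum>x\<in>P. v x i) \<in> M d"
  using assms(2,3)
proof (induction P rule: finite_induct)
  case empty
  then show ?case using graded_moduleD(1)[OF assms(1), of d] by (simp add: zero_fun_def)
next
  case (insert x P)
  have "v x + (\<lambda>i. \<Sum>x\<in>P. v x i) \<in> M d"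
    using insert by (intro graded_moduleD(2)[OF assms(1)]) auto
  then show ?case using insert.hyps by (simp add: plus_fun_def)
qed

lemma graded_module_syzygies:
  assumes "\<forall>e\<in>set l. 0 \<le> e"
  shows "graded_module {} V (syzygies \<G> V l gens)"
  unfolding graded_module_def
proof (intro conjI allI ballI)
  show "\<exists>l'. (\<forall>e\<in>set l'. 0 \<le> e) \<and> (\<forall>d. syzygies \<G> V l gens d \<subseteq> grfree V l' d)"
    using assms by (intro exI[of _ l]) (auto simp: syzygies_def)
  show "(\<lambda>i. nf {} (f * v i)) \<in> syzygies \<G> V l gens (a + d)"
    if "f \<in> hpoly V a" "v \<in> syzygies \<G> V l gens d" for a d f v
    using that grfree_scale[of f V a v l d] by (auto simp: syzygies_def pmap_scale zero_fun_def)
qed (auto simp: syzygies_def pmap_add grfree_add)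

text \<open>Gaussian elimination: the coefficients at the finitely many positions in
  \<open>C\<close> determine an element of \<open>W\<close>, and one element with a nonzero
  coefficient at a position clears that position in all others.\<close>

lemma finite_spanning:
  fixes W :: "(nat \<Rightarrow> ('v, 'k::field) mpoly) set"
  assumes "finite C" "\<And>v. v \<in> W \<Longrightarrow> (\<And>i m. (i, m) \<in> C \<Longrightarrow> coef (v i) m = 0) \<Longrightarrow> v = 0"
    and "0 \<in> W"
    and "\<And>v w c. v \<in> W \<Longrightarrow> w \<in> W \<Longrightarrow> (\<lambda>i. v i - Poly_Mapping.single 0 c * w i) \<in> W"
  shows "\<exists>B. finite B \<and> B \<subseteq> W \<and>
    (\<forall>v\<in>W. \<exists>c. v = (\<lambda>i. \<Sum>b\<in>B. Poly_Mapping.single 0 (c b) * b i))"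
  using assms
proof (induction C arbitrary: W rule: finite_induct)
  case empty
  have "v = (\<lambda>i. 0)" if "v \<in> W" for v using empty.prems(1)[OF that] by (simp add: zero_fun_def)
  then show ?case by (intro exI[of _ "{}"]) auto
next
  case (insert x C)
  obtain i m where x: "x = (i, m)" by (cases x)
  define W' where "W' = {v \<in> W. coef (v i) m = 0}"
  have "\<exists>B. finite B \<and> B \<subseteq> W' \<and>
    (\<forall>v\<in>W'. \<exists>c. v = (\<lambda>i. \<Sum>b\<in>B. Poly_Mapping.single 0 (c b) * b i))"
  proof (rule insert.IH)
    show "v = 0" if "v \<in> W'" "\<And>i m. (i, m) \<in> C \<Longrightarrow> coef (v i) m = 0" for v
      using that by (intro insert.prems(1)) (auto simp: W'_def x)
    show "(\<lambda>i. v i - Poly_Mapping.single 0 c * w i) \<in> W'" if "v \<in> W'" "w \<in> W'" for v w c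
      using that insert.prems(3) by (auto simp: W'_def lookup_minus)
  qed (use insert.prems(2) in \<open>auto simp: W'_def\<close>)
  then obtain B where B: "finite B" "B \<subseteq> W'"
    "\<And>v. v \<in> W' \<Longrightarrow> \<exists>c. v = (\<lambda>i. \<Sum>b\<in>B. Poly_Mapping.single 0 (c b) * b i)" by blast
  show ?case
  proof (cases "W' = W")
    case True
    then show ?thesis using B by blast
  next
    case False
    then obtain b where b: "b \<in> W" "coef (b i) m \<noteq> 0" by (auto simp: W'_def)
    have "b \<notin> B" using B(2) b by (auto simp: W'_def)
    have "\<exists>c. v = (\<lambda>i. \<Sum>b\<in>insert b B. Poly_Mapping.single 0 (c b) * b i)" if v: "v \<in> W" for v
    proof -
      define c0 where "c0 = coef (v i) m / coef (b i) m"
      have "(\<lambda>i. v i - Poly_Mapping.single 0 c0 * b i) \<in> W'"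
        using insert.prems(3)[OF v b(1)] b(2) by (simp add: W'_def lookup_minus c0_def)
      then obtain c where c: "(\<lambda>i. v i - Poly_Mapping.single 0 c0 * b i) =
          (\<lambda>i. \<Sum>b\<in>B. Poly_Mapping.single 0 (c b) * b i)" using B(3) by blast
      have "v i = (\<Sum>x\<in>insert b B. Poly_Mapping.single 0 ((c(b := c0)) x) * x i)" for i
      proof -
        have "(\<Sum>x\<in>B. Poly_Mapping.single 0 ((c(b := c0)) x) * x i) =
            (\<Sum>x\<in>B. Poly_Mapping.single 0 (c x) * x i)"
          using \<open>b \<notin> B\<close> by (intro sum.cong) auto
        also have "\<dots> = v i - Poly_Mapping.single 0 c0 * b i" using fun_cong[OF c, of i] by simp
        finally show ?thesis using B(1) \<open>b \<notin> B\<close> by simp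
      qed
      then show ?thesis by blast
    qed
    then show ?thesis using B b by (intro exI[of _ "insert b B"]) (auto simp: W'_def)
  qed
qed

lemma graded_piece_finite_spanning:
  assumes V: "finite V" and M: "graded_module \<G> V M"
  shows "\<exists>B. finite B \<and> B \<subseteq> M d \<and>
    (\<forall>v\<in>M d. \<exists>c. v = (\<lambda>i. \<Sum>b\<in>B. Poly_Mapping.single 0 (c b) * b i))"
proof -
  obtain l where l: "\<And>d. M d \<subseteq> grfree V l d" using M unfolding graded_module_def by blast
  define C where "C = (SIGMA i:{..<length l}. {m. keysp m \<subseteq> V \<and> mono_deg m = nat (d - l ! i)})"
  show ?thesis
  proof (rule finite_spanning[of C])
    show "finite C" unfolding C_def using finite_monomials[OF V] by auto
    show "v = 0" if v: "v \<in> M d" "\<And>i m. (i, m) \<in> C \<Longrightarrow> coef (v i) m = 0" for v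
    proof (intro ext poly_mapping_eqI)
      fix i m
      have "m \<notin> keysp (v i)"
      proof
        assume m: "m \<in> keysp (v i)"
        have "i < length l" using grfreeD(2)[of v V l d i] v(1) l m by force
        then have "v i \<in> hpoly V (d - l ! i)" using grfreeD(1) v(1) l by blast
        then have "keysp m \<subseteq> V" "int (mono_deg m) = d - l ! i" using m by (auto simp: hpoly_iff)
        then have "(i, m) \<in> C" using \<open>i < length l\<close> by (auto simp: C_def)
        then show False using v(2) m by (auto simp: in_keys_iff)
      qed
      then show "coef (v i) m = coef (0 i) m" by (simp add: in_keys_iff)
    qed
    show "0 \<in> M d" by (rule graded_moduleD(1)[OF M])
    show "(\<lambda>i. v i - Poly_Mapping.single 0 c * w i) \<in> M d" if vw: "v \<in> M d" "w \<in> M d" for v w c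
    proof -
      have "(\<lambda>i. nf \<G> (Poly_Mapping.single 0 (- c) * w i)) \<in> M d"
        using graded_moduleD(3)[OF M hpoly_single_0 vw(2)] by simp
      then have "v + (\<lambda>i. nf \<G> (Poly_Mapping.single 0 (- c) * w i)) \<in> M d"
        using vw by (intro graded_moduleD(2)[OF M])
      moreover have "v i + nf \<G> (Poly_Mapping.single 0 (- c) * w i) =
          v i - Poly_Mapping.single 0 c * w i" for i
      proof -
        have "nf \<G> (w i) = w i" by (rule graded_moduleD(4)[OF M vw(2)])
        then have "std_mono \<G> m" if "coef (w i) m \<noteq> 0" for m
          using that by (auto simp: nf_def restr_id_iff in_keys_iff)
        then show ?thesis
          by (intro poly_mapping_eqI) (auto simp: nf_def lookup_add lookup_minus)
      qed
      ultimately show ?thesis by (simp add: plus_fun_def)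
    qed
  qed
qed

definition generates :: "'v::linorder set set \<Rightarrow> 'v set \<Rightarrow> ('v, 'k::field) grmod \<Rightarrow>
    (int \<times> (nat \<Rightarrow> ('v, 'k) mpoly)) set \<Rightarrow> bool" where
  "generates \<G> V M P \<longleftrightarrow> finite P \<and> (\<forall>x\<in>P. 0 \<le> fst x \<and> snd x \<in> M (fst x)) \<and>
     (\<forall>d. \<forall>v\<in>M d. \<exists>c. (\<forall>x\<in>P. c x \<in> hpoly V (d - fst x)) \<and>
        v = (\<lambda>i. nf \<G> (\<Sum>x\<in>P. c x * snd x i)))"

text \<open>Vanishing in homological degree 0 beyond \<open>J\<close> says that elements of degree
  above \<open>J\<close> are combinations of variables and elements of lower degree. So spanning
  sets of the pieces in degrees 0 to \<open>J\<close> generate.\<close>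

lemma exists_generating_set:
  assumes V: "finite V" and M: "graded_module \<G> V M"
    and hv: "\<And>j. j > int J \<Longrightarrow> hvan \<G> V M 0 j"
  shows "\<exists>P. generates \<G> V M P"
proof -
  define spans where "spans d B \<longleftrightarrow>
      (\<forall>v\<in>M d. \<exists>c. v = (\<lambda>i. \<Sum>b\<in>B. Poly_Mapping.single 0 (c b) * b i))" for d B
  have "\<exists>B. \<forall>d. finite (B d) \<and> B d \<subseteq> M d \<and> spans d (B d)"
    unfolding spans_def by (intro choice allI graded_piece_finite_spanning[OF V M])
  then obtain B where B: "\<And>d. finite (B d)" "\<And>d. B d \<subseteq> M d" and spans: "\<And>d. spans d (B d)"
    by auto
  define P where "P = (SIGMA d:{0..int J}. B d)"
  have finP: "finite P" unfolding P_def using B(1) by auto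
  obtain l where l: "\<forall>e\<in>set l. 0 \<le> e" "\<And>d. M d \<subseteq> grfree V l d"
    using M unfolding graded_module_def by blast
  have nonneg: "\<forall>v\<in>M (int d). \<exists>c. (\<forall>x\<in>P. c x \<in> hpoly V (int d - fst x)) \<and>
      v = (\<lambda>i. nf \<G> (\<Sum>x\<in>P. c x * snd x i))" for d
  proof (induction d rule: less_induct)
    case (less d)
    show ?case
    proof
      fix v assume v: "v \<in> M (int d)"
      show "\<exists>c. (\<forall>x\<in>P. c x \<in> hpoly V (int d - fst x)) \<and> v = (\<lambda>i. nf \<G> (\<Sum>x\<in>P. c x * snd x i))"
      proof (cases "d \<le> J")
        case True
        obtain c where c: "v = (\<lambda>i. \<Sum>b\<in>B (int d). Poly_Mapping.single 0 (c b) * b i)"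
          using bspec[OF spans[unfolded spans_def] v] by (rule exE)
        define c' where "c' x = (if fst x = int d then Poly_Mapping.single 0 (c (snd x)) else 0 :: ('a, 'b) mpoly)" for x
        have "(\<Sum>x\<in>P. c' x * snd x i) = v i" for i
        proof -
          have "(\<Sum>x\<in>P. c' x * snd x i) = (\<Sum>x\<in>{int d} \<times> B (int d). c' x * snd x i)"
            by (rule sum.mono_neutral_right[OF finP]) (use True in \<open>auto simp: P_def c'_def\<close>)
          also have "\<dots> = (\<Sum>b\<in>B (int d). Poly_Mapping.single 0 (c b) * b i)"
          proof -
            have "{int d} \<times> B (int d) = Pair (int d) ` B (int d)" by auto
            then show ?thesis by (simp add: sum.reindex inj_on_def c'_def)
          qed
          finally show ?thesis by (simp add: c)
        qed
        moreover have "nf \<G> (v i) = v i" for i by (rule graded_moduleD(4)[OF M v])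
        moreover have "c' x \<in> hpoly V (int d - fst x)" for x
          by (auto simp: c'_def hpoly_single_0)
        ultimately show ?thesis by (intro exI[of _ c']) simp
      next
        case False
        \<comment> \<open>\<open>v\<close> as a 0-chain; a chain bounding it writes \<open>v\<close>
          through the variables.\<close>
        define F where "F S = (if S = {} then v else 0)" for S :: "'a set"
        have card0: "S \<subseteq> V \<and> card S = 0 \<longleftrightarrow> S = {}" for S using V finite_subset[of S V] by auto
        have F: "F \<in> tens V M 0 (int d)"
        proof (rule tensI)
          fix S assume "S \<subseteq> V" "card S = 0"
          then have "S = {}" using card0 by blast
          then show "F S \<in> M (int d - int 0)" using v by (simp add: F_def)
        qed (use card0 in \<open>auto simp: F_def\<close>)
        have "hvan \<G> V M 0 (int d)" using hv False by simp
        then obtain G where G: "G \<in> tens V M (Suc 0) (int d)" "F = mkoszul \<G> V G"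
          using F mkoszul_tens_0[OF F V] unfolding hvan_def by blast
        have "v i = mkoszul \<G> V G {} i" for i
          using fun_cong[OF fun_cong[OF G(2), of "{}"], of i] by (simp add: F_def)
        then have vi: "v i = nf \<G> (\<Sum>x\<in>V. Var x * G {x} i)" for i by (simp add: mkoszul_empty_set)
        have "\<exists>c. (\<forall>y\<in>P. c y \<in> hpoly V (int (d - 1) - fst y)) \<and>
            G {x} = (\<lambda>i. nf \<G> (\<Sum>y\<in>P. c y * snd y i))" if "x \<in> V" for x
        proof -
          have "G {x} \<in> M (int (d - 1))" using tensD[OF G(1), of "{x}"] that False
            by (simp add: of_nat_diff)
          then show ?thesis using less[of "d - 1"] False by auto
        qed
        then have "\<forall>x\<in>V. \<exists>c. (\<forall>y\<in>P. c y \<in> hpoly V (int (d - 1) - fst y)) \<and>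
            G {x} = (\<lambda>i. nf \<G> (\<Sum>y\<in>P. c y * snd y i))" by (rule ballI)
        from bchoice[OF this] obtain c where c': "\<forall>x\<in>V. (\<forall>y\<in>P. c x y \<in> hpoly V (int (d - 1) - fst y)) \<and>
            G {x} = (\<lambda>i. nf \<G> (\<Sum>y\<in>P. c x y * snd y i))" ..
        have c: "c x y \<in> hpoly V (int (d - 1) - fst y)" if "x \<in> V" "y \<in> P" for x y
          using c' that by simp
        have G_eq: "G {x} i = nf \<G> (\<Sum>y\<in>P. c x y * snd y i)" if "x \<in> V" for x i
          using c' that by simp
        define c' where "c' y = (\<Sum>x\<in>V. Var x * c x y)" for y
        have "c' y \<in> hpoly V (int d - fst y)" if "y \<in> P" for y
          unfolding c'_def
        proof (rule hpoly_sum)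
          fix x assume "x \<in> V"
          then have "Var x * c x y \<in> hpoly V (1 + (int (d - 1) - fst y))"
            using c[OF _ that] by (intro hpoly_mult) auto
          then show "Var x * c x y \<in> hpoly V (int d - fst y)" using False by (simp add: of_nat_diff)
        qed
        moreover have "v i = nf \<G> (\<Sum>y\<in>P. c' y * snd y i)" for i
        proof -
          have "v i = nf \<G> (\<Sum>x\<in>V. Var x * nf \<G> (\<Sum>y\<in>P. c x y * snd y i))"
            by (simp add: vi G_eq)
          also have "\<dots> = nf \<G> (\<Sum>x\<in>V. Var x * (\<Sum>y\<in>P. c x y * snd y i))" by (rule nf_sum_mult)
          also have "(\<Sum>x\<in>V. Var x * (\<Sum>y\<in>P. c x y * snd y i)) = (\<Sum>y\<in>P. c' y * snd y i)"
            unfolding c'_def sum_distrib_left sum_distrib_right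
            by (subst sum.swap) (simp add: mult.assoc)
          finally show ?thesis .
        qed
        ultimately show ?thesis by (intro exI[of _ c']) auto
      qed
    qed
  qed
  have neg: "\<exists>c. (\<forall>x\<in>P. c x \<in> hpoly V (d - fst x)) \<and> v = (\<lambda>i. nf \<G> (\<Sum>x\<in>P. c x * snd x i))"
    if "d < 0" "v \<in> M d" for d v
  proof -
    have "v = 0" using grfree_neg[OF l(1) that(1)] that(2) l(2) by blast
    then show ?thesis by (intro exI[of _ "\<lambda>_. 0"]) (simp add: zero_fun_def)
  qed
  have all: "\<forall>v\<in>M d. \<exists>c. (\<forall>x\<in>P. c x \<in> hpoly V (d - fst x)) \<and>
      v = (\<lambda>i. nf \<G> (\<Sum>x\<in>P. c x * snd x i))" for d
  proof (cases "d < 0")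
    case True
    show ?thesis by (intro ballI neg[OF True])
  next
    case False
    then show ?thesis using nonneg[of "nat d"] by simp
  qed
  have "generates \<G> V M P"
    unfolding generates_def
  proof (intro conjI allI)
    show "\<forall>x\<in>P. 0 \<le> fst x \<and> snd x \<in> M (fst x)" using B(2) by (auto simp: P_def)
  qed (rule finP, rule all)
  then show ?thesis by (rule exI)
qed

lemma generatesE:
  assumes "generates \<G> V M P" "v \<in> M d"
  obtains c where "\<And>x. x \<in> P \<Longrightarrow> c x \<in> hpoly V (d - fst x)"
    "v = (\<lambda>i. nf \<G> (\<Sum>x\<in>P. c x * snd x i))"
proof -
  have "\<exists>c. (\<forall>x\<in>P. c x \<in> hpoly V (d - fst x)) \<and> v = (\<lambda>i. nf \<G> (\<Sum>x\<in>P. c x * snd x i))"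
    using assms unfolding generates_def by simp
  then obtain c where c: "(\<forall>x\<in>P. c x \<in> hpoly V (d - fst x)) \<and>
      v = (\<lambda>i. nf \<G> (\<Sum>x\<in>P. c x * snd x i))" ..
  show ?thesis by (rule that[OF bspec[OF conjunct1[OF c]] conjunct2[OF c]])
qed

text \<open>A nonzero constant coefficient is a unit, and the relation has the degree of
  \<open>x0\<close>. It can then be solved for \<open>x0\<close>, and the other generators suffice,
  against the minimal cardinality of \<open>P\<close>.\<close>

lemma minimal_generating_set:
  assumes M: "graded_module \<G> V M" and P: "generates \<G> V M P"
    and min: "\<And>P'. generates \<G> V M P' \<Longrightarrow> card P \<le> card P'"
    and c: "\<And>x. x \<in> P \<Longrightarrow> c x \<in> hpoly V (d - fst x)" "\<And>i. nf \<G> (\<Sum>x\<in>P. c x * snd x i) = 0"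
    and x0: "x0 \<in> P"
  shows "coef (c x0) 0 = 0"
proof (rule ccontr)
  define \<gamma> where "\<gamma> = coef (c x0) 0"
  assume "coef (c x0) 0 \<noteq> 0"
  then have \<gamma>: "\<gamma> \<noteq> 0" by (simp add: \<gamma>_def)
  have d: "d = fst x0" using hpoly_0_coef[OF c(1)[OF x0]] \<gamma> by (auto simp: \<gamma>_def)
  then have cx0: "c x0 = Poly_Mapping.single 0 \<gamma>"
    using hpoly_degree_0[of "c x0" V] c(1)[OF x0] by (simp add: \<gamma>_def)
  have finP: "finite P" using P by (simp add: generates_def)
  define P' where "P' = P - {x0}"
  define \<epsilon> where "\<epsilon> = (Poly_Mapping.single 0 (1 / \<gamma>) :: ('a, 'b) mpoly)"
  have \<epsilon>\<gamma>: "\<epsilon> * Poly_Mapping.single 0 \<gamma> = 1" using \<gamma> by (simp add: \<epsilon>_def mult_single)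
  have rel: "nf \<G> (\<Sum>x\<in>P'. c x * snd x i) = - nf \<G> (c x0 * snd x0 i)" for i
  proof -
    have "nf \<G> (c x0 * snd x0 i + (\<Sum>x\<in>P'. c x * snd x i)) = 0"
      using c(2)[of i] finP x0 by (simp add: P'_def sum.remove)
    then show ?thesis by (simp add: nf_def restr_add eq_neg_iff_add_eq_0 add.commute)
  qed
  have "generates \<G> V M P'"
    unfolding generates_def
  proof (intro conjI allI ballI)
    fix d' v assume "v \<in> M d'"
    then obtain b where b: "\<And>x. x \<in> P \<Longrightarrow> b x \<in> hpoly V (d' - fst x)"
      "v = (\<lambda>i. nf \<G> (\<Sum>x\<in>P. b x * snd x i))" using P unfolding generates_def by blast
    \<comment> \<open>The coefficients after substituting the solved relation for
      \<open>x0\<close>.\<close>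
    define b' where "b' x = b x - b x0 * \<epsilon> * c x" for x
    have "b' x \<in> hpoly V (d' - fst x)" if x: "x \<in> P'" for x
    proof -
      have "b x0 * \<epsilon> * c x \<in> hpoly V ((d' - fst x0) + 0 + (d - fst x))"
        using x x0 unfolding \<epsilon>_def by (intro hpoly_mult b c hpoly_single_0) (auto simp: P'_def)
      then show ?thesis using b(1)[of x] x by (auto simp: b'_def d P'_def)
    qed
    moreover have "v i = nf \<G> (\<Sum>x\<in>P'. b' x * snd x i)" for i
    proof -
      have "(\<Sum>x\<in>P'. b' x * snd x i) =
          (\<Sum>x\<in>P'. b x * snd x i) - (b x0 * \<epsilon>) * (\<Sum>x\<in>P'. c x * snd x i)"
        by (simp add: b'_def left_diff_distrib sum_subtractf sum_distrib_left mult.assoc)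
      then have "nf \<G> (\<Sum>x\<in>P'. b' x * snd x i) = nf \<G> (\<Sum>x\<in>P'. b x * snd x i) -
          nf \<G> ((b x0 * \<epsilon>) * nf \<G> (\<Sum>x\<in>P'. c x * snd x i))"
        by (simp add: nf_mult) (simp add: nf_def restr_diff)
      also have "nf \<G> ((b x0 * \<epsilon>) * nf \<G> (\<Sum>x\<in>P'. c x * snd x i)) =
          - nf \<G> ((b x0 * \<epsilon>) * (c x0 * snd x0 i))"
        unfolding rel using nf_mult[of \<G> "b x0 * \<epsilon>" "c x0 * snd x0 i"]
        by (simp add: nf_def restr_uminus)
      also have "(b x0 * \<epsilon>) * (c x0 * snd x0 i) = b x0 * snd x0 i"
        using arg_cong[OF \<epsilon>\<gamma>, of "\<lambda>y. b x0 * (y * snd x0 i)"] by (simp add: cx0 mult.assoc)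
      also have "nf \<G> (\<Sum>x\<in>P'. b x * snd x i) - - nf \<G> (b x0 * snd x0 i) =
          nf \<G> (b x0 * snd x0 i + (\<Sum>x\<in>P'. b x * snd x i))"
        by (simp add: nf_def restr_add)
      also have "\<dots> = v i" using finP x0 by (simp add: b(2) P'_def sum.remove)
      finally show ?thesis by simp
    qed
    ultimately show "\<exists>c. (\<forall>x\<in>P'. c x \<in> hpoly V (d' - fst x)) \<and>
        v = (\<lambda>i. nf \<G> (\<Sum>x\<in>P'. c x * snd x i))" by (intro exI[of _ b'] conjI ballI ext)
  qed (use P in \<open>auto simp: generates_def P'_def\<close>)
  then have "card P \<le> card P'" by (rule min)
  moreover have "card P' < card P" unfolding P'_def using finP x0 by (rule card_Diff1_less)
  ultimately show False by simp
qed

lemma exists_presentation: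
  assumes V: "finite V" and M: "graded_module \<G> V M"
    and hv: "\<And>j. j > int J \<Longrightarrow> hvan \<G> V M 0 j"
  shows "\<exists>l gens. presents \<G> V M l gens \<and> (\<forall>e\<in>set l. 0 \<le> e) \<and>
    (\<forall>k<length l. gens k \<in> M (l ! k))"
proof -
  obtain P where P: "generates \<G> V M P" and min: "\<And>P'. generates \<G> V M P' \<Longrightarrow> card P \<le> card P'"
  proof -
    obtain P\<^sub>0 where "generates \<G> V M P\<^sub>0" using exists_generating_set[OF V M hv] by auto
    then show thesis using that ex_has_least_nat[of "generates \<G> V M" P\<^sub>0 card] by auto
  qed
  have finP: "finite P" and P_mem: "\<And>x. x \<in> P \<Longrightarrow> 0 \<le> fst x \<and> snd x \<in> M (fst x)"
    using P unfolding generates_def by simp_all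
  obtain xs where xs: "set xs = P" "distinct xs" using finite_distinct_list[OF finP] by blast
  define l where "l = map fst xs"
  define gens where "gens k = snd (xs ! k)" for k
  have len: "length l = length xs" by (simp add: l_def)
  have bij: "bij_betw ((!) xs) {..<length xs} P" using bij_betw_nth[OF xs(2)] xs(1) by simp
  have sum_P: "(\<Sum>x\<in>P. h x) = (\<Sum>k<length xs. h (xs ! k))" for h :: "_ \<Rightarrow> ('a, 'b) mpoly"
    by (rule sum.reindex_bij_betw[OF bij, symmetric])
  define idx where "idx = inv_into {..<length xs} ((!) xs)"
  have idx: "xs ! idx x = x" "idx x < length xs" if "x \<in> P" for x
    using that bij f_inv_into_f[of x "(!) xs" "{..<length xs}"] inv_into_into[of x "(!) xs" "{..<length xs}"]
    unfolding idx_def bij_betw_def by auto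
  have idx': "idx (xs ! k) = k" if "k < length xs" for k
    using that bij unfolding idx_def bij_betw_def by (auto intro: inv_into_f_f)
  have pmap_P: "pmap \<G> (length l) gens w = (\<lambda>i. nf \<G> (\<Sum>x\<in>P. w (idx x) * snd x i))" for w
    by (rule ext) (simp add: pmap_def sum_P len gens_def idx')
  have w_P: "w (idx x) \<in> hpoly V (d - fst x)" if "w \<in> grfree V l d" "x \<in> P" for w d x
    using grfreeD(1)[OF that(1), of "idx x"] idx[OF that(2)] by (simp add: l_def)
  have "M d = pmap \<G> (length l) gens ` grfree V l d" for d
  proof (intro equalityI subsetI)
    fix v assume "v \<in> M d"
    then obtain c where c: "\<And>x. x \<in> P \<Longrightarrow> c x \<in> hpoly V (d - fst x)"
      "v = (\<lambda>i. nf \<G> (\<Sum>x\<in>P. c x * snd x i))" by (rule generatesE[OF P]) (rule that)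
    define w where "w k = (if k < length xs then c (xs ! k) else 0)" for k
    have "w \<in> grfree V l d"
      using c(1)[of "xs ! _"] xs(1) by (intro grfreeI) (auto simp: w_def l_def)
    moreover have "w (idx x) = c x" if "x \<in> P" for x using idx[OF that] by (simp add: w_def)
    then have "v = pmap \<G> (length l) gens w" unfolding pmap_P c(2) by simp
    ultimately show "v \<in> pmap \<G> (length l) gens ` grfree V l d" by blast
  next
    fix v assume "v \<in> pmap \<G> (length l) gens ` grfree V l d"
    then obtain w where w: "w \<in> grfree V l d" "v = pmap \<G> (length l) gens w" by blast
    have "(\<lambda>i. nf \<G> (w (idx x) * snd x i)) \<in> M d" if "x \<in> P" for x
      using graded_moduleD(3)[OF M w_P[OF w(1) that], of "snd x" "fst x"] P_mem[OF that] by simp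
    then have "(\<lambda>i. \<Sum>x\<in>P. nf \<G> (w (idx x) * snd x i)) \<in> M d"
      by (rule graded_module_sum[OF M finP])
    then show "v \<in> M d" unfolding w(2) pmap_P by (simp add: nf_def restr_sum)
  qed
  moreover have "coef (w k) 0 = 0" if w: "w \<in> syzygies \<G> V l gens d" for w d k
  proof (cases "k < length xs")
    case True
    have w1: "w \<in> grfree V l d" and w2: "pmap \<G> (length l) gens w = 0"
      using w by (auto simp: syzygies_def)
    have "coef (w (idx (xs ! k))) 0 = 0"
    proof (rule minimal_generating_set[OF M P min, where d = d])
      show "nf \<G> (\<Sum>x\<in>P. w (idx x) * snd x i) = 0" for i
        using fun_cong[OF w2, of i] by (simp add: pmap_P)
    qed (use w_P[OF w1] True xs(1) in auto)
    then show ?thesis using idx'[OF True] by simp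
  next
    case False
    then show ?thesis using w grfreeD(2)[of w V l d k] by (simp add: syzygies_def len)
  qed
  ultimately have "presents \<G> V M l gens" unfolding presents_def by blast
  moreover have "\<forall>e\<in>set l. 0 \<le> e" using P_mem xs(1) by (auto simp: l_def)
  moreover have "gens k \<in> M (l ! k)" if "k < length l" for k
    using P_mem[of "xs ! k"] xs(1) nth_mem[of k xs] that by (simp add: gens_def l_def)
  ultimately show ?thesis by blast
qed

text \<open>The quotient ring, represented by normal forms in the coordinate \<open>0\<close>.\<close>

definition std_module :: "'v set set \<Rightarrow> 'v set \<Rightarrow> ('v, 'k::field) grmod" where
  "std_module \<G> V d = {v. v 0 \<in> hpoly V d \<and> nf \<G> (v 0) = v 0 \<and> (\<forall>i>0. v i = 0)}"

text \<open>Only the quotient ring itself is computed modulo the ideal; the higher syzygy modules lie in free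
  modules.\<close>

definition res_gens :: "'v set set \<Rightarrow> nat \<Rightarrow> 'v set set" where
  "res_gens \<G> q = (if q = 0 then \<G> else {})"

section \<open>Resolutions as chains of minimal presentations\<close>

fun res_module :: "'v set set \<Rightarrow> 'v set \<Rightarrow> (nat \<Rightarrow> int list) \<Rightarrow>
    (nat \<Rightarrow> nat \<Rightarrow> nat \<Rightarrow> ('v, 'k::field) mpoly) \<Rightarrow> nat \<Rightarrow> ('v, 'k) grmod" where
  "res_module \<G> V l gens 0 = std_module \<G> V"
| "res_module \<G> V l gens (Suc q) = syzygies (if q = 0 then \<G> else {}) V (l q) (gens q)"

text \<open>Each step presents the syzygies of the preceding one, so exactness is built into
  \<open>res_module\<close> and minimality into \<open>presents\<close>.\<close>

definition graded_resolution :: "'v set set \<Rightarrow> 'v set \<Rightarrow> (nat \<Rightarrow> int list) \<Rightarrow>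
    (nat \<Rightarrow> nat \<Rightarrow> nat \<Rightarrow> ('v, 'k::field) mpoly) \<Rightarrow> bool" where
  "graded_resolution \<G> V l gens \<longleftrightarrow>
     (\<forall>q. presents (res_gens \<G> q) V (res_module \<G> V l gens q) (l q) (gens q))"

text \<open>Shifting \<open>i\<close> times moves Koszul homology from degree \<open>i\<close> of
  the quotient ring to degree 0 of the \<open>i\<close>-th syzygy module, where it shows the degrees
  of generators. The right-hand side does not mention the resolution, which gives independence of
  the choice.\<close>

lemma graded_resolution_degrees:
  fixes gens :: "nat \<Rightarrow> nat \<Rightarrow> nat \<Rightarrow> ('v::linorder, 'k::field) mpoly"
  assumes V: "finite V" and res: "graded_resolution \<G> V l gens"
  shows "j \<in> set (l i) \<longleftrightarrow> \<not> hvan \<G> V (std_module \<G> V :: ('v::linorder, 'k::field) grmod) i j"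
proof -
  have pres: "presents (res_gens \<G> q) V (res_module \<G> V l gens q) (l q) (gens q)" for q
    using res by (simp add: graded_resolution_def)
  have "hvan \<G> V (std_module \<G> V :: ('v, 'k) grmod) (p + q) j \<longleftrightarrow>
      hvan (res_gens \<G> q) V (res_module \<G> V l gens q) p j" for p q
  proof (induction q arbitrary: p)
    case 0
    then show ?case by (simp add: res_gens_def)
  next
    case (Suc q)
    have "hvan \<G> V (std_module \<G> V :: ('v, 'k) grmod) (Suc p + q) j \<longleftrightarrow>
        hvan (res_gens \<G> q) V (res_module \<G> V l gens q) (Suc p) j" by (rule Suc)
    also have "\<dots> \<longleftrightarrow> hvan {} V (syzygies (res_gens \<G> q) V (l q) (gens q)) p j"
      by (rule hvan_shift[OF V pres])
    finally show ?case by (simp add: res_gens_def)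
  qed
  from this[of 0 i] show ?thesis using hvan_0_iff[OF V pres, of i j] by simp
qed

lemma graded_module_std: "graded_module \<G> V (std_module \<G> V)"
  unfolding graded_module_def
proof (intro conjI allI ballI)
  show "\<exists>l. (\<forall>e\<in>set l. 0 \<le> e) \<and> (\<forall>d. std_module \<G> V d \<subseteq> grfree V l d)"
    by (intro exI[of _ "[0]"]) (auto simp: std_module_def grfree_def)
  show "(\<lambda>i. nf \<G> (f * v i)) \<in> std_module \<G> V (a + d)"
    if "f \<in> hpoly V a" "v \<in> std_module \<G> V d" for a d f v
    using that hpoly_mult[of f V a "v 0" d] by (auto simp: std_module_def) (auto simp: nf_def)
  show "nf \<G> (v i) = v i" if "v \<in> std_module \<G> V d" for v d i
    using that by (cases i) (auto simp: std_module_def)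
qed (auto simp: std_module_def nf_def restr_add)

text \<open>Dependent choice that carries along vanishing beyond \<open>J\<close> in all homological
  degrees: a shift turns degree \<open>Suc p\<close> for one module into degree \<open>p\<close> for
  its syzygies, and degree 0 makes these finitely generated.\<close>

lemma exists_graded_resolution:
  assumes V: "finite V"
    and hv: "\<And>p j. j > int J \<Longrightarrow> hvan \<G> V (std_module \<G> V :: ('v::linorder, 'k::field) grmod) p j"
  shows "\<exists>l (gens :: nat \<Rightarrow> nat \<Rightarrow> nat \<Rightarrow> ('v, 'k) mpoly). graded_resolution \<G> V l gens \<and>
    (\<forall>q. \<forall>k<length (l q). gens q k \<in> res_module \<G> V l gens q (l q ! k))"
proof -
  let ?good = "\<lambda>q (M :: ('v, 'k) grmod). graded_module (res_gens \<G> q) V M \<and>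
    (\<forall>p. \<forall>j>int J. hvan (res_gens \<G> q) V M p j)"
  let ?P = "\<lambda>q (M, l, gens :: nat \<Rightarrow> nat \<Rightarrow> ('v, 'k) mpoly). ?good q M \<and>
    presents (res_gens \<G> q) V M l gens \<and> (\<forall>e\<in>set l. 0 \<le> e) \<and> (\<forall>k<length l. gens k \<in> M (l ! k)) \<and>
    (q = 0 \<longrightarrow> M = std_module \<G> V)"
  let ?Q = "\<lambda>q (M :: ('v, 'k) grmod, l, gens :: nat \<Rightarrow> nat \<Rightarrow> ('v, 'k) mpoly) (M', l', gens').
    M' = syzygies (res_gens \<G> q) V l gens"
  have pres: "\<exists>l gens. presents (res_gens \<G> q) V M l gens \<and> (\<forall>e\<in>set l. 0 \<le> e) \<and>
      (\<forall>k<length l. gens k \<in> M (l ! k))" if "?good q M" for q M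
    using that by (intro exists_presentation[OF V, where J = J]) auto
  have "\<exists>f. \<forall>q. ?P q (f q) \<and> ?Q q (f q) (f (Suc q))"
  proof (rule dependent_nat_choice)
    have "?good 0 (std_module \<G> V)" using graded_module_std hv by (simp add: res_gens_def)
    with pres[OF this] show "\<exists>x. ?P 0 x" by auto
  next
    fix x q assume "?P q x"
    moreover obtain M l and gens :: "nat \<Rightarrow> nat \<Rightarrow> ('v, 'k) mpoly" where x: "x = (M, l, gens)"
      by (cases x)
    ultimately have P: "?good q M" "presents (res_gens \<G> q) V M l gens" "\<forall>e\<in>set l. 0 \<le> e" by auto
    define M' where "M' = syzygies (res_gens \<G> q) V l gens"
    have "hvan (res_gens \<G> (Suc q)) V M' p j" if "j > int J" for p j
    proof -
      have "hvan (res_gens \<G> q) V M (Suc p) j" using P(1) that by blast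
      then show ?thesis unfolding hvan_shift[OF V P(2)] by (simp add: M'_def res_gens_def)
    qed
    moreover have "graded_module (res_gens \<G> (Suc q)) V M'"
      by (simp add: M'_def res_gens_def graded_module_syzygies[OF P(3)])
    ultimately have "?good (Suc q) M'" by blast
    with pres[OF this] show "\<exists>y. ?P (Suc q) y \<and> ?Q q x y" by (auto simp: x M'_def)
  qed
  then obtain f where "\<forall>q. ?P q (f q) \<and> ?Q q (f q) (f (Suc q))" ..
  then have f: "?P q (f q)" "?Q q (f q) (f (Suc q))" for q by simp_all
  define l where "l q = fst (snd (f q))" for q
  define gens where "gens q = snd (snd (f q))" for q
  have M: "fst (f q) = res_module \<G> V l gens q" for q
    using f(1)[of q] f(2)[of "q - 1"]
    by (cases q) (auto simp: l_def gens_def res_gens_def split: prod.splits)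
  have "presents (res_gens \<G> q) V (fst (f q)) (l q) (gens q) \<and>
      (\<forall>k<length (l q). gens q k \<in> fst (f q) (l q ! k))" for q
    using f(1)[of q] by (auto simp: l_def gens_def split: prod.splits)
  then show ?thesis unfolding graded_resolution_def M by blast
qed

section \<open>Resolutions in coordinates\<close>

lemma std_module_component:
  assumes "F \<in> tens V (std_module \<G> V) p j"
  shows "(\<lambda>S. F S 0) \<in> koszul_chains \<G> V p j" "i > 0 \<Longrightarrow> F S i = 0"
proof -
  have *: "if S \<subseteq> V \<and> card S = p then F S \<in> std_module \<G> V (j - int p) else F S = 0" for S
    using assms unfolding tens_def mem_Collect_eq by (rule spec)
  show "(\<lambda>S. F S 0) \<in> koszul_chains \<G> V p j"
    unfolding koszul_chains_def mem_Collect_eq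
  proof
    fix S
    show "if S \<subseteq> V \<and> card S = p then F S 0 \<in> hpoly V (j - int p) \<and> nf \<G> (F S 0) = F S 0 else F S 0 = 0"
      using *[of S] by (cases "S \<subseteq> V \<and> card S = p") (auto simp: std_module_def)
  qed
  show "F S i = 0" if "i > 0"
    using *[of S] that by (cases "S \<subseteq> V \<and> card S = p") (auto simp: std_module_def)
qed

lemma tens_std_moduleI:
  assumes "f \<in> koszul_chains \<G> V p j"
  shows "(\<lambda>S i. if i = 0 then f S else 0) \<in> tens V (std_module \<G> V) p j"
proof (rule tensI)
  fix S assume "S \<subseteq> V" "card S = p"
  then show "(\<lambda>i. if i = 0 then f S else 0) \<in> std_module \<G> V (j - int p)"
    using assms by (simp add: koszul_chains_def std_module_def)
next
  fix S assume "\<not> (S \<subseteq> V \<and> card S = p)"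
  then show "(\<lambda>i. if i = 0 then f S else 0) = 0" using koszul_chains_0[OF assms] by (intro ext) simp
qed

lemma hvan_std_module_iff:
  "hvan \<G> V (std_module \<G> V :: ('v::linorder, 'k::field) grmod) p j \<longleftrightarrow>
    koszul_acyclic TYPE('k) \<G> V p j"
proof
  assume hv: "hvan \<G> V (std_module \<G> V :: ('v, 'k) grmod) p j"
  show "koszul_acyclic TYPE('k) \<G> V p j"
    unfolding koszul_acyclic_def
  proof (intro allI impI)
    fix f :: "'v set \<Rightarrow> ('v, 'k) mpoly"
    assume f: "f \<in> koszul_chains \<G> V p j" and cyc: "koszul \<G> V f = 0"
    define F where "F = (\<lambda>S (i::nat). if i = 0 then f S else 0)"
    have "mkoszul \<G> V F = 0"
    proof (intro ext)
      fix S i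
      show "mkoszul \<G> V F S i = 0 S i"
        using fun_cong[OF cyc, of S]
        by (cases "i = 0") (simp_all add: mkoszul_def F_def, simp add: koszul_def)
    qed
    then obtain G where G: "G \<in> tens V (std_module \<G> V) (Suc p) j" "F = mkoszul \<G> V G"
      using hv tens_std_moduleI[OF f] unfolding hvan_def F_def by blast
    have "f S = koszul \<G> V (\<lambda>S. G S 0) S" for S
      using fun_cong[OF fun_cong[OF G(2), of S], of 0] by (simp add: F_def mkoszul_def)
    then show "\<exists>g\<in>koszul_chains \<G> V (Suc p) j. f = koszul \<G> V g"
      using std_module_component(1)[OF G(1)] by (intro bexI[of _ "\<lambda>S. G S 0"] ext)
  qed
next
  assume ac: "koszul_acyclic TYPE('k) \<G> V p j"
  show "hvan \<G> V (std_module \<G> V :: ('v, 'k) grmod) p j"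
    unfolding hvan_def
  proof (intro ballI impI)
    fix F :: "'v set \<Rightarrow> nat \<Rightarrow> ('v, 'k) mpoly"
    assume F: "F \<in> tens V (std_module \<G> V) p j" and cyc: "mkoszul \<G> V F = 0"
    have "koszul \<G> V (\<lambda>S. F S 0) = 0"
      using fun_cong[OF fun_cong[OF cyc]] by (intro ext) (simp add: mkoszul_def)
    then obtain g where g: "g \<in> koszul_chains \<G> V (Suc p) j" "(\<lambda>S. F S 0) = koszul \<G> V g"
      using ac std_module_component(1)[OF F] unfolding koszul_acyclic_def by blast
    define G where "G = (\<lambda>S (i::nat). if i = 0 then g S else 0)"
    have "F S i = mkoszul \<G> V G S i" for S i
    proof (cases "i = 0")
      case True
      then show ?thesis using fun_cong[OF g(2), of S] by (simp add: mkoszul_def G_def)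
    next
      case False
      then show ?thesis using std_module_component(2)[OF F] by (simp add: mkoszul_def G_def koszul_def)
    qed
    then show "\<exists>G\<in>tens V (std_module \<G> V) (Suc p) j. F = mkoszul \<G> V G"
      using tens_std_moduleI[OF g(1)] by (intro bexI[of _ G] ext) (auto simp: G_def)
  qed
qed

text \<open>Internal degree \<open>j\<close> involves only squarefree multidegrees, that is subsets
  of cardinality \<open>j\<close>. Faces are complements of exterior indices, hence the cardinality
  \<open>card \<sigma> - p\<close>.\<close>

lemma hochster:
  assumes V: "finite V"
  shows "hvan \<G> V (std_module \<G> V :: ('v::linorder, 'k::field) grmod) p j \<longleftrightarrow>
    (\<forall>\<sigma>\<subseteq>V. int (card \<sigma>) = j \<longrightarrow> p \<le> card \<sigma> \<longrightarrow> vanishing TYPE('k) (card \<sigma> - p) (cpx \<sigma> \<G>))"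
  unfolding hvan_std_module_iff using koszul_acyclicI[OF V] koszul_acyclicD[OF V] by metis

lemma hcomp_restr: "hcomp d (restr Q f) = restr Q (hcomp d f)"
  by (rule poly_mapping_eqI) (simp add: hcomp_def)

lemma hcomp_0 [simp]: "hcomp d 0 = 0"
  by (simp add: hcomp_def)

lemma hcomp_sum: "hcomp d (sum f A) = (\<Sum>x\<in>A. hcomp d (f x))"
  by (simp add: hcomp_def restr_sum)

text \<open>The shift \<open>\<delta>\<close> will be the degree of a basis element, so that all
  coordinates of a vector are decomposed along one set of total degrees.\<close>

lemma sum_hcomp_shift:
  assumes "finite X" "\<And>m. m \<in> keysp f \<Longrightarrow> int (mono_deg m) + \<delta> \<in> X"
  shows "(\<Sum>d\<in>X. hcomp (d - \<delta>) f) = f"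
proof (rule poly_mapping_eqI)
  fix m
  have "coef (\<Sum>d\<in>X. hcomp (d - \<delta>) f) m = (\<Sum>d\<in>X. if d = int (mono_deg m) + \<delta> then coef f m else 0)"
    unfolding lookup_sum hcomp_def by (intro sum.cong) auto
  also have "\<dots> = coef f m" using assms by (auto simp: in_keys_iff)
  finally show "coef (\<Sum>d\<in>X. hcomp (d - \<delta>) f) m = coef f m" .
qed

text \<open>A matrix with homogeneous entries respects total degree, so components may be taken
  before or after applying it.\<close>

lemma hcomp_pmap:
  assumes "\<And>k. k < length l \<Longrightarrow> gens k \<in> grfree V A (l ! k)" "i < length A"
  shows "pmap \<G> (length l) gens (\<lambda>k. hcomp (d - l ! k) (w k)) i =
    hcomp (d - A ! i) (pmap \<G> (length l) gens w i)"
proof -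
  have "hcomp (d - l ! k) (w k) * gens k i = hcomp (d - A ! i) (w k * gens k i)"
    if "k < length l" for k
  proof -
    have "homogeneous (l ! k - A ! i) (gens k i)"
      using grfreeD(1)[OF assms(1)[OF that] assms(2)] by (simp add: hpoly_def)
    from hcomp_mult[OF this, of "d - A ! i" "w k"] show ?thesis by (simp add: mult.commute)
  qed
  then show ?thesis by (simp add: pmap_def nf_def hcomp_restr hcomp_sum)
qed

lemma pmap_beyond:
  assumes "\<And>k. k < length l \<Longrightarrow> gens k \<in> grfree V A (l ! k)" "\<not> i < length A"
  shows "pmap \<G> (length l) gens w i = 0"
  using grfreeD(2)[OF assms(1) assms(2)] by (simp add: pmap_def)

lemma pmap_unit:
  assumes "k < L"
  shows "pmap \<G> L g (\<lambda>k'. if k' = k then 1 else 0) = (\<lambda>i. nf \<G> (g k i))"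
proof
  fix i
  have "(\<Sum>k'<L. (if k' = k then 1 else 0) * g k' i) = (\<Sum>k'<L. if k' = k then g k i else 0)"
    by (intro sum.cong) auto
  then show "pmap \<G> L g (\<lambda>k'. if k' = k then 1 else 0) i = nf \<G> (g k i)"
    using assms by (simp add: pmap_def)
qed

text \<open>A chain of generators in coordinates: \<open>gens q k\<close> is an element of the free module with basis
  degrees \<open>ambient l q\<close>. For \<open>q = 0\<close> it is the polynomial representing a generator of the quotient
  ring.\<close>

definition ambient :: "(nat \<Rightarrow> int list) \<Rightarrow> nat \<Rightarrow> int list" where
  "ambient l q = (case q of 0 \<Rightarrow> [0] | Suc q' \<Rightarrow> l q')"

lemma ambient_simps [simp]: "ambient l 0 = [0]" "ambient l (Suc q) = l q"
  by (simp_all add: ambient_def)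

definition vec_fun :: "('v, 'k::field) mpoly vec \<Rightarrow> nat \<Rightarrow> ('v, 'k) mpoly" where
  "vec_fun v k = (if k < dim_vec v then v $ k else 0)"

text \<open>Dictionary between vectors and matrices and the coordinate functions used so far. It
  serves both to construct a resolution and to analyse a given one.\<close>

locale resolution_coordinates =
  fixes V :: "'v::linorder set" and \<G> :: "'v set set" and l :: "nat \<Rightarrow> int list"
    and gens :: "nat \<Rightarrow> nat \<Rightarrow> nat \<Rightarrow> ('v, 'k::field) mpoly"
    and e :: "('v, 'k) mpoly vec" and D :: "nat \<Rightarrow> ('v, 'k) mpoly mat"
  assumes V: "finite V" and G: "\<And>A. A \<in> \<G> \<Longrightarrow> A \<subseteq> V"
    and gens: "\<And>q k. k < length (l q) \<Longrightarrow> gens q k \<in> grfree V (ambient l q) (l q ! k)"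
    and e_carrier: "e \<in> carrier_vec (length (l 0))"
    and e_gens: "\<And>k. k < length (l 0) \<Longrightarrow> e $ k = gens 0 k 0"
    and D_carrier: "\<And>q. D q \<in> carrier_mat (length (l q)) (length (l (Suc q)))"
    and D_gens: "\<And>q i k. i < length (l q) \<Longrightarrow> k < length (l (Suc q)) \<Longrightarrow>
      D q $$ (i, k) = gens (Suc q) k i"
begin

abbreviation I where "I \<equiv> ideal_gen V {\<Prod>x\<in>A. Var x | A. A \<in> \<G>} :: ('v, 'k) mpoly set"

abbreviation pm where "pm q w \<equiv> pmap (res_gens \<G> q) (length (l q)) (gens q) w"

abbreviation syz where "syz q \<equiv> syzygies (res_gens \<G> q) V (l q) (gens q)"

lemma I_iff: "f \<in> I \<longleftrightarrow> f \<in> poly_ring V \<and> nf \<G> f = 0"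
  by (rule monomial_ideal_iff) (rule conjI[OF finite_subset[OF G V] G])

lemma gens_poly: "k < length (l q) \<Longrightarrow> gens q k i \<in> poly_ring V"
  using grfreeD[OF gens, of k q i] by (cases "i < length (ambient l q)") (auto dest: hpoly_poly_ring)

lemma pm_beyond: "\<not> i < length (ambient l q) \<Longrightarrow> pm q w i = 0"
  by (rule pmap_beyond[OF gens])

lemma vec_fun_eq_0_iff: "dim_vec v = n \<Longrightarrow> v = 0\<^sub>v n \<longleftrightarrow> vec_fun v = 0"
proof
  assume dim: "dim_vec v = n" and "vec_fun v = 0"
  then have "vec_fun v k = 0" for k by simp
  then show "v = 0\<^sub>v n" using dim by (intro eq_vecI) (simp_all add: vec_fun_def, metis)
qed (auto simp: vec_fun_def fun_eq_iff)

lemma vec_fun_inj: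
  assumes "dim_vec v = dim_vec w" "vec_fun v = vec_fun w"
  shows "v = w"
proof (rule eq_vecI)
  fix i assume "i < dim_vec w"
  then show "v $ i = w $ i" using fun_cong[OF assms(2), of i] assms(1) by (simp add: vec_fun_def)
qed (rule assms(1))

lemma free_module_iff:
  "v \<in> free_module V n \<longleftrightarrow> dim_vec v = n \<and> (\<forall>k. vec_fun v k \<in> poly_ring V)"
proof
  assume v: "v \<in> free_module V n"
  then have "dim_vec v = n" "v $ k \<in> poly_ring V" if "k < n" for k
    using that by (simp_all add: free_module_def)
  moreover have "dim_vec v = n" using v by (simp add: free_module_def)
  ultimately show "dim_vec v = n \<and> (\<forall>k. vec_fun v k \<in> poly_ring V)"
    unfolding vec_fun_def by simp
next
  assume v: "dim_vec v = n \<and> (\<forall>k. vec_fun v k \<in> poly_ring V)"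
  have "v $ k \<in> poly_ring V" if "k < n" for k
    using conjunct2[OF v, THEN spec, of k] that v by (simp add: vec_fun_def)
  moreover have "v \<in> carrier_vec n" by (rule carrier_vecI) (rule conjunct1[OF v])
  ultimately show "v \<in> free_module V n" unfolding free_module_def by blast
qed

lemma vec_fun_free:
  assumes "v \<in> free_module V n"
  shows "vec_fun v k \<in> poly_ring V" "n \<le> k \<Longrightarrow> vec_fun v k = 0"
proof -
  show "vec_fun v k \<in> poly_ring V" using assms by (simp add: free_module_iff)
  show "vec_fun v k = 0" if "n \<le> k"
    using assms that unfolding free_module_iff vec_fun_def by auto
qed

lemma aug_in_I_iff:
  assumes v: "v \<in> free_module V (length (l 0))"
  shows "e \<bullet> v \<in> I \<longleftrightarrow> pm 0 (vec_fun v) = 0"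
    and "nf \<G> (e \<bullet> v) = pm 0 (vec_fun v) 0"
    and "e \<bullet> v \<in> poly_ring V"
proof -
  have ev: "e \<bullet> v = (\<Sum>k<length (l 0). vec_fun v k * gens 0 k 0)"
    using v by (auto simp: free_module_iff scalar_prod_def vec_fun_def e_gens atLeast0LessThan
        mult.commute intro!: sum.cong)
  show nf: "nf \<G> (e \<bullet> v) = pm 0 (vec_fun v) 0" by (simp add: ev pmap_def res_gens_def)
  show ring: "e \<bullet> v \<in> poly_ring V"
    unfolding ev using v gens_poly by (intro poly_ring_sum poly_ring_mult) (auto simp: free_module_iff)
  have "pm 0 (vec_fun v) i = 0" if "i \<noteq> 0" for i
    using pm_beyond[of i 0] that by simp
  then have "pm 0 (vec_fun v) = 0" if "pm 0 (vec_fun v) 0 = 0"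
    using that by (intro ext) (metis zero_fun_apply)
  then have "pm 0 (vec_fun v) = 0 \<longleftrightarrow> pm 0 (vec_fun v) 0 = 0" by auto
  then show "e \<bullet> v \<in> I \<longleftrightarrow> pm 0 (vec_fun v) = 0" using ring nf by (simp add: I_iff)
qed

lemma D_mult:
  assumes v: "v \<in> free_module V (length (l (Suc q)))"
  shows "vec_fun (D q *\<^sub>v v) = pm (Suc q) (vec_fun v)"
    and "D q *\<^sub>v v = 0\<^sub>v (length (l q)) \<longleftrightarrow> pm (Suc q) (vec_fun v) = 0"
    and "D q *\<^sub>v v \<in> free_module V (length (l q))"
proof -
  have dim: "dim_vec (D q *\<^sub>v v) = length (l q)" using D_carrier[of q] by simp
  have entry: "(D q *\<^sub>v v) $ i = (\<Sum>k<length (l (Suc q)). vec_fun v k * gens (Suc q) k i)"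
    if "i < length (l q)" for i
    using v that D_carrier[of q]
    by (auto simp: free_module_iff scalar_prod_def vec_fun_def D_gens atLeast0LessThan
        mult.commute intro!: sum.cong)
  show eq: "vec_fun (D q *\<^sub>v v) = pm (Suc q) (vec_fun v)"
  proof
    fix i
    show "vec_fun (D q *\<^sub>v v) i = pm (Suc q) (vec_fun v) i"
    proof (cases "i < length (l q)")
      case True
      then show ?thesis using dim entry by (simp add: vec_fun_def[of "D q *\<^sub>v v"] pmap_def res_gens_def)
    next
      case False
      then show ?thesis
        using pm_beyond[of i "Suc q"] unfolding vec_fun_def[of "D q *\<^sub>v v"] dim by simp
    qed
  qed
  have "D q *\<^sub>v v = 0\<^sub>v (length (l q)) \<longleftrightarrow> vec_fun (D q *\<^sub>v v) = 0"
    using dim by (rule vec_fun_eq_0_iff)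
  then show "D q *\<^sub>v v = 0\<^sub>v (length (l q)) \<longleftrightarrow> pm (Suc q) (vec_fun v) = 0" by (simp add: eq)
  show "D q *\<^sub>v v \<in> free_module V (length (l q))"
  proof -
    have "pm (Suc q) (vec_fun v) k \<in> poly_ring V" for k
      unfolding pmap_def nf_def
      by (intro poly_ring_restr poly_ring_sum poly_ring_mult vec_fun_free(1)[OF v] gens_poly) simp
    then show ?thesis unfolding free_module_iff eq using dim by simp
  qed
qed

lemma fun_of_free:
  assumes "\<And>k. w k \<in> poly_ring V" "\<And>k. n \<le> k \<Longrightarrow> w k = 0"
  shows "vec n w \<in> free_module V n" "vec_fun (vec n w) = w"
proof -
  show "vec_fun (vec n w) = w" using assms(2) by (auto simp: vec_fun_def fun_eq_iff)
  then show "vec n w \<in> free_module V n" using assms(1) by (simp add: free_module_iff)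
qed

lemma grfree_poly: "w \<in> grfree V A d \<Longrightarrow> w k \<in> poly_ring V"
  using grfreeD[of w V A d k] by (cases "k < length A") (auto dest: hpoly_poly_ring)

lemma hcomp_grfree:
  assumes "\<And>k. w k \<in> poly_ring V" "\<And>k. length A \<le> k \<Longrightarrow> w k = 0"
  shows "(\<lambda>k. hcomp (d - (if k < length A then A ! k else 0)) (w k)) \<in> grfree V A d"
  using assms by (intro grfreeI) auto

definition kernel_vecs :: "nat \<Rightarrow> ('v, 'k) mpoly vec set" where
  "kernel_vecs q = {v \<in> free_module V (length (l q)). pm q (vec_fun v) = 0}"

lemma kernel_vecs_0: "kernel_vecs 0 = {v \<in> free_module V (length (l 0)). e \<bullet> v \<in> I}"
  using aug_in_I_iff(1) by (auto simp: kernel_vecs_def)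

lemma kernel_vecs_Suc: "kernel_vecs (Suc q) =
    {v \<in> free_module V (length (l (Suc q))). D q *\<^sub>v v = 0\<^sub>v (length (l q))}"
  using D_mult(2) by (auto simp: kernel_vecs_def)

lemma pm_hcomp_grfree:
  assumes "\<And>k. k < length (l q) \<Longrightarrow> w' k = hcomp (d - l q ! k) (w k)"
  shows "i < length (ambient l q) \<Longrightarrow> pm q w' i = hcomp (d - ambient l q ! i) (pm q w i)"
    and "\<not> i < length (ambient l q) \<Longrightarrow> pm q w' i = 0"
proof -
  have "pm q w' i = pm q (\<lambda>k. hcomp (d - l q ! k) (w k)) i"
    using assms by (simp add: pmap_def)
  then show "i < length (ambient l q) \<Longrightarrow> pm q w' i = hcomp (d - ambient l q ! i) (pm q w i)"
    using hcomp_pmap[OF gens] by simp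
  show "\<not> i < length (ambient l q) \<Longrightarrow> pm q w' i = 0"
    by (rule pm_beyond)
qed

text \<open>Exactness on all vectors is compared with exactness on homogeneous pieces. A preimage of
  a homogeneous vector may be replaced by its component of the right degree; conversely a kernel
  vector is a finite sum of homogeneous ones, each again in the kernel.\<close>

lemma kernel_image_iff:
  "kernel_vecs q = (\<lambda>w. D q *\<^sub>v w) ` free_module V (length (l (Suc q))) \<longleftrightarrow>
    (\<forall>d. syz q d = pm (Suc q) ` grfree V (l (Suc q)) d)"
proof
  assume ker: "kernel_vecs q = (\<lambda>w. D q *\<^sub>v w) ` free_module V (length (l (Suc q)))"
  show "\<forall>d. syz q d = pm (Suc q) ` grfree V (l (Suc q)) d"
  proof (intro allI equalityI subsetI)
    fix d w assume w: "w \<in> syz q d"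
    have wf: "w \<in> grfree V (l q) d" and w0: "pm q w = 0" using w by (auto simp: syzygies_def)
    note wv = fun_of_free[of w "length (l q)", OF grfree_poly[OF wf]]
    have beyond: "\<And>k. length (l q) \<le> k \<Longrightarrow> w k = 0" using grfreeD(2)[OF wf] by simp
    have "vec (length (l q)) w \<in> kernel_vecs q"
      using wv[OF beyond] w0 by (simp add: kernel_vecs_def)
    then obtain u where u: "u \<in> free_module V (length (l (Suc q)))" "vec (length (l q)) w = D q *\<^sub>v u"
      unfolding ker by blast
    have w_eq: "w = pm (Suc q) (vec_fun u)"
      using D_mult(1)[OF u(1)] wv(2)[OF beyond] u(2) by simp
    define u' where "u' k = hcomp (d - (if k < length (l (Suc q)) then l (Suc q) ! k else 0)) (vec_fun u k)" for k
    have "u' \<in> grfree V (l (Suc q)) d"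
      unfolding u'_def by (intro hcomp_grfree vec_fun_free[OF u(1)])
    moreover have "w i = pm (Suc q) u' i" for i
    proof (cases "i < length (l q)")
      case True
      have "pm (Suc q) u' i = hcomp (d - l q ! i) (pm (Suc q) (vec_fun u) i)"
        using pm_hcomp_grfree(1)[of "Suc q" u' d "vec_fun u" i] True by (simp add: u'_def)
      also have "\<dots> = w i"
        using hcomp_id[OF grfreeD(1)[OF wf True]] by (simp flip: w_eq)
      finally show ?thesis by simp
    next
      case False
      then show ?thesis
        using pm_hcomp_grfree(2)[of "Suc q" u' d "vec_fun u" i] beyond by (simp add: u'_def)
    qed
    ultimately show "w \<in> pm (Suc q) ` grfree V (l (Suc q)) d" by blast
  next
    fix d w assume "w \<in> pm (Suc q) ` grfree V (l (Suc q)) d"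
    then obtain u where u: "u \<in> grfree V (l (Suc q)) d" "w = pm (Suc q) u" by blast
    have beyond: "\<And>k. length (l (Suc q)) \<le> k \<Longrightarrow> u k = 0" using grfreeD(2)[OF u(1)] by simp
    note uv = fun_of_free[of u "length (l (Suc q))", OF grfree_poly[OF u(1)] beyond]
    have "D q *\<^sub>v vec (length (l (Suc q))) u \<in> kernel_vecs q" unfolding ker using uv(1) by blast
    then have "pm q w = 0"
      using D_mult(1)[OF uv(1)] uv(2) u(2) by (simp add: kernel_vecs_def)
    moreover have "w \<in> grfree V (l q) d"
    proof (rule grfreeI)
      fix i assume i: "i < length (l q)"
      have "u k * gens (Suc q) k i \<in> hpoly V (d - l q ! i)" if "k < length (l (Suc q))" for k
      proof -
        have "u k * gens (Suc q) k i \<in> hpoly V ((d - l (Suc q) ! k) + (l (Suc q) ! k - l q ! i))"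
          using grfreeD(1)[OF u(1) that] grfreeD(1)[OF gens[OF that], of i] i
          by (intro hpoly_mult) auto
        then show ?thesis by simp
      qed
      then show "w i \<in> hpoly V (d - l q ! i)"
        unfolding u(2) pmap_def nf_def by (intro hpoly_restr hpoly_sum) simp
    next
      fix i assume "length (l q) \<le> i"
      then show "w i = 0"
        unfolding u(2) using pm_beyond[of i "Suc q"] by simp
    qed
    ultimately show "w \<in> syz q d" by (simp add: syzygies_def)
  qed
next
  assume ex: "\<forall>d. syz q d = pm (Suc q) ` grfree V (l (Suc q)) d"
  show "kernel_vecs q = (\<lambda>w. D q *\<^sub>v w) ` free_module V (length (l (Suc q)))"
  proof (intro equalityI subsetI)
    fix v assume v: "v \<in> kernel_vecs q"
    have vf: "\<And>k. vec_fun v k \<in> poly_ring V" "dim_vec v = length (l q)" and v0: "pm q (vec_fun v) = 0"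
      using v by (auto simp: kernel_vecs_def free_module_iff)
    \<comment> \<open>All total degrees occurring in \<open>v\<close>, with the degrees of the basis
      elements included.\<close>
    define X where "X = (\<Union>k<length (l q). (\<lambda>m. int (mono_deg m) + l q ! k) ` keysp (vec_fun v k))"
    have finX: "finite X" by (simp add: X_def)
    define vd where "vd d k = hcomp (d - (if k < length (l q) then l q ! k else 0)) (vec_fun v k)" for d k
    have vd_sum: "(\<Sum>d\<in>X. vd d k) = vec_fun v k" for k
    proof (cases "k < length (l q)")
      case True
      have "(\<Sum>d\<in>X. hcomp (d - l q ! k) (vec_fun v k)) = vec_fun v k"
        by (rule sum_hcomp_shift[OF finX]) (use True in \<open>auto simp: X_def\<close>)
      then show ?thesis using True by (simp add: vd_def)
    qed (simp add: vd_def vec_fun_def vf(2))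
    have "vd d \<in> syz q d" for d
    proof -
      have "vd d \<in> grfree V (l q) d"
        unfolding vd_def using vf by (intro hcomp_grfree) (auto simp: vec_fun_def)
      moreover have "pm q (vd d) i = 0" for i
        using pm_hcomp_grfree[of q "vd d" d "vec_fun v" i] v0
        by (cases "i < length (ambient l q)") (auto simp: vd_def)
      then have "pm q (vd d) = 0" by (intro ext) simp
      ultimately show ?thesis by (simp add: syzygies_def)
    qed
    then have "vd d \<in> pm (Suc q) ` grfree V (l (Suc q)) d" for d using ex by simp
    then have "\<exists>u\<in>grfree V (l (Suc q)) d. vd d = pm (Suc q) u" for d unfolding image_iff .
    then obtain u where u: "\<And>d. u d \<in> grfree V (l (Suc q)) d" "\<And>d. vd d = pm (Suc q) (u d)"
      by metis
    define w where "w k = (\<Sum>d\<in>X. u d k)" for k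
    have w: "vec (length (l (Suc q))) w \<in> free_module V (length (l (Suc q)))"
      "vec_fun (vec (length (l (Suc q))) w) = w"
      using grfree_poly[OF u(1)] grfreeD(2)[OF u(1)]
      by (intro fun_of_free, auto simp: w_def)+
    have "pm (Suc q) w i = vec_fun v i" for i
    proof -
      have "pm (Suc q) w i = (\<Sum>d\<in>X. pm (Suc q) (u d) i)"
        by (simp add: pmap_def res_gens_def w_def sum_distrib_right) (rule sum.swap)
      then show ?thesis using vd_sum[of i] by (simp flip: u(2))
    qed
    then have "vec_fun v = vec_fun (D q *\<^sub>v vec (length (l (Suc q))) w)"
      using D_mult(1)[OF w(1)] w(2) by auto
    moreover have "dim_vec (D q *\<^sub>v vec (length (l (Suc q))) w) = length (l q)"
      using D_carrier[of q] by simp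
    ultimately have "v = D q *\<^sub>v vec (length (l (Suc q))) w"
      using vf(2) by (intro vec_fun_inj) simp_all
    then show "v \<in> (\<lambda>w. D q *\<^sub>v w) ` free_module V (length (l (Suc q)))" using w(1) by blast
  next
    fix v assume "v \<in> (\<lambda>w. D q *\<^sub>v w) ` free_module V (length (l (Suc q)))"
    then obtain u where u: "u \<in> free_module V (length (l (Suc q)))" "v = D q *\<^sub>v u" by blast
    \<comment> \<open>That \<open>D q\<close> maps into the kernel is tested on basis vectors, whose
      images are these generators.\<close>
    have gens0: "pm q (gens (Suc q) k) = 0" if "k < length (l (Suc q))" for k
    proof -
      define \<delta> where "\<delta> = (\<lambda>k'. if k' = k then 1 else 0 :: ('v, 'k) mpoly)"
      have "\<delta> \<in> grfree V (l (Suc q)) (l (Suc q) ! k)"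
        using that by (intro grfreeI) (auto simp: \<delta>_def)
      moreover have "pm (Suc q) \<delta> = gens (Suc q) k"
        unfolding \<delta>_def using pmap_unit[OF that, of _ "gens (Suc q)"] by (simp add: res_gens_def)
      ultimately have "gens (Suc q) k \<in> syz q (l (Suc q) ! k)" using ex by (metis imageI)
      then show ?thesis by (simp add: syzygies_def)
    qed
    have "pm q (vec_fun v) i = 0" for i
    proof -
      have "pm q (vec_fun v) i = nf (res_gens \<G> q) (\<Sum>k'<length (l (Suc q)). vec_fun u k' *
          (\<Sum>k<length (l q). gens (Suc q) k' k * gens q k i))"
      proof -
        have "(\<Sum>k<length (l q). (\<Sum>k'<length (l (Suc q)). vec_fun u k' * gens (Suc q) k' k) * gens q k i) =
          (\<Sum>k'<length (l (Suc q)). vec_fun u k' * (\<Sum>k<length (l q). gens (Suc q) k' k * gens q k i))"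
          unfolding sum_distrib_left sum_distrib_right by (subst sum.swap) (simp add: mult.assoc)
        moreover have "res_gens \<G> (Suc q) = {}" by (simp add: res_gens_def)
        ultimately show ?thesis unfolding u(2) D_mult(1)[OF u(1)] pmap_def by simp
      qed
      also have "\<dots> = nf (res_gens \<G> q) (\<Sum>k'<length (l (Suc q)). vec_fun u k' * pm q (gens (Suc q) k') i)"
        unfolding pmap_def by (rule nf_sum_mult[symmetric])
      also have "\<dots> = 0" by (simp add: gens0)
      finally show ?thesis .
    qed
    then have "pm q (vec_fun v) = 0" by (intro ext) simp
    then show "v \<in> kernel_vecs q" using D_mult(3)[OF u(1)] u(2) by (simp add: kernel_vecs_def)
  qed
qed

lemma aug_surjective_iff:
  "(\<forall>f\<in>poly_ring V. \<exists>v\<in>free_module V (length (l 0)). f - e \<bullet> v \<in> I) \<longleftrightarrow>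
    (\<forall>d. std_module \<G> V d = pm 0 ` grfree V (l 0) d)"
proof
  assume surj: "\<forall>f\<in>poly_ring V. \<exists>v\<in>free_module V (length (l 0)). f - e \<bullet> v \<in> I"
  show "\<forall>d. std_module \<G> V d = pm 0 ` grfree V (l 0) d"
  proof (intro allI equalityI subsetI)
    fix d and f :: "nat \<Rightarrow> ('v, 'k) mpoly" assume f: "f \<in> std_module \<G> V d"
    then have f0: "f 0 \<in> hpoly V d" "nf \<G> (f 0) = f 0" "\<And>i. i > 0 \<Longrightarrow> f i = 0"
      by (auto simp: std_module_def)
    then obtain v where v: "v \<in> free_module V (length (l 0))" "f 0 - e \<bullet> v \<in> I"
      using surj hpoly_poly_ring by blast
    have "f 0 = pm 0 (vec_fun v) 0"
      using v(2) aug_in_I_iff(2)[OF v(1)] f0(2) by (simp add: I_iff nf_def restr_diff)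
    define u where "u k = hcomp (d - (if k < length (l 0) then l 0 ! k else 0)) (vec_fun v k)" for k
    have "u \<in> grfree V (l 0) d"
      unfolding u_def by (intro hcomp_grfree vec_fun_free[OF v(1)])
    moreover have "f i = pm 0 u i" for i
      using pm_hcomp_grfree[of 0 u d "vec_fun v" i] f0(3)[of i] hcomp_id[OF f0(1)]
        \<open>f 0 = pm 0 (vec_fun v) 0\<close>
      by (cases "i = 0") (auto simp: u_def)
    ultimately show "f \<in> pm 0 ` grfree V (l 0) d" by blast
  next
    fix d f assume "f \<in> pm 0 ` grfree V (l 0) d"
    then obtain u where u: "u \<in> grfree V (l 0) d" "f = pm 0 u" by blast
    have "u k * gens 0 k 0 \<in> hpoly V d" if "k < length (l 0)" for k
    proof -
      have "u k * gens 0 k 0 \<in> hpoly V ((d - l 0 ! k) + (l 0 ! k - 0))"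
        using grfreeD(1)[OF u(1) that] grfreeD(1)[OF gens[OF that], of 0]
        by (intro hpoly_mult) auto
      then show ?thesis by simp
    qed
    then have "f 0 \<in> hpoly V d" "nf \<G> (f 0) = f 0"
      unfolding u(2) pmap_def by (auto simp: res_gens_def) (auto simp: nf_def intro!: hpoly_restr hpoly_sum)
    moreover have "f i = 0" if "i > 0" for i
      unfolding u(2) using pm_beyond[of i 0] that by simp
    ultimately show "f \<in> std_module \<G> V d" by (simp add: std_module_def)
  qed
next
  assume ex: "\<forall>d. std_module \<G> V d = pm 0 ` grfree V (l 0) d"
  show "\<forall>f\<in>poly_ring V. \<exists>v\<in>free_module V (length (l 0)). f - e \<bullet> v \<in> I"
  proof
    fix f :: "('v, 'k) mpoly" assume f: "f \<in> poly_ring V"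
    define X where "X = (\<lambda>m. int (mono_deg m)) ` keysp f"
    have f_sum: "(\<Sum>d\<in>X. hcomp d f) = f"
      using sum_hcomp_shift[of X f 0] by (auto simp: X_def)
    have "(\<lambda>i. if i = 0 then nf \<G> (hcomp d f) else 0) \<in> std_module \<G> V d" for d
      using f by (auto simp: std_module_def) (auto simp: nf_def)
    then have "(\<lambda>i. if i = 0 then nf \<G> (hcomp d f) else 0) \<in> pm 0 ` grfree V (l 0) d" for d
      using ex by simp
    then have "\<exists>u\<in>grfree V (l 0) d. (\<lambda>i. if i = 0 then nf \<G> (hcomp d f) else 0) = pm 0 u" for d
      unfolding image_iff .
    then obtain u where u: "\<And>d. u d \<in> grfree V (l 0) d"
      and u_eq: "\<And>d. (\<lambda>i. if i = 0 then nf \<G> (hcomp d f) else 0) = pm 0 (u d)" by metis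
    define w where "w k = (\<Sum>d\<in>X. u d k)" for k
    have w: "vec (length (l 0)) w \<in> free_module V (length (l 0))" "vec_fun (vec (length (l 0)) w) = w"
      using grfree_poly[OF u(1)] grfreeD(2)[OF u(1)] by (intro fun_of_free, auto simp: w_def)+
    have "pm 0 w 0 = (\<Sum>d\<in>X. pm 0 (u d) 0)"
      unfolding pmap_def w_def sum_distrib_right by (subst sum.swap) (simp add: nf_def restr_sum)
    also have "\<dots> = (\<Sum>d\<in>X. nf \<G> (hcomp d f))" by (simp flip: u_eq)
    also have "\<dots> = nf \<G> (\<Sum>d\<in>X. hcomp d f)" by (simp add: nf_def restr_sum)
    also have "\<dots> = nf \<G> f" by (simp only: f_sum)
    finally have "nf \<G> (f - e \<bullet> vec (length (l 0)) w) = 0"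
      using aug_in_I_iff(2)[OF w(1)] w(2) by (simp add: nf_def restr_diff)
    then have "f - e \<bullet> vec (length (l 0)) w \<in> I"
      using f aug_in_I_iff(3)[OF w(1)] by (auto simp: I_iff)
    then show "\<exists>v\<in>free_module V (length (l 0)). f - e \<bullet> v \<in> I" using w(1) by blast
  qed
qed

text \<open>Exactness passes through the two preceding equivalences. Minimality does as well: the
  syzygies are the images of the matrices, so they lack constant coefficients exactly if the matrix
  entries do.\<close>

lemma graded_resolution_iff:
  "minimal_graded_free_resolution V I l e D \<longleftrightarrow> graded_resolution \<G> V l gens"
proof
  assume "minimal_graded_free_resolution V I l e D"
  then interpret minimal_graded_free_resolution V I l e D .
  have ker: "kernel_vecs q = (\<lambda>w. D q *\<^sub>v w) ` free_module V (length (l (Suc q)))" for q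
    using exact_aug exact_diff by (cases q) (auto simp: kernel_vecs_0 kernel_vecs_Suc)
  have "coef (w k) 0 = 0" if w: "w \<in> syz q d" for q d w k
  proof -
    have "w \<in> pm (Suc q) ` grfree V (l (Suc q)) d" using kernel_image_iff ker w by blast
    then obtain u where u: "w = pm (Suc q) u" by blast
    have "coef (u k' * gens (Suc q) k' k) 0 = 0" if k': "k' < length (l (Suc q))" for k'
    proof -
      have "coef (gens (Suc q) k' k) 0 = 0"
      proof (cases "k < length (l q)")
        case True
        then show ?thesis using minimal[OF True k'] D_gens[OF True k'] by (simp add: irrelevant_ideal_iff)
      next
        case False
        then show ?thesis using grfreeD(2)[OF gens[OF k'], of k] by simp
      qed
      then have "gens (Suc q) k' k \<in> ideal_gen V (Var ` V)"
        using gens_poly[OF k'] by (simp add: irrelevant_ideal_iff)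
      have "0 \<notin> keysp (u k' * gens (Suc q) k' k)"
      proof
        assume "0 \<in> keysp (u k' * gens (Suc q) k' k)"
        then obtain a b where "0 = a + b" "b \<in> keysp (gens (Suc q) k' k)"
          using keys_mult[of "u k'" "gens (Suc q) k' k"] by auto
        then have "b = 0" using keys_add_nat[of a b] by (metis keys_eq_empty keys_zero sup_eq_bot_iff)
        then show False using \<open>b \<in> _\<close> \<open>coef (gens (Suc q) k' k) 0 = 0\<close> by (simp add: in_keys_iff)
      qed
      then show ?thesis by (simp add: in_keys_iff)
    qed
    then show ?thesis unfolding u pmap_def by (simp add: res_gens_def lookup_sum)
  qed
  moreover have "res_module \<G> V l gens q d = pm q ` grfree V (l q) d" for q d
    using aug_surjective_iff aug_surjective kernel_image_iff ker
    by (cases q) (auto simp: res_gens_def)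
  ultimately show "graded_resolution \<G> V l gens"
    unfolding graded_resolution_def presents_def by blast
next
  assume res: "graded_resolution \<G> V l gens"
  have M: "res_module \<G> V l gens q d = pm q ` grfree V (l q) d" for q d
    using res unfolding graded_resolution_def presents_def by blast
  have min: "coef (w k) 0 = 0" if "w \<in> syz q d" for q d w k
    using res that unfolding graded_resolution_def presents_def by blast
  have syz_eq: "syz q d = pm (Suc q) ` grfree V (l (Suc q)) d" for q d
    using M[of "Suc q" d] by (simp add: res_gens_def)
  then have ker: "kernel_vecs q = (\<lambda>w. D q *\<^sub>v w) ` free_module V (length (l (Suc q)))" for q
    using kernel_image_iff by blast
  have D_hpoly: "D q $$ (i, k) \<in> hpoly V (l (Suc q) ! k - l q ! i)"
    if "i < length (l q)" "k < length (l (Suc q))" for q i k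
    using grfreeD(1)[OF gens[OF that(2)], of i] that by (simp add: D_gens)
  have e_hpoly: "e $ k \<in> hpoly V (l 0 ! k)" if "k < length (l 0)" for k
    using grfreeD(1)[OF gens[OF that], of 0] that by (simp add: e_gens)
  have D_coef: "coef (D q $$ (i, k)) 0 = 0" if ik: "i < length (l q)" "k < length (l (Suc q))" for q i k
  proof -
    \<comment> \<open>Column \<open>k\<close> is the image of a basis vector, hence a
      syzygy.\<close>
    define \<delta> where "\<delta> = (\<lambda>k'. if k' = k then 1 else 0 :: ('v, 'k) mpoly)"
    have "\<delta> \<in> grfree V (l (Suc q)) (l (Suc q) ! k)"
      using ik by (intro grfreeI) (auto simp: \<delta>_def)
    then have "pm (Suc q) \<delta> \<in> syz q (l (Suc q) ! k)" using syz_eq by blast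
    from min[OF this, of i] have "coef (pm (Suc q) \<delta> i) 0 = 0" .
    moreover have "pm (Suc q) \<delta> = gens (Suc q) k"
      unfolding \<delta>_def using pmap_unit[OF ik(2), of _ "gens (Suc q)"] by (simp add: res_gens_def)
    ultimately show ?thesis using ik by (simp add: D_gens)
  qed
  show "minimal_graded_free_resolution V I l e D"
  proof
    show "e \<in> free_module V (length (l 0))"
      using e_carrier e_hpoly hpoly_poly_ring by (auto simp: free_module_def)
    show "homogeneous (l 0 ! k) (e $ k)" if "k < length (l 0)" for k
      using e_hpoly[OF that] by (simp add: hpoly_def)
    show "\<exists>v\<in>free_module V (length (l 0)). f - e \<bullet> v \<in> I" if "f \<in> poly_ring V" for f
      using aug_surjective_iff M[of 0] that by auto
    show "D i \<in> carrier_mat (length (l i)) (length (l (Suc i)))" for i by (rule D_carrier)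
    show "D q $$ (i, k) \<in> poly_ring V" "homogeneous (l (Suc q) ! k - l q ! i) (D q $$ (i, k))"
      "D q $$ (i, k) \<in> ideal_gen V (Var ` V)"
      if "i < length (l q)" "k < length (l (Suc q))" for q i k
      using D_hpoly[OF that] D_coef[OF that] by (auto simp: hpoly_def irrelevant_ideal_iff)
    show "{v \<in> free_module V (length (l 0)). e \<bullet> v \<in> I} =
        (\<lambda>w. D 0 *\<^sub>v w) ` free_module V (length (l 1))"
      using ker[of 0] by (simp add: kernel_vecs_0)
    show "{v \<in> free_module V (length (l (Suc i))). D i *\<^sub>v v = 0\<^sub>v (length (l i))} =
        (\<lambda>w. D (Suc i) *\<^sub>v w) ` free_module V (length (l (Suc (Suc i))))" for i
      using ker[of "Suc i"] by (simp add: kernel_vecs_Suc)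
  qed
qed

end

section \<open>Regularity of cycles and wheels\<close>

lemma exists_minimal_resolution:
  fixes V :: "'v::linorder set"
  assumes V: "finite V" and G: "\<And>A. A \<in> \<G> \<Longrightarrow> A \<subseteq> V"
  shows "\<exists>d e D. minimal_graded_free_resolution V
    (ideal_gen V {\<Prod>x\<in>A. Var x | A. A \<in> \<G>} :: ('v, 'k::field) mpoly set) d e D"
proof -
  \<comment> \<open>Contributing multidegrees are subsets of \<open>V\<close>, so
    \<open>card V\<close> serves as the bound \<open>J\<close>.\<close>
  have hv: "hvan \<G> V (std_module \<G> V :: ('v, 'k) grmod) p j" if "j > int (card V)" for p j
    unfolding hochster[OF V]
  proof (intro allI impI)
    fix \<sigma> assume "\<sigma> \<subseteq> V" "int (card \<sigma>) = j"
    then have False using that card_mono[OF V \<open>\<sigma> \<subseteq> V\<close>] by simp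
    then show "vanishing TYPE('k) (card \<sigma> - p) (cpx \<sigma> \<G>)" ..
  qed
  obtain l and g :: "nat \<Rightarrow> nat \<Rightarrow> nat \<Rightarrow> ('v, 'k) mpoly" where res: "graded_resolution \<G> V l g"
    and g: "\<And>q k. k < length (l q) \<Longrightarrow> g q k \<in> res_module \<G> V l g q (l q ! k)"
    using exists_graded_resolution[OF V, where J = "card V", OF hv] by auto
  have g': "g q k \<in> grfree V (ambient l q) (l q ! k)" if "k < length (l q)" for q k
    using g[OF that]
    by (cases q) (auto simp: std_module_def syzygies_def intro!: grfreeI)
  define e where "e = vec (length (l 0)) (\<lambda>k. g 0 k 0)"
  define D where "D q = mat (length (l q)) (length (l (Suc q))) (\<lambda>(i, k). g (Suc q) k i)" for q
  interpret resolution_coordinates V \<G> l g e D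
    by unfold_locales (use V G g' in \<open>auto simp: e_def D_def\<close>)
  show ?thesis using graded_resolution_iff res by blast
qed

text \<open>Stated for an arbitrary minimal resolution, in order to apply to the one selected by
  \<open>resolution_degrees\<close>.\<close>

lemma minimal_resolution_degrees:
  fixes V :: "'v::linorder set"
  assumes V: "finite V" and G: "\<And>A. A \<in> \<G> \<Longrightarrow> A \<subseteq> V"
    and res: "minimal_graded_free_resolution V
      (ideal_gen V {\<Prod>x\<in>A. Var x | A. A \<in> \<G>} :: ('v, 'k::field) mpoly set) d e D"
  shows "j \<in> set (d i) \<longleftrightarrow> \<not> hvan \<G> V (std_module \<G> V :: ('v, 'k) grmod) i j"
proof -
  interpret R: minimal_graded_free_resolution V
    "ideal_gen V {\<Prod>x\<in>A. Var x | A. A \<in> \<G>} :: ('v, 'k) mpoly set" d e D by (rule res)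
  define g where "g q k = (\<lambda>i. case q of 0 \<Rightarrow> if i = 0 then e $ k else 0
      | Suc q' \<Rightarrow> if i < length (d q') then D q' $$ (i, k) else 0)" for q k
  have gens: "g q k \<in> grfree V (ambient d q) (d q ! k)" if "k < length (d q)" for q k
  proof (cases q)
    case 0
    have "e $ k \<in> poly_ring V" using R.aug_carrier that 0 by (auto simp: free_module_def)
    then have "e $ k \<in> hpoly V (d 0 ! k)" using R.aug_homogeneous that 0 by (simp add: hpoly_def)
    then show ?thesis by (intro grfreeI) (auto simp: 0 g_def)
  next
    case (Suc q')
    then show ?thesis using that R.diff_entries R.diff_homogeneous
      by (intro grfreeI) (auto simp: g_def hpoly_def)
  qed
  interpret C: resolution_coordinates V \<G> d g e D
  proof
    show "e \<in> carrier_vec (length (d 0))" using R.aug_carrier by (simp add: free_module_def)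
  qed (use V G gens R.diff_carrier in \<open>simp_all add: g_def\<close>)
  show ?thesis by (rule graded_resolution_degrees[OF V]) (use C.graded_resolution_iff res in blast)
qed

text \<open>Hochster's formula turns the regularity into the largest dimension (shifted by one) of a
  nonvanishing cohomology class of an induced subcomplex.\<close>

lemma regularity_eqI:
  fixes V :: "'v::linorder set"
  assumes V: "finite V" and G: "\<And>A. A \<in> \<G> \<Longrightarrow> A \<subseteq> V"
    and upper: "\<And>\<sigma> t. \<sigma> \<subseteq> V \<Longrightarrow> \<rho> < t \<Longrightarrow> vanishing TYPE('k::field) t (cpx \<sigma> \<G>)"
    and attained: "\<exists>\<sigma>\<subseteq>V. \<not> vanishing TYPE('k) \<rho> (cpx \<sigma> \<G>)"
  shows "regularity V (ideal_gen V {\<Prod>x\<in>A. Var x | A. A \<in> \<G>} :: ('v, 'k) mpoly set) = int \<rho>"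
proof -
  let ?I = "ideal_gen V {\<Prod>x\<in>A. Var x | A. A \<in> \<G>} :: ('v, 'k) mpoly set"
  have "\<exists>e D. minimal_graded_free_resolution V ?I (resolution_degrees V ?I) e D"
    unfolding resolution_degrees_def
    using someI_ex[of "\<lambda>d. \<exists>e D. minimal_graded_free_resolution V ?I d e D"]
      exists_minimal_resolution[OF V G] by blast
  then have "j \<in> set (resolution_degrees V ?I i) \<longleftrightarrow>
      \<not> hvan \<G> V (std_module \<G> V :: ('v, 'k) grmod) i j" for i j
    using minimal_resolution_degrees[OF V G] by blast
  then have betti: "graded_betti V ?I i j \<noteq> 0 \<longleftrightarrow> (\<exists>\<sigma>\<subseteq>V. int (card \<sigma>) = j \<and> i \<le> card \<sigma> \<and>
      \<not> vanishing TYPE('k) (card \<sigma> - i) (cpx \<sigma> \<G>))" for i j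
    unfolding graded_betti_def hochster[OF V] by (simp add: count_list_0_iff) metis
  let ?S = "{j - int i | i j. graded_betti V ?I i j \<noteq> 0}"
  have S_le: "x \<in> int ` {..\<rho>}" if x: "x \<in> ?S" for x
  proof -
    obtain i j where ij: "x = j - int i" "graded_betti V ?I i j \<noteq> 0" using x by auto
    obtain \<sigma> where \<sigma>: "\<sigma> \<subseteq> V" "int (card \<sigma>) = j" "i \<le> card \<sigma>"
      "\<not> vanishing TYPE('k) (card \<sigma> - i) (cpx \<sigma> \<G>)" using iffD1[OF betti ij(2)] by auto
    have "card \<sigma> - i \<le> \<rho>" using upper[OF \<sigma>(1), of "card \<sigma> - i"] \<sigma>(4) by (meson not_le)
    moreover have "x = int (card \<sigma> - i)" using \<sigma> ij(1) by auto
    ultimately show ?thesis by blast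
  qed
  have "int \<rho> \<in> ?S"
  proof -
    obtain \<sigma> where \<sigma>: "\<sigma> \<subseteq> V" "\<not> vanishing TYPE('k) \<rho> (cpx \<sigma> \<G>)" using attained by blast
    \<comment> \<open>Keeps the homological degree \<open>card \<sigma> - \<rho>\<close> from being
      truncated.\<close>
    have "\<rho> \<le> card \<sigma>"
      using \<sigma> vanishing_trivial[of \<sigma> \<rho>] finite_subset[OF _ V] by (meson not_le)
    then have "graded_betti V ?I (card \<sigma> - \<rho>) (int (card \<sigma>)) \<noteq> 0"
      unfolding betti using \<sigma> by (intro exI[of _ \<sigma>]) simp
    moreover have "int \<rho> = int (card \<sigma>) - int (card \<sigma> - \<rho>)" using \<open>\<rho> \<le> card \<sigma>\<close> by simp
    ultimately show ?thesis by blast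
  qed
  \<comment> \<open>\<open>Max\<close> requires a finite set; all values lie between 0 and
    \<open>\<rho>\<close>.\<close>
  moreover have "finite ?S"
    by (rule finite_subset[of _ "int ` {..\<rho>}"]) (use S_le in blast, simp)
  ultimately show ?thesis
    unfolding regularity_def by (intro Max_eqI) (use S_le in fastforce)+
qed

section \<open>Connected vertex sets of cycles and wheels\<close>

lemma connected_induced_iff:
  assumes sym: "sym (parcs G)"
  shows "Digraph_Component.connected (with_proj G \<restriction> A) \<longleftrightarrow>
    A \<noteq> {} \<and> (\<forall>u\<in>A. \<forall>v\<in>A. (u, v) \<in> (parcs G \<inter> A \<times> A)\<^sup>*)"
proof -
  let ?R = "parcs G \<inter> A \<times> A"
  have "parcs (mk_symmetric (with_proj G \<restriction> A)) = ?R"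
    using sym by (auto simp: parcs_mk_symmetric dest: symD)
  then have ends: "arcs_ends (with_proj (mk_symmetric (with_proj G \<restriction> A))) = ?R"
    by (simp add: arcs_ends_conv)
  have "(u, v) \<in> rtrancl_on A ?R" if "(u, v) \<in> ?R\<^sup>*" "u \<in> A" for u v
    using that(1)
  proof (induction rule: rtrancl_induct)
    case base
    then show ?case using that(2) by (rule rtrancl_on_refl)
  next
    case (step y z)
    then show ?case by (auto intro: rtrancl_on_into_rtrancl_on)
  qed
  moreover have "(u, v) \<in> ?R\<^sup>*" if "(u, v) \<in> rtrancl_on A ?R" for u v
    using that by (rule rtrancl_on_rtranclI)
  ultimately show ?thesis
    unfolding Digraph_Component.connected_def strongly_connected_def reachable_def ends by auto
qed

lemma card_arc: "s < n \<Longrightarrow> r < n \<Longrightarrow> card (arc n r s) = r + 1"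
proof -
  assume "s < n" "r < n"
  then show ?thesis
  proof (cases "s + r < n")
    case False
    then have "arc n r s = {s..<n} \<union> {..s + r - n}" using \<open>s < n\<close> \<open>r < n\<close> by (simp add: arc_eq)
    moreover have "{s..<n} \<inter> {..s + r - n} = {}" using False \<open>r < n\<close> by auto
    ultimately have "card (arc n r s) = (n - s) + (s + r - n + 1)" by (simp add: card_Un_disjoint)
    then show ?thesis using False \<open>s < n\<close> by simp
  qed (simp add: arc_eq)
qed

lemma arc_subset: "0 < n \<Longrightarrow> arc n r s \<subseteq> {..<n}"
  by (auto simp: arc_def)

lemma sym_cycle: "sym (parcs (cycle_graph n))"
  by (auto simp: cycle_graph_def sym_def)

lemma sym_wheel: "sym (parcs (wheel_graph n))"
  by (auto simp: wheel_graph_def cycle_graph_def sym_def)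

lemma connected_arc:
  assumes "0 < n" "s < n"
  shows "Digraph_Component.connected (with_proj (cycle_graph n) \<restriction> arc n r s)"
  unfolding connected_induced_iff[OF sym_cycle]
proof (intro conjI ballI)
  let ?A = "arc n r s"
  let ?R = "parcs (cycle_graph n) \<inter> ?A \<times> ?A"
  have "((s + i) mod n, (s + Suc i) mod n) \<in> ?R" if "Suc i \<le> r" for i
  proof -
    have "(s + i) mod n \<in> ?A" "(s + Suc i) mod n \<in> ?A"
      unfolding arc_def using that by (intro imageI; simp)+
    moreover have "(s + Suc i) mod n = ((s + i) mod n + 1) mod n" by (simp add: mod_Suc_eq)
    ultimately show ?thesis using assms(1) by (simp add: cycle_graph_def)
  qed
  then have "i \<le> r \<Longrightarrow> (s mod n, (s + i) mod n) \<in> ?R\<^sup>*" for i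
  proof (induction i)
    case (Suc i)
    then show ?case by (meson Suc_leD rtrancl.rtrancl_into_rtrancl)
  qed simp
  then have from_s: "(s mod n, u) \<in> ?R\<^sup>*" if "u \<in> ?A" for u
    using that by (auto simp: arc_def)
  have "sym (?R\<^sup>*)" using sym_cycle by (intro sym_rtrancl) (auto simp: sym_def)
  then show "(u, v) \<in> ?R\<^sup>*" if "u \<in> ?A" "v \<in> ?A" for u v
    using from_s[OF that(1)] from_s[OF that(2)] by (meson rtrancl_trans symD)
qed (simp add: arc_def)

text \<open>Going around from a vertex \<open>c\<close> outside \<open>A\<close>, let
  \<open>s\<close> be the first vertex of \<open>A\<close> and \<open>k\<close> the length of the
  run of \<open>A\<close> that begins there. Both ends of the run border on vertices outside
  \<open>A\<close>, so no edge inside \<open>A\<close> leaves it, and connectedness makes it all of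
  \<open>A\<close>.\<close>

lemma connected_imp_arc:
  assumes rn: "r < n" and A: "A \<subseteq> {..<n}" "card A = r + 1"
    and conn: "Digraph_Component.connected (with_proj (cycle_graph n) \<restriction> A)"
  shows "A \<in> arc_sets n r"
proof (cases "A = {..<n}")
  case True
  then have "n = r + 1" using A by simp
  then show ?thesis using True by (simp add: arc_sets_full)
next
  case False
  then obtain c where c: "c < n" "c \<notin> A" using A by auto
  have n: "0 < n" using rn by simp
  have "A \<noteq> {}" using A by auto
  then obtain a where "a \<in> A" by blast
  then have a: "a < n" using A by auto
  have "(c + (a + n - c)) mod n \<in> A" using \<open>a \<in> A\<close> a c by simp
  then have ex: "\<exists>i. (c + i) mod n \<in> A" by blast
  define m where "m = (LEAST i. (c + i) mod n \<in> A)"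
  have m: "(c + m) mod n \<in> A" unfolding m_def using ex by (rule LeastI_ex)
  have "m \<noteq> 0" using m c by (metis add_0_right mod_less)
  then obtain m' where m': "m = Suc m'" by (cases m) auto
  have pred: "(c + m') mod n \<notin> A" using not_less_Least[of m' "\<lambda>i. (c + i) mod n \<in> A"] m' by (simp add: m_def)
  define s where "s = (c + m) mod n"
  have s: "s < n" "s \<in> A" using n m by (auto simp: s_def)
  \<comment> \<open>The predecessor of \<open>s\<close> on the circle is unique and, by the choice
    of \<open>m\<close>, outside \<open>A\<close>.\<close>
  have pred_s: "y \<notin> A" if "(y + 1) mod n = s" "y < n" for y
  proof -
    have "(y + 1) mod n = ((c + m') mod n + 1) mod n" using that by (simp add: s_def m' mod_Suc_eq)
    then have "y = (c + m') mod n" using that(2) n by (auto simp: mod_Suc split: if_splits)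
    then show ?thesis using pred by simp
  qed
  define f where "f i = (s + i) mod n" for i
  have f_Suc: "f (Suc i) = (f i + 1) mod n" for i by (simp add: f_def mod_Suc_eq)
  have f_lt: "f i < n" for i using n by (simp add: f_def)
  have "f (n - 1) \<notin> A"
  proof (rule pred_s)
    show "(f (n - 1) + 1) mod n = s" using f_Suc[of "n - 1"] n s by (simp add: f_def)
  qed (rule f_lt)
  then have ex2: "\<exists>i. f i \<notin> A" by blast
  \<comment> \<open>The run stops at the latest before \<open>f (n - 1)\<close>, the predecessor of
    \<open>s\<close>, so it does not close up around the circle.\<close>
  define k where "k = (LEAST i. f i \<notin> A)"
  have k: "f k \<notin> A" unfolding k_def using ex2 by (rule LeastI_ex)
  have k_le: "k \<le> n - 1" unfolding k_def by (rule Least_le) fact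
  have below: "f i \<in> A" if "i < k" for i using not_less_Least[of i "\<lambda>i. f i \<notin> A"] that by (auto simp: k_def)
  have f0: "f 0 = s" using s by (simp add: f_def)
  have "k \<noteq> 0" using k f0 s(2) by metis
  have closed: "y \<in> f ` {..<k}" if xy: "x \<in> f ` {..<k}" "(x, y) \<in> parcs (cycle_graph n) \<inter> A \<times> A" for x y
  proof -
    obtain i where i: "i < k" "x = f i" using xy by auto
    have y: "y < n" "y \<in> A" "y = (x + 1) mod n \<or> x = (y + 1) mod n"
      using xy by (auto simp: cycle_graph_def)
    from y(3) show ?thesis
    proof
      assume "y = (x + 1) mod n"
      then have "y = f (Suc i)" using i f_Suc by simp
      then have "Suc i < k" using y k i by (metis Suc_lessI)
      then show ?thesis using \<open>y = f (Suc i)\<close> by blast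
    next
      assume x: "x = (y + 1) mod n"
      show ?thesis
      proof (cases i)
        case 0
        then show ?thesis using pred_s[of y] x y i f0 by simp
      next
        case (Suc i')
        then have "(y + 1) mod n = (f i' + 1) mod n" using x i f_Suc by simp
        then have "y = f i'" using y(1) f_lt[of i'] by (auto simp: mod_Suc split: if_splits)
        then show ?thesis using Suc i by auto
      qed
    qed
  qed
  have "u \<in> f ` {..<k}" if "u \<in> A" for u
  proof -
    have "(s, u) \<in> (parcs (cycle_graph n) \<inter> A \<times> A)\<^sup>*"
      using conn s that unfolding connected_induced_iff[OF sym_cycle] by blast
    then show ?thesis
    proof (induction rule: rtrancl_induct)
      case base
      then show ?case using f0 \<open>k \<noteq> 0\<close> by (intro image_eqI[of _ _ 0]) auto
    next
      case (step y z)
      then show ?case using closed by blast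
    qed
  qed
  then have A_eq: "A = f ` {..<k}" using below by auto
  have "arc n (k - 1) s = f ` {..<k}"
    using \<open>k \<noteq> 0\<close> unfolding arc_def f_def by (intro image_cong) auto
  then have "card A = k" using card_arc[OF s(1), of "k - 1"] k_le \<open>k \<noteq> 0\<close> n A_eq by simp
  then have "k - 1 = r" using A by simp
  then show ?thesis using \<open>arc n (k - 1) s = f ` {..<k}\<close> A_eq s by (auto simp: arc_sets_def)
qed

lemma cycle_connected_subsets:
  assumes "r < n"
  shows "{A. A \<subseteq> pverts (cycle_graph n) \<and> card A = r + 1 \<and>
      Digraph_Component.connected (with_proj (cycle_graph n) \<restriction> A)} = arc_sets n r"
proof (intro equalityI subsetI)
  fix A assume "A \<in> arc_sets n r"
  then obtain s where "s < n" "A = arc n r s" by (auto simp: arc_sets_def)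
  then show "A \<in> {A. A \<subseteq> pverts (cycle_graph n) \<and> card A = r + 1 \<and>
      Digraph_Component.connected (with_proj (cycle_graph n) \<restriction> A)}"
    using arc_subset[of n r s] card_arc[of s n r] connected_arc[of n s r] assms
    by (simp add: cycle_graph_def)
qed (use connected_imp_arc[OF assms] in \<open>auto simp: cycle_graph_def\<close>)

lemma wheel_connected_subsets:
  assumes r: "1 \<le> r" and rn: "r < n"
  shows "{A. A \<subseteq> pverts (wheel_graph n) \<and> card A = r + 1 \<and>
      Digraph_Component.connected (with_proj (wheel_graph n) \<restriction> A)} = wheel_gens n r"
proof -
  have verts: "pverts (wheel_graph n) = insert n {..<n}" by (simp add: wheel_graph_def cycle_graph_def)
  have rim: "Digraph_Component.connected (with_proj (wheel_graph n) \<restriction> A) \<longleftrightarrow>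
      Digraph_Component.connected (with_proj (cycle_graph n) \<restriction> A)" if "n \<notin> A" for A
  proof -
    have "parcs (wheel_graph n) \<inter> A \<times> A = parcs (cycle_graph n) \<inter> A \<times> A"
      using that by (auto simp: wheel_graph_def)
    then show ?thesis by (simp add: connected_induced_iff sym_cycle sym_wheel)
  qed
  have hub: "Digraph_Component.connected (with_proj (wheel_graph n) \<restriction> insert n S)"
    if "S \<subseteq> {..<n}" for S
    unfolding connected_induced_iff[OF sym_wheel]
  proof (intro conjI ballI)
    let ?R = "parcs (wheel_graph n) \<inter> insert n S \<times> insert n S"
    have "(u, n) \<in> ?R\<^sup>* \<and> (n, u) \<in> ?R\<^sup>*" if "u \<in> insert n S" for u
      using that \<open>S \<subseteq> {..<n}\<close> by (cases "u = n") (auto simp: wheel_graph_def cycle_graph_def)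
    then show "(u, v) \<in> ?R\<^sup>*" if "u \<in> insert n S" "v \<in> insert n S" for u v
      using that by (meson rtrancl_trans)
  qed simp
  show ?thesis
  proof (intro equalityI subsetI)
    fix A assume A: "A \<in> {A. A \<subseteq> pverts (wheel_graph n) \<and> card A = r + 1 \<and>
        Digraph_Component.connected (with_proj (wheel_graph n) \<restriction> A)}"
    show "A \<in> wheel_gens n r"
    proof (cases "n \<in> A")
      case True
      have "A = insert n (A - {n})" "A - {n} \<subseteq> {..<n}" "card (A - {n}) = r"
        using A True by (auto simp: verts)
      then show ?thesis unfolding wheel_gens_def by blast
    next
      case False
      then have "A \<in> arc_sets n r" using A rim[OF False] by (intro connected_imp_arc[OF rn]) (auto simp: verts)
      then show ?thesis by (simp add: wheel_gens_def)
    qed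
  next
    fix A assume "A \<in> wheel_gens n r"
    then consider "A \<in> arc_sets n r" | S where "A = insert n S" "S \<subseteq> {..<n}" "card S = r"
      by (auto simp: wheel_gens_def)
    then show "A \<in> {A. A \<subseteq> pverts (wheel_graph n) \<and> card A = r + 1 \<and>
        Digraph_Component.connected (with_proj (wheel_graph n) \<restriction> A)}"
    proof cases
      case 1
      then have *: "A \<subseteq> pverts (cycle_graph n) \<and> card A = r + 1 \<and>
          Digraph_Component.connected (with_proj (cycle_graph n) \<restriction> A)"
        using cycle_connected_subsets[OF rn] by blast
      then have "n \<notin> A" by (auto simp: cycle_graph_def)
      then show ?thesis using * rim by (auto simp: wheel_graph_def)
    next
      case 2
      have "n \<notin> S" "finite S" using 2(2) finite_subset by auto
      then show ?thesis using 2 hub[OF 2(2)] by (auto simp: verts)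
    qed
  qed
qed

lemma connected_ideal_cycle:
  assumes "r < n"
  shows "connected_ideal (cycle_graph n) r = ideal_gen {..<n} {\<Prod>x\<in>A. Var x | A. A \<in> arc_sets n r}"
proof -
  have *: "A \<subseteq> pverts (cycle_graph n) \<and> card A = r + 1 \<and>
      Digraph_Component.connected (with_proj (cycle_graph n) \<restriction> A) \<longleftrightarrow> A \<in> arc_sets n r" for A
    using cycle_connected_subsets[OF assms] by blast
  have "pverts (cycle_graph n) = {..<n}" by (simp add: cycle_graph_def)
  then show ?thesis unfolding connected_ideal_def * by simp
qed

lemma connected_ideal_wheel:
  assumes "1 \<le> r" "r < n"
  shows "connected_ideal (wheel_graph n) r = ideal_gen {..n} {\<Prod>x\<in>A. Var x | A. A \<in> wheel_gens n r}"
proof -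
  have *: "A \<subseteq> pverts (wheel_graph n) \<and> card A = r + 1 \<and>
      Digraph_Component.connected (with_proj (wheel_graph n) \<restriction> A) \<longleftrightarrow> A \<in> wheel_gens n r" for A
    using wheel_connected_subsets[OF assms] by blast
  have "pverts (wheel_graph n) = {..n}"
    by (auto simp: wheel_graph_def cycle_graph_def)
  then show ?thesis unfolding connected_ideal_def * by simp
qed

theorem corollary4p11:
  fixes n r p q :: nat
  assumes "n \<ge> 3" and "1 \<le> r" and "r \<le> n - 1"
    and "n = (r + 2) * p + q" and "q \<le> r + 1"
  shows "regularity (pverts (wheel_graph n)) (connected_ideal (wheel_graph n) r :: (nat, 'k::field) mpoly set)
       = regularity (pverts (cycle_graph n)) (connected_ideal (cycle_graph n) r :: (nat, 'k) mpoly set)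
    \<and> regularity (pverts (cycle_graph n)) (connected_ideal (cycle_graph n) r :: (nat, 'k) mpoly set)
       = (if q \<noteq> 0 then int r * int p + int q - 1 else int r * int p)"
proof -
  have rn: "r < n" using assms by simp
  note hyps = assms(2) rn assms(4,5)
  have "regularity {..<n} (connected_ideal (cycle_graph n) r :: (nat, 'k) mpoly set) =
      int (cycle_reg r p q)"
    unfolding connected_ideal_cycle[OF rn]
  proof (rule regularity_eqI)
    show "A \<subseteq> {..<n}" if "A \<in> arc_sets n r" for A using that arc_subset[of n r] rn by (auto simp: arc_sets_def)
  qed (use cycle_vanishing[OF hyps] cycle_nonvanishing[OF hyps] in auto)
  moreover have "regularity {..n} (connected_ideal (wheel_graph n) r :: (nat, 'k) mpoly set) =
      int (cycle_reg r p q)"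
    unfolding connected_ideal_wheel[OF assms(2) rn]
  proof (rule regularity_eqI)
    show "A \<subseteq> {..n}" if "A \<in> wheel_gens n r" for A
      using that arc_subset[of n r] rn by (fastforce simp: arc_sets_def wheel_gens_def)
  qed (use wheel_vanishing[OF hyps] wheel_nonvanishing[OF hyps] in auto)
  moreover have "pverts (cycle_graph n) = {..<n}" "pverts (wheel_graph n) = {..n}"
    by (auto simp: cycle_graph_def wheel_graph_def)
  moreover have "int (cycle_reg r p q) = (if q \<noteq> 0 then int r * int p + int q - 1 else int r * int p)"
    by (auto simp: cycle_reg_def of_nat_diff)
  ultimately show ?thesis by simp
qed

end
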